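(* The following statements are equivalent: (a) $\mathcal R$ is well-quasi-ordered (under $<$); (b) $\mathcal R^\bullet$ is well-quasi-ordered (under $<_\bullet$); (c) $\mathcal R^{n\bullet}$ is well-quasi-ordered (under $<_\bullet$) for every $n\in\mathbb N$; (d) $\mathrm{Rank}^{n\bullet}_{<\alpha}$ is well-quasi-ordered (under $<_\bullet$) for every $n\in\mathbb N$ and every ordinal $\alpha<\omega_1$; (e) $\mathcal R$ has no (infinite) descending chain; (f) $\mathrm{Rank}_\alpha$ has no (infinite) descending chain for every ordinal $\alpha<\omega_1$; (g) $\mathcal R^\bullet$ has no (infinite) descending chain; (h) $\mathcal R$ has no infinite antichain; (i) $\mathcal R$ has no antichain of cardinality $2^{\aleph_0}$; (j) $|\mathrm{Rank}_\alpha|_<$ is countable for every ordinal $\alpha<\omega_1$; (k) $|\mathrm{Rank}^\bullet_\alpha|_{<_\bullet}$ is countable for every ordinal $\alpha<\omega_1$; (l) $|\mathrm{Rank}_\alpha|_<<2^{\aleph_0}$ for every ordinal $\alpha<\omega_1$.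
   Context: All graphs are countable. A graph is rayless if it contains no 1-way infinite path. $\mathcal R$ is the class of countable rayless graphs. Minors. A minor model of $G$ in $H$ is a collection of pairwise disjoint (non-empty) connected subgraphs $B_v$, $v\in V(G)$, of $H$ (branch sets), together with edges $E_{uv}$, $uv\in E(G)$, of $H$ such that each $E_{uv}$ has one end-vertex in $B_u$ and one in $B_v$; write $G<H$ if one exists. A marked graph is a pair $(G,M)$ with $M\subseteq V(G)$ the set of marked vertices. Write $(G,M)<_\bullet(H,M')$ (marked minor) if there is a minor model of $G$ in $H$ such that $B_v$ contains a vertex of $M'$ for every $v\in M$. (Marked) graphs are (marked-)minor-twins if each is a (marked) minor of the other; for a class $\mathcal C$ of graphs (respectively marked graphs), $|\mathcal C|_<$ (respectively $|\mathcal C|_{<_\bullet}$) is the cardinality of the set of (marked-)minor-twin classes of elements of $\mathcal C$. Unmarked classes are ordered by $<$ and marked ones by $<_\bullet$. $\mathcal R^\bullet$ is the class of marked graphs $(G,M)$ with $G\in\mathcal R$ and $M$ finite; $\mathcal R^{n\bullet}$ is the subclass of those with $|M|\leq n$. Rank. $\mathrm{Rank}_0$ is the class of finite graphs; for an ordinal $\alpha>0$, $G\in\mathrm{Rank}_\alpha$ if there is a finite $S\subset V(G)$ such that each component of $G-S$ lies in $\mathrm{Rank}_\beta$ for some $\beta<\alpha$. $\mathrm{Rank}_{<\alpha}:=\bigcup_{\beta<\alpha}\mathrm{Rank}_\beta$. $\mathrm{Rank}^\bullet_\alpha$ is the class of marked graphs $(G,M)$ with $G\in\mathrm{Rank}_\alpha$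 and $M$ finite; $\mathrm{Rank}^{n\bullet}_{<\alpha}$ is the class of marked graphs $(G,M)$ with $G\in\mathrm{Rank}_{<\alpha}$ and $|M|\leq n$. Orders. A quasi-order $(Q,\leq)$ is well-quasi-ordered if for every sequence $(q_n)_{n\in\mathbb N}$ in $Q$ there are $i<j$ with $q_i\leq q_j$. A descending chain is an infinite sequence $(q_n)_{n\in\mathbb N}$ with $q_{n+1}\leq q_n$ and $q_n\not\leq q_{n+1}$ for all $n$. An antichain is a set of pairwise incomparable elements. *)

theory Defs
  imports Main "HOL-Library.Countable_Set" "HOL-Library.Equipollence"
begin

section \<open>Graphs\<close>

record 'a ugraph =
  vertices :: "'a set"
  edges :: "'a set set"

text \<open>Graphs are simple and undirected; they may be infinite, and the null graph is allowed.\<close>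

definition wf_ugraph :: "'a ugraph \<Rightarrow> bool" where
  "wf_ugraph G \<longleftrightarrow> (\<forall>e\<in>edges G. e \<subseteq> vertices G \<and> card e = 2)"

definition subgraph :: "'a ugraph \<Rightarrow> 'a ugraph \<Rightarrow> bool" where
  "subgraph H G \<longleftrightarrow> wf_ugraph H \<and> vertices H \<subseteq> vertices G \<and> edges H \<subseteq> edges G"

definition induced_subgraph :: "'a ugraph \<Rightarrow> 'a set \<Rightarrow> 'a ugraph" where
  "induced_subgraph G W =
     \<lparr>vertices = vertices G \<inter> W, edges = {e \<in> edges G. e \<subseteq> W}\<rparr>"

definition delete_vertices :: "'a ugraph \<Rightarrow> 'a set \<Rightarrow> 'a ugraph" where
  "delete_vertices G S = induced_subgraph G (- S)"

definition adjacent :: "'a ugraph \<Rightarrow> 'a \<Rightarrow> 'a \<Rightarrow> bool" where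
  "adjacent G x y \<longleftrightarrow> {x, y} \<in> edges G"

abbreviation reachable_in :: "'a ugraph \<Rightarrow> 'a \<Rightarrow> 'a \<Rightarrow> bool" where
  "reachable_in G \<equiv> (adjacent G)\<^sup>*\<^sup>*"

definition nonempty_connected :: "'a ugraph \<Rightarrow> bool" where
  "nonempty_connected G \<longleftrightarrow>
     vertices G \<noteq> {} \<and> (\<forall>x\<in>vertices G. \<forall>y\<in>vertices G. reachable_in G x y)"

definition graph_components :: "'a ugraph \<Rightarrow> 'a ugraph set" where
  "graph_components G = {induced_subgraph G {y. reachable_in G x y} | x. x \<in> vertices G}"

definition rayless :: "'a ugraph \<Rightarrow> bool" where
  "rayless G \<longleftrightarrow> \<not> (\<exists>p :: nat \<Rightarrow> 'a. inj p \<and> (\<forall>n. {p n, p (Suc n)} \<in> edges G))"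


section \<open>Minors and marked minors\<close>

text \<open>\<open>B\<close> gives the branch sets, and \<open>E\<close> maps each edge of \<open>G\<close> to the edge of \<open>H\<close> modelling it;
  the values of \<open>B\<close> and \<open>E\<close> outside \<open>vertices G\<close> and \<open>edges G\<close> are irrelevant.\<close>

definition minor_model ::
  "('a \<Rightarrow> 'b ugraph) \<Rightarrow> ('a set \<Rightarrow> 'b set) \<Rightarrow> 'a ugraph \<Rightarrow> 'b ugraph \<Rightarrow> bool" where
  "minor_model B E G H \<longleftrightarrow>
     (\<forall>v\<in>vertices G. subgraph (B v) H \<and> nonempty_connected (B v)) \<and>
     (\<forall>u\<in>vertices G. \<forall>v\<in>vertices G. u \<noteq> v \<longrightarrow> vertices (B u) \<inter> vertices (B v) = {}) \<and>
     (\<forall>u v. {u, v} \<in> edges G \<longrightarrow>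
        E {u, v} \<in> edges H \<and> (\<exists>x\<in>vertices (B u). \<exists>y\<in>vertices (B v). E {u, v} = {x, y}))"

definition minor :: "'a ugraph \<Rightarrow> 'b ugraph \<Rightarrow> bool" where
  "minor G H \<longleftrightarrow> (\<exists>B E. minor_model B E G H)"

type_synonym 'a marked_graph = "'a ugraph \<times> 'a set"

definition marked_minor :: "'a marked_graph \<Rightarrow> 'b marked_graph \<Rightarrow> bool" where
  "marked_minor = (\<lambda>(G, M) (H, M').
     \<exists>B E. minor_model B E G H \<and> (\<forall>v\<in>M. vertices (B v) \<inter> M' \<noteq> {}))"


section \<open>Countable ordinals\<close>

text \<open>As a well-order, \<^term>\<open>cardSuc natLeq\<close> is \<open>\<omega>\<^sub>1\<close>, so its elements
  in their order are the ordinals below \<open>\<omega>\<^sub>1\<close>.\<close>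

typedef countable_ordinal = "Field (cardSuc natLeq)"
proof -
  have "Field (cardSuc natLeq) \<noteq> {}"
    using cardSuc_finite[OF natLeq_Card_order] by (auto simp: Field_natLeq)
  then show ?thesis by blast
qed

instantiation countable_ordinal :: wellorder
begin

definition less_eq_countable_ordinal where
  "\<alpha> \<le> \<beta> \<longleftrightarrow> (Rep_countable_ordinal \<alpha>, Rep_countable_ordinal \<beta>) \<in> cardSuc natLeq"

definition less_countable_ordinal where
  "(\<alpha> :: countable_ordinal) < \<beta> \<longleftrightarrow> \<alpha> \<le> \<beta> \<and> \<alpha> \<noteq> \<beta>"

instance
proof -
  let ?r = "cardSuc natLeq"
  let ?R = Rep_countable_ordinal
  have wo: "Well_order ?r"
    by (simp add: cardSuc_Well_order natLeq_Card_order)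
  then have refl: "refl_on (Field ?r) ?r" and trans: "trans ?r" and antisym: "antisym ?r"
    and total: "total_on (Field ?r) ?r" and wf: "wf (?r - Id)"
    by (auto simp: order_on_defs)
  have le_refl: "\<alpha> \<le> \<alpha>" for \<alpha> :: countable_ordinal
    using refl Rep_countable_ordinal by (auto simp: less_eq_countable_ordinal_def refl_on_def)
  have le_antisym: "\<alpha> \<le> \<beta> \<Longrightarrow> \<beta> \<le> \<alpha> \<Longrightarrow> \<alpha> = \<beta>" for \<alpha> \<beta> :: countable_ordinal
    using antisym unfolding less_eq_countable_ordinal_def antisym_def
    by (metis Rep_countable_ordinal_inject)
  have wf_less: "wf {(\<alpha>, \<beta> :: countable_ordinal). \<alpha> < \<beta>}"
    by (rule wf_subset[OF wf_inv_image[OF wf, of ?R]])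
      (auto simp: inv_image_def less_countable_ordinal_def less_eq_countable_ordinal_def
        Rep_countable_ordinal_inject)
  show "OFCLASS(countable_ordinal, wellorder_class)"
  proof
    fix \<alpha> \<beta> \<gamma> :: countable_ordinal
    show "\<alpha> < \<beta> \<longleftrightarrow> \<alpha> \<le> \<beta> \<and> \<not> \<beta> \<le> \<alpha>"
      using le_antisym le_refl by (auto simp: less_countable_ordinal_def)
    show "\<alpha> \<le> \<alpha>" by (rule le_refl)
    show "\<alpha> \<le> \<beta> \<Longrightarrow> \<beta> \<le> \<gamma> \<Longrightarrow> \<alpha> \<le> \<gamma>"
      using trans unfolding less_eq_countable_ordinal_def by (rule transD)
    show "\<alpha> \<le> \<beta> \<Longrightarrow> \<beta> \<le> \<alpha> \<Longrightarrow> \<alpha> = \<beta>" by (rule le_antisym)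
    show "\<alpha> \<le> \<beta> \<or> \<beta> \<le> \<alpha>"
      using total le_refl Rep_countable_ordinal
      unfolding less_eq_countable_ordinal_def total_on_def by metis
  next
    fix P :: "countable_ordinal \<Rightarrow> bool" and \<alpha> :: countable_ordinal
    assume "\<And>\<beta>. (\<And>\<gamma>. \<gamma> < \<beta> \<Longrightarrow> P \<gamma>) \<Longrightarrow> P \<beta>"
    then show "P \<alpha>"
      using wf_induct_rule[OF wf_less, of P \<alpha>] by blast
  qed
qed

end

instantiation countable_ordinal :: zero
begin

definition zero_countable_ordinal where
  "0 = (LEAST \<alpha> :: countable_ordinal. True)"

instance ..

end


section \<open>Classes of countable graphs\<close>

text \<open>Countable graphs are represented, up to isomorphism, by the graphs whose vertices are
  natural numbers.\<close>

definition rayless_graphs :: "nat ugraph set" where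
  "rayless_graphs = {G. wf_ugraph G \<and> rayless G}"

definition rayless_marked :: "nat marked_graph set" where
  "rayless_marked = {(G, M). G \<in> rayless_graphs \<and> M \<subseteq> vertices G \<and> finite M}"

definition rayless_marked_le :: "nat \<Rightarrow> nat marked_graph set" where
  "rayless_marked_le n = {(G, M) \<in> rayless_marked. card M \<le> n}"

function Rank :: "countable_ordinal \<Rightarrow> nat ugraph set" where
  "Rank \<alpha> =
     (if \<alpha> = 0 then {G. wf_ugraph G \<and> finite (vertices G)}
      else {G. wf_ugraph G \<and>
              (\<exists>S. finite S \<and> S \<subseteq> vertices G \<and>
                 (\<forall>C\<in>graph_components (delete_vertices G S). \<exists>\<beta>\<in>{..<\<alpha>}. C \<in> Rank \<beta>))})"
  by pat_completeness auto
termination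
  by (relation "{(\<alpha>, \<beta>). \<alpha> < \<beta>}") (auto simp: wf)

declare Rank.simps [simp del]

definition Rank_below :: "countable_ordinal \<Rightarrow> nat ugraph set" where
  "Rank_below \<alpha> = (\<Union>\<beta>\<in>{..<\<alpha>}. Rank \<beta>)"

definition Rank_marked :: "countable_ordinal \<Rightarrow> nat marked_graph set" where
  "Rank_marked \<alpha> = {(G, M). G \<in> Rank \<alpha> \<and> M \<subseteq> vertices G \<and> finite M}"

definition Rank_marked_below_le :: "nat \<Rightarrow> countable_ordinal \<Rightarrow> nat marked_graph set" where
  "Rank_marked_below_le n \<alpha> =
     {(G, M). G \<in> Rank_below \<alpha> \<and> M \<subseteq> vertices G \<and> finite M \<and> card M \<le> n}"


section \<open>Quasi-orders\<close>

definition wqo_on :: "('q \<Rightarrow> 'q \<Rightarrow> bool) \<Rightarrow> 'q set \<Rightarrow> bool" where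
  "wqo_on le Q \<longleftrightarrow> (\<forall>q :: nat \<Rightarrow> 'q. range q \<subseteq> Q \<longrightarrow> (\<exists>i j. i < j \<and> le (q i) (q j)))"

definition descending_chain :: "('q \<Rightarrow> 'q \<Rightarrow> bool) \<Rightarrow> 'q set \<Rightarrow> (nat \<Rightarrow> 'q) \<Rightarrow> bool" where
  "descending_chain le Q q \<longleftrightarrow>
     range q \<subseteq> Q \<and> (\<forall>n. le (q (Suc n)) (q n) \<and> \<not> le (q n) (q (Suc n)))"

definition antichain :: "('q \<Rightarrow> 'q \<Rightarrow> bool) \<Rightarrow> 'q set \<Rightarrow> 'q set \<Rightarrow> bool" where
  "antichain le Q A \<longleftrightarrow> A \<subseteq> Q \<and> pairwise (\<lambda>x y. \<not> le x y \<and> \<not> le y x) A"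

definition twin_classes :: "('q \<Rightarrow> 'q \<Rightarrow> bool) \<Rightarrow> 'q set \<Rightarrow> 'q set set" where
  "twin_classes le Q = Q // {(x, y). x \<in> Q \<and> y \<in> Q \<and> le x y \<and> le y x}"


definition all_equivalent :: "bool list \<Rightarrow> bool" where
  "all_equivalent Ps \<longleftrightarrow> (\<forall>P\<in>set Ps. \<forall>Q\<in>set Ps. P \<longleftrightarrow> Q)"

end

theory Submission
  imports Defs "HOL-Library.Countable_Set_Type"
begin

text \<open>All twelve statements are shown to be equivalent to one more: connected rayless graphs are
  well-quasi-ordered under minors. Three ideas carry the proof.

  A failure of this can be spread out as far as desired (\<open>spread\<close>). Let \<open>G\<^sub>0, G\<^sub>1, \<dots>\<close> be a bad
  sequence of connected rayless graphs, without loss of generality of nondecreasing rank. For a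
  set \<open>X\<close> of indices let \<open>H X\<close> be the disjoint union of \<open>n\<^sub>i\<close> copies of \<open>G\<^sub>i\<close> for all \<open>i \<in> X\<close>. If
  \<open>i \<in> X - Y\<close> and \<open>H X\<close> is a minor of \<open>H Y\<close>, then each of the \<open>n\<^sub>i\<close> copies of \<open>G\<^sub>i\<close>, being
  connected, lands in a copy of some \<open>G\<^sub>j\<close>, where \<open>j < i\<close> because the sequence is bad. But the
  copies of the \<open>G\<^sub>j\<close> with \<open>j < i\<close> can be cut down to ranks below that of \<open>G\<^sub>i\<close> by a finite number
  of vertices, and if the multiplicities grow fast enough, \<open>n\<^sub>i\<close> exceeds this number, so one copy
  of \<open>G\<^sub>i\<close> would survive. Hence \<open>H X\<close> is a minor of \<open>H Y\<close> only if \<open>X \<subseteq> Y\<close>. Suitable choices of \<open>X\<close>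
  yield a descending chain, an antichain of size continuum and continuum many twin classes, all at
  bounded rank.

  Finitely many marks on arbitrary rayless graphs can be encoded in connected unmarked rayless
  graphs (\<open>encoding_reflects\<close>): infinitely many copies of a graph of large rank are attached at
  each marked vertex, and two further vertices are joined to all original vertices and made
  recognizable by copies of still larger rank. The two vertices prevent the unmarked part of a
  graph from being hidden inside the attached copies. So all the well-quasi-orders considered
  stand or fall together.

  Finally, well-quasi-ordering makes the number of twin classes countable at each rank
  (\<open>rooted_Rank_countable\<close>), by induction on the rank. A graph is glued from pieces of smaller
  rank along a finite kernel, and countable families over a well-quasi-order with countably many
  classes have only countably many types up to injective domination (\<open>family_invariant\<close>).\<close>


section \<open>Countable ordinals\<close>

lemma countable_initial_segment:
  includes cardinal_syntax
  shows "countable {\<beta> :: countable_ordinal. \<beta> < \<alpha>}"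
proof -
  let ?r = "cardSuc natLeq"
  have co: "Card_order ?r"
    using cardSuc_Card_order natLeq_Card_order by blast
  have "|underS ?r (Rep_countable_ordinal \<alpha>)| <o ?r"
    using card_of_underS[OF co Rep_countable_ordinal] .
  then have "|underS ?r (Rep_countable_ordinal \<alpha>)| \<le>o natLeq"
    using cardSuc_ordLeq_ordLess[OF natLeq_Card_order card_of_Card_order] by blast
  then have "countable (underS ?r (Rep_countable_ordinal \<alpha>))"
    using countable_card_le_natLeq by blast
  moreover have "Rep_countable_ordinal ` {\<beta>. \<beta> < \<alpha>} \<subseteq> underS ?r (Rep_countable_ordinal \<alpha>)"
    by (auto simp: underS_def less_countable_ordinal_def less_eq_countable_ordinal_def
        Rep_countable_ordinal_inject)
  ultimately have "countable (Rep_countable_ordinal ` {\<beta>. \<beta> < \<alpha>})"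
    using countable_subset by blast
  then show ?thesis
    by (rule countable_image_inj_on) (simp add: inj_on_def Rep_countable_ordinal_inject)
qed

lemma uncountable_ordinals:
  includes cardinal_syntax
  shows "\<not> countable (UNIV :: countable_ordinal set)"
proof
  let ?r = "cardSuc natLeq"
  assume "countable (UNIV :: countable_ordinal set)"
  then have "countable (range Rep_countable_ordinal)"
    by (rule countable_image)
  then have "countable (Field ?r)"
    using type_definition.Rep_range[OF type_definition_countable_ordinal] by simp
  then have "|Field ?r| \<le>o natLeq"
    using countable_card_le_natLeq by blast
  moreover have "|Field ?r| =o ?r"
    using card_of_Field_ordIso cardSuc_Card_order natLeq_Card_order by blast
  moreover have "natLeq <o ?r"
    using cardSuc_greater natLeq_Card_order by blast
  ultimately show False
    by (meson not_ordLess_ordIso ordIso_ordLeq_trans ordIso_symmetric ordLeq_ordLess_trans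
        ordLess_irreflexive)
qed

text \<open>Otherwise the countable ordinals would be a countable union of countable initial segments.\<close>

lemma countable_bounded:
  fixes A :: "countable_ordinal set"
  assumes "countable A"
  shows "\<exists>\<alpha>. \<forall>\<beta>\<in>A. \<beta> < \<alpha>"
proof (rule ccontr)
  assume "\<not> ?thesis"
  then have "UNIV \<subseteq> (\<Union>\<alpha>\<in>A. {\<beta>. \<beta> < \<alpha>} \<union> {\<alpha>})"
    by (auto simp: not_less le_less)
  moreover have "countable (\<Union>\<alpha>\<in>A. {\<beta>. \<beta> < \<alpha>} \<union> {\<alpha>})"
    using assms countable_initial_segment by auto
  ultimately show False
    using uncountable_ordinals countable_subset by blast
qed

lemma zero_least: "(0 :: countable_ordinal) \<le> \<alpha>"
  unfolding zero_countable_ordinal_def by (rule Least_le) simp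


section \<open>Well-quasi-orders\<close>

text \<open>Recursion in which each value has to fit only the finite set of earlier values.\<close>

lemma fresh_sequence:
  assumes "\<And>(n::nat) T. finite T \<Longrightarrow> \<exists>y. P n T y"
  shows "\<exists>g :: nat \<Rightarrow> 'b. \<forall>n. P n (g ` {..<n}) (g n)"
proof -
  have "\<exists>g. \<forall>n. (\<lambda>f n r. P n (f ` {..<n}) r) g n (g n)"
  proof (rule dependent_wf_choice[of less_than])
    fix f g :: "nat \<Rightarrow> 'b" and n r
    assume "\<And>m. (m, n) \<in> less_than \<Longrightarrow> f m = g m"
    then have "f ` {..<n} = g ` {..<n}" by (intro image_cong) auto
    then show "P n (f ` {..<n}) r = P n (g ` {..<n}) r" by simp
  qed (use assms in auto)
  then show ?thesis by simp
qed

text \<open>Without a finite basis, members not above any earlier one could be chosen forever, giving a bad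
  sequence. Since the basis consists of indices, the lemma also bounds index sets whose members
  dominate only finitely many others.\<close>

lemma wqo_finite_basis:
  fixes p :: "'i \<Rightarrow> 'q"
  assumes wqo: "wqo_on le Q" and p: "p ` I \<subseteq> Q"
  shows "\<exists>T\<subseteq>I. finite T \<and> (\<forall>i\<in>I. \<exists>t\<in>T. le (p t) (p i))"
proof (rule ccontr)
  assume no_basis: "\<not> ?thesis"
  have "\<exists>g :: nat \<Rightarrow> 'i. \<forall>n. g n \<in> I \<and> (\<forall>t\<in>g ` {..<n}. t \<in> I \<longrightarrow> \<not> le (p t) (p (g n)))"
  proof (rule fresh_sequence[where P = "\<lambda>n T y. y \<in> I \<and> (\<forall>t\<in>T. t \<in> I \<longrightarrow> \<not> le (p t) (p y))"])
    fix n and T :: "'i set"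
    assume "finite T"
    then have "T \<inter> I \<subseteq> I" "finite (T \<inter> I)" by auto
    then have "\<not> (\<forall>i\<in>I. \<exists>t\<in>T \<inter> I. le (p t) (p i))"
      using no_basis by blast
    then show "\<exists>y. y \<in> I \<and> (\<forall>t\<in>T. t \<in> I \<longrightarrow> \<not> le (p t) (p y))" by blast
  qed
  then obtain g :: "nat \<Rightarrow> _" where
    g: "\<And>n. g n \<in> I" "\<And>n t. t \<in> g ` {..<n} \<Longrightarrow> t \<in> I \<Longrightarrow> \<not> le (p t) (p (g n))" by blast
  have "range (\<lambda>n. p (g n)) \<subseteq> Q" using g(1) p by blast
  then have "\<exists>i j. i < j \<and> le (p (g i)) (p (g j))"
    using wqo unfolding wqo_on_def by (elim allE[of _ "\<lambda>n. p (g n)"]) simp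
  then obtain i j where ij: "i < j" "le (p (g i)) (p (g j))" by blast
  then have "g i \<in> g ` {..<j}" by simp
  then show False using g(2)[OF _ g(1)] ij(2) by blast
qed

lemma injective_choice:
  assumes "countable A" and "\<And>a. a \<in> A \<Longrightarrow> infinite (T a)"
  shows "\<exists>f. inj_on f A \<and> (\<forall>a\<in>A. f a \<in> T a)"
proof -
  obtain e :: "'a \<Rightarrow> nat" where e: "inj_on e A"
    using assms(1) by (auto simp: countable_def)
  let ?d = "inv_into A e"
  have fresh: "\<exists>g :: nat \<Rightarrow> 'b. \<forall>n. g n \<notin> g ` {..<n} \<and> (n \<in> e ` A \<longrightarrow> g n \<in> T (?d n))"
    if inf: "infinite (UNIV :: 'b set)"
  proof (rule fresh_sequence[where P = "\<lambda>n S y. y \<notin> S \<and> (n \<in> e ` A \<longrightarrow> y \<in> T (?d n))"])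
    fix n and S :: "'b set"
    assume S: "finite S"
    show "\<exists>y. y \<notin> S \<and> (n \<in> e ` A \<longrightarrow> y \<in> T (?d n))"
    proof (cases "n \<in> e ` A")
      case True
      then have "?d n \<in> A" by (rule inv_into_into)
      then have "\<not> T (?d n) \<subseteq> S" using assms(2)[of "?d n"] S finite_subset by blast
      then show ?thesis by blast
    next
      case False
      then show ?thesis using ex_new_if_finite[OF inf S] by blast
    qed
  qed
  show ?thesis
  proof (cases "A = {}")
    case True
    then show ?thesis by simp
  next
    case False
    then obtain a where "a \<in> A" by blast
    then have inf: "infinite (UNIV :: 'b set)"
      using assms(2)[of a] finite_subset[of "T a" UNIV] by auto
    obtain g :: "nat \<Rightarrow> 'b"
      where g: "\<And>n. g n \<notin> g ` {..<n}" "\<And>n. n \<in> e ` A \<Longrightarrow> g n \<in> T (?d n)"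
      using fresh[OF inf] by auto
    have "g m \<noteq> g n" if "m < n" for m n
      using g(1)[of n] that by (metis imageI lessThan_iff)
    then have "inj g"
      by (rule linorder_injI)
    then have "inj_on (\<lambda>a. g (e a)) A"
      using e by (simp add: inj_on_def)
    moreover have "g (e a) \<in> T a" if "a \<in> A" for a
      using g(2)[of "e a"] inv_into_f_f[OF e that] that by simp
    ultimately show ?thesis by (intro exI[of _ "\<lambda>a. g (e a)"]) simp
  qed
qed

text \<open>Only countably many elements up to equivalence, expressed by representatives so that it can be
  used for quasi-orders without forming quotients.\<close>

definition essentially_countable :: "('q \<Rightarrow> 'q \<Rightarrow> bool) \<Rightarrow> 'q set \<Rightarrow> bool" where
  "essentially_countable le Q \<longleftrightarrow>
     (\<exists>C. countable C \<and> C \<subseteq> Q \<and> (\<forall>x\<in>Q. \<exists>c\<in>C. le x c \<and> le c x))"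

lemma essentially_countable_by_invariant:
  assumes "countable K" and "\<And>x. x \<in> Q \<Longrightarrow> sig x \<in> K"
    and "\<And>x y. x \<in> Q \<Longrightarrow> y \<in> Q \<Longrightarrow> sig x = sig y \<Longrightarrow> le x y"
  shows "essentially_countable le Q"
proof -
  let ?g = "\<lambda>k. SOME x. x \<in> Q \<and> sig x = k"
  have g: "?g (sig x) \<in> Q \<and> sig (?g (sig x)) = sig x" if "x \<in> Q" for x
    by (rule someI[of "\<lambda>y. y \<in> Q \<and> sig y = sig x" x]) (use that in auto)
  let ?C = "?g ` (sig ` Q)"
  have "countable (sig ` Q)" using countable_subset[of "sig ` Q" K] assms(1,2) by auto
  then have "countable ?C" by blast
  moreover have "?C \<subseteq> Q" using g by blast
  moreover have "\<exists>c\<in>?C. le x c \<and> le c x" if "x \<in> Q" for x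
  proof (rule bexI)
    show "le x (?g (sig x)) \<and> le (?g (sig x)) x"
      using assms(3)[OF that, of "?g (sig x)"] assms(3)[of "?g (sig x)" x] g[OF that] that by simp
    show "?g (sig x) \<in> ?C" using that by (intro imageI)
  qed
  ultimately show ?thesis unfolding essentially_countable_def by blast
qed

text \<open>Elements are classified by the index \<open>n\<close> of one of their codes together with a representative of
  that code in \<open>P n\<close>.\<close>

lemma essentially_countable_by_encoding:
  fixes P :: "nat \<Rightarrow> 'p set"
  assumes cnt: "\<And>n. essentially_countable (R n) (P n)"
    and code: "\<And>x. x \<in> Q \<Longrightarrow> \<exists>n y. y \<in> P n \<and> code x n y"
    and le: "\<And>x x' n y y' c. x \<in> Q \<Longrightarrow> x' \<in> Q \<Longrightarrow> code x n y \<Longrightarrow> code x' n y' \<Longrightarrow>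
      R n y c \<Longrightarrow> R n c y' \<Longrightarrow> le x x'"
  shows "essentially_countable le Q"
proof -
  have "\<forall>n. \<exists>C. countable C \<and> (\<forall>y\<in>P n. \<exists>c\<in>C. R n y c \<and> R n c y)"
    using cnt unfolding essentially_countable_def by blast
  from choice[OF this] obtain C where
    C: "\<forall>n. countable (C n) \<and> (\<forall>y\<in>P n. \<exists>c\<in>C n. R n y c \<and> R n c y)" ..
  let ?good = "\<lambda>x (n, c). \<exists>y. code x n y \<and> c \<in> C n \<and> R n y c \<and> R n c y"
  have "\<forall>x\<in>Q. \<exists>k. ?good x k"
  proof
    fix x assume "x \<in> Q"
    then obtain n y where y: "y \<in> P n" "code x n y" using code by blast
    then obtain c where "c \<in> C n" "R n y c" "R n c y" using C by blast
    then have "?good x (n, c)" using y by auto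
    then show "\<exists>k. ?good x k" by (rule exI)
  qed
  from bchoice[OF this] obtain sig where sig: "\<forall>x\<in>Q. ?good x (sig x)" ..
  show ?thesis
  proof (rule essentially_countable_by_invariant[where K = "Sigma UNIV C" and sig = sig])
    show "countable (Sigma UNIV C)" using C by (intro countable_SIGMA) auto
    show "sig x \<in> Sigma UNIV C" if "x \<in> Q" for x
      using bspec[OF sig that] by (cases "sig x") auto
    fix x x' assume x: "x \<in> Q" "x' \<in> Q" "sig x = sig x'"
    obtain n c where nc: "sig x = (n, c)" by (cases "sig x")
    obtain y where "code x n y" "R n y c" using bspec[OF sig x(1)] nc by auto
    moreover obtain y' where "code x' n y'" "R n c y'" using bspec[OF sig x(2)] nc x(3) by auto
    ultimately show "le x x'" using le[OF x(1,2)] by simp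
  qed
qed

lemma countable_twin_classes:
  assumes "essentially_countable le Q"
    and trans: "\<And>x y z. x \<in> Q \<Longrightarrow> y \<in> Q \<Longrightarrow> z \<in> Q \<Longrightarrow> le x y \<Longrightarrow> le y z \<Longrightarrow> le x z"
  shows "countable (twin_classes le Q)"
proof -
  obtain C where C: "countable C" "C \<subseteq> Q" "\<forall>x\<in>Q. \<exists>c\<in>C. le x c \<and> le c x"
    using assms(1) unfolding essentially_countable_def by blast
  let ?R = "{(x, y). x \<in> Q \<and> y \<in> Q \<and> le x y \<and> le y x}"
  have "Q // ?R \<subseteq> (\<lambda>c. ?R `` {c}) ` C"
  proof
    fix X assume "X \<in> Q // ?R"
    then obtain x where x: "x \<in> Q" "X = ?R `` {x}" by (auto elim: quotientE)
    then obtain c where c: "c \<in> C" "le x c" "le c x" using C by blast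
    then have "c \<in> Q" using C by blast
    have "?R `` {x} = ?R `` {c}"
    proof (intro set_eqI iffI)
      fix z assume "z \<in> ?R `` {x}"
      then have z: "z \<in> Q" "le x z" "le z x" by auto
      then have "le c z" "le z c"
        using trans[of c x z] trans[of z x c] c x(1) \<open>c \<in> Q\<close> by blast+
      then show "z \<in> ?R `` {c}" using z \<open>c \<in> Q\<close> by blast
    next
      fix z assume "z \<in> ?R `` {c}"
      then have z: "z \<in> Q" "le c z" "le z c" by auto
      then have "le x z" "le z x"
        using trans[of x c z] trans[of z c x] c x(1) \<open>c \<in> Q\<close> by blast+
      then show "z \<in> ?R `` {x}" using z x(1) by blast
    qed
    then show "X \<in> (\<lambda>c. ?R `` {c}) ` C" using c x by blast
  qed
  then show ?thesis
    unfolding twin_classes_def using C(1) by (meson countable_image countable_subset)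
qed

text \<open>Over a well-quasi-order with countably many classes, countable families are classified by
  countably many values as far as injective domination goes. All but finitely many members \<open>p i\<close>
  of a family lie below infinitely many members. Those can be matched one after the other, so for
  them it suffices to record which elements of \<open>Q\<close> lie below one of them; this downward closed set
  is coded by a finite basis of its complement. The finitely many remaining members are listed
  outright.\<close>

lemma family_invariant:
  fixes I :: "'x \<Rightarrow> 'i set" and p :: "'x \<Rightarrow> 'i \<Rightarrow> 'q"
  assumes wqo: "wqo_on le Q" and cnt: "essentially_countable le Q"
    and trans: "\<And>x y z. x \<in> Q \<Longrightarrow> y \<in> Q \<Longrightarrow> z \<in> Q \<Longrightarrow> le x y \<Longrightarrow> le y z \<Longrightarrow> le x z"
    and I: "\<And>x. x \<in> A \<Longrightarrow> countable (I x)"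
    and p: "\<And>x i. x \<in> A \<Longrightarrow> i \<in> I x \<Longrightarrow> p x i \<in> Q"
  shows "\<exists>(K :: ('q list \<times> 'q set) set) sig. countable K \<and> sig ` A \<subseteq> K \<and>
           (\<forall>x\<in>A. \<forall>y\<in>A. sig x = sig y \<longrightarrow>
              (\<exists>f. inj_on f (I x) \<and> f ` I x \<subseteq> I y \<and> (\<forall>i\<in>I x. le (p x i) (p y (f i)))))"
proof -
  obtain C where C: "countable C" "C \<subseteq> Q" "\<forall>q\<in>Q. \<exists>c\<in>C. le q c \<and> le c q"
    using cnt unfolding essentially_countable_def by blast
  define rep where "rep q = (SOME c. c \<in> C \<and> le q c \<and> le c q)" for q
  have rep: "rep q \<in> C \<and> le q (rep q) \<and> le (rep q) q" if "q \<in> Q" for q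
    unfolding rep_def by (rule someI_ex) (use C that in blast)
  define bad where "bad x = {i \<in> I x. finite {j \<in> I x. le (p x i) (p x j)}}" for x
  have fin_bad: "finite (bad x)" if "x \<in> A" for x
  proof -
    have "p x ` bad x \<subseteq> Q" using p that by (auto simp: bad_def)
    then obtain T where T: "T \<subseteq> bad x" "finite T" "\<forall>i\<in>bad x. \<exists>t\<in>T. le (p x t) (p x i)"
      using wqo_finite_basis[OF wqo, of "p x" "bad x"] by blast
    have "bad x \<subseteq> (\<Union>t\<in>T. {j \<in> I x. le (p x t) (p x j)})"
      using T(3) by (auto simp: bad_def)
    moreover have "finite (\<Union>t\<in>T. {j \<in> I x. le (p x t) (p x j)})"
      using T(1,2) by (auto simp: bad_def)
    ultimately show ?thesis using finite_subset by blast
  qed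
  define dom where "dom x = {q \<in> Q. \<exists>i\<in>I x - bad x. le q (p x i)}" for x
  have "\<exists>T\<subseteq>C. finite T \<and> (\<forall>q\<in>Q. q \<notin> dom x \<longleftrightarrow> (\<exists>t\<in>T. le t q))" if "x \<in> A" for x
  proof -
    have "(\<lambda>q. q) ` (C - dom x) \<subseteq> Q" using C(2) by auto
    from wqo_finite_basis[OF wqo this]
    obtain T where T: "T \<subseteq> C - dom x" "finite T" "\<forall>q\<in>C - dom x. \<exists>t\<in>T. le t q" by blast
    have "q \<notin> dom x \<longleftrightarrow> (\<exists>t\<in>T. le t q)" if q: "q \<in> Q" for q
    proof
      assume "q \<notin> dom x"
      have "rep q \<notin> dom x"
      proof
        assume "rep q \<in> dom x"
        then obtain i where "i \<in> I x - bad x" "le (rep q) (p x i)" unfolding dom_def by blast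
        moreover from this have "rep q \<in> Q" "p x i \<in> Q" using rep[OF q] C(2) p[OF \<open>x \<in> A\<close>] by auto
        ultimately have "le q (p x i)" using trans[of q "rep q" "p x i"] rep[OF q] q by simp
        then show False using \<open>q \<notin> dom x\<close> q \<open>i \<in> I x - bad x\<close> by (auto simp: dom_def)
      qed
      then obtain t where "t \<in> T" "le t (rep q)" using T(3) rep[OF q] by blast
      moreover have "t \<in> Q" "rep q \<in> Q" using calculation T(1) C(2) rep[OF q] by auto
      ultimately show "\<exists>t\<in>T. le t q" using trans[of t "rep q" q] rep[OF q] q by blast
    next
      assume "\<exists>t\<in>T. le t q"
      then obtain t where t: "t \<in> T" "le t q" by blast
      then have "t \<in> Q" "t \<notin> dom x" using T(1) C(2) by auto
      show "q \<notin> dom x"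
      proof
        assume "q \<in> dom x"
        then obtain i where i: "i \<in> I x - bad x" "le q (p x i)" unfolding dom_def by blast
        then have "le t (p x i)" using trans[of t q "p x i"] t(2) q \<open>t \<in> Q\<close> p[OF \<open>x \<in> A\<close>, of i] by simp
        then show False using \<open>t \<in> Q\<close> \<open>t \<notin> dom x\<close> i(1) unfolding dom_def by blast
      qed
    qed
    then show ?thesis using T by blast
  qed
  then obtain basis where basis: "\<And>x. x \<in> A \<Longrightarrow> basis x \<subseteq> C \<and> finite (basis x) \<and>
      (\<forall>q\<in>Q. q \<notin> dom x \<longleftrightarrow> (\<exists>t\<in>basis x. le t q))"
    by metis
  have "\<exists>xs. set xs = bad x \<and> distinct xs" if "x \<in> A" for x
    using finite_distinct_list[OF fin_bad[OF that]] by blast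
  then obtain enum where enum: "\<And>x. x \<in> A \<Longrightarrow> set (enum x) = bad x \<and> distinct (enum x)"
    by metis
  define sig where "sig x = (map (\<lambda>i. rep (p x i)) (enum x), basis x)" for x
  let ?K = "lists C \<times> {T. finite T \<and> T \<subseteq> C}"
  have "countable ?K" using C(1) by (simp add: countable_Collect_finite_subset)
  have "sig ` A \<subseteq> ?K"
  proof
    fix k assume "k \<in> sig ` A"
    then obtain x where x: "x \<in> A" "k = sig x" by blast
    have "rep (p x i) \<in> C" if "i \<in> set (enum x)" for i
      using that enum[OF x(1)] rep p[OF x(1)] by (auto simp: bad_def)
    then show "k \<in> ?K" unfolding x(2) sig_def using basis[OF x(1)] by auto
  qed
  have dominated: "\<exists>f. inj_on f (I x) \<and> f ` I x \<subseteq> I y \<and> (\<forall>i\<in>I x. le (p x i) (p y (f i)))"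
    if x: "x \<in> A" and y: "y \<in> A" and eq: "sig x = sig y" for x y
  proof -
    have maps: "map (\<lambda>i. rep (p x i)) (enum x) = map (\<lambda>i. rep (p y i)) (enum y)"
      using eq unfolding sig_def by simp
    then have len: "length (enum x) = length (enum y)"
      by (metis length_map)
    have reps: "rep (p x (enum x ! k)) = rep (p y (enum y ! k))" if "k < length (enum x)" for k
      using arg_cong[OF maps, of "\<lambda>xs. xs ! k"] that len by simp
    have ex: "set (enum x) = bad x" "distinct (enum x)"
      and ey: "set (enum y) = bad y" "distinct (enum y)"
      using enum x y by auto
    have bi: "\<exists>k<length (enum x). enum x ! k = i" if "i \<in> bad x" for i
      using that ex by (metis in_set_conv_nth)
    define idx where "idx i = (SOME k. k < length (enum x) \<and> enum x ! k = i)" for i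
    have idx: "idx i < length (enum x) \<and> enum x ! idx i = i" if "i \<in> bad x" for i
      unfolding idx_def by (rule someI_ex) (use bi that in blast)
    define f1 where "f1 i = enum y ! idx i" for i
    have f1_bad: "f1 i \<in> bad y" if "i \<in> bad x" for i
      using idx[OF that] len ey unfolding f1_def by (metis nth_mem)
    have f1_inj: "inj_on f1 (bad x)"
    proof (rule inj_onI)
      fix i j assume "i \<in> bad x" "j \<in> bad x" "f1 i = f1 j"
      then have "idx i = idx j"
        using idx len ey(2) unfolding f1_def by (metis nth_eq_iff_index_eq)
      then show "i = j" using idx \<open>i \<in> bad x\<close> \<open>j \<in> bad x\<close> by metis
    qed
    have f1_le: "le (p x i) (p y (f1 i))" if i: "i \<in> bad x" for i
    proof -
      have "rep (p x i) = rep (p y (f1 i))" using reps idx[OF i] unfolding f1_def by metis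
      moreover have "p x i \<in> Q" "p y (f1 i) \<in> Q"
        using i f1_bad[OF i] p x y by (auto simp: bad_def)
      ultimately show ?thesis
        using rep[of "p x i"] rep[of "p y (f1 i)"] C(2)
          trans[of "p x i" "rep (p x i)" "p y (f1 i)"] by auto
    qed
    have "dom x = dom y"
    proof -
      have "basis x = basis y" using eq by (simp add: sig_def)
      then have "\<forall>q\<in>Q. q \<in> dom x \<longleftrightarrow> q \<in> dom y" using basis[OF x] basis[OF y] by auto
      then show ?thesis by (auto simp: dom_def)
    qed
    have inf: "infinite {j \<in> I y - bad y. le (p x i) (p y j)}" if i: "i \<in> I x - bad x" for i
    proof
      assume fin: "finite {j \<in> I y - bad y. le (p x i) (p y j)}"
      have pQ: "p x i \<in> Q" using i p x by blast
      have "infinite {j \<in> I x. le (p x i) (p x j)}" using i by (auto simp: bad_def)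
      then obtain j where "j \<in> {j \<in> I x. le (p x i) (p x j)} - bad x"
        using fin_bad[OF x] by (metis Diff_eq_empty_iff ex_in_conv finite_subset)
      then have "p x i \<in> dom y" using pQ \<open>dom x = dom y\<close> by (auto simp: dom_def)
      then obtain j where j: "j \<in> I y - bad y" "le (p x i) (p y j)" by (auto simp: dom_def)
      have "{k \<in> I y. le (p y j) (p y k)} \<subseteq> {j \<in> I y - bad y. le (p x i) (p y j)} \<union> bad y"
        using trans[of "p x i" "p y j"] pQ j p[OF y] by auto
      then have "finite {k \<in> I y. le (p y j) (p y k)}"
        using fin fin_bad[OF y] by (meson finite_Un finite_subset)
      then show False using j by (auto simp: bad_def)
    qed
    have "countable (I x - bad x)" using I[OF x] by simp
    from injective_choice[of "I x - bad x" "\<lambda>i. {j \<in> I y - bad y. le (p x i) (p y j)}", OF this inf]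
    obtain f2 where f2: "inj_on f2 (I x - bad x)"
      "\<forall>i\<in>I x - bad x. f2 i \<in> {j \<in> I y - bad y. le (p x i) (p y j)}"
      by blast
    define f where "f i = (if i \<in> bad x then f1 i else f2 i)" for i
    have "inj_on f (I x)"
    proof (rule inj_onI)
      fix i j assume ij: "i \<in> I x" "j \<in> I x" "f i = f j"
      have "f2 k \<notin> bad y" if "k \<in> I x" "k \<notin> bad x" for k using that f2(2) by blast
      note sep = this
      show "i = j"
      proof (cases "i \<in> bad x")
        case True
        then have "f1 i = f j" using ij(3) by (simp add: f_def)
        then have "j \<in> bad x" using f1_bad[OF True] sep[OF ij(2)]
          by (cases "j \<in> bad x") (simp_all add: f_def)
        then show ?thesis using True \<open>f1 i = f j\<close> inj_onD[OF f1_inj, of i j] by (simp add: f_def)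
      next
        case False
        then have "f2 i = f j" using ij(3) by (simp add: f_def)
        then have "j \<notin> bad x" using f1_bad[of j] sep[OF ij(1) False]
          by (cases "j \<in> bad x") (simp_all add: f_def)
        then show ?thesis
          using False \<open>f2 i = f j\<close> ij(1,2) inj_onD[OF f2(1), of i j] by (simp add: f_def)
      qed
    qed
    moreover have "f i \<in> I y \<and> le (p x i) (p y (f i))" if "i \<in> I x" for i
    proof (cases "i \<in> bad x")
      case True
      then show ?thesis using f1_bad[OF True] f1_le[OF True] by (simp add: f_def bad_def)
    next
      case False
      then show ?thesis using f2(2) that by (simp add: f_def)
    qed
    ultimately show ?thesis by (intro exI[of _ f]) auto
  qed
  then have "countable ?K \<and> sig ` A \<subseteq> ?K \<and>
      (\<forall>x\<in>A. \<forall>y\<in>A. sig x = sig y \<longrightarrow>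
        (\<exists>f. inj_on f (I x) \<and> f ` I x \<subseteq> I y \<and> (\<forall>i\<in>I x. le (p x i) (p y (f i)))))"
    using \<open>countable ?K\<close> \<open>sig ` A \<subseteq> ?K\<close> by simp
  then show ?thesis by (intro exI[of _ ?K] exI[of _ sig])
qed


section \<open>Connected sets and models\<close>

text \<open>A set is connected if no nonempty proper part of it is closed under adjacency.  This form avoids
  walks: to prove a property of all vertices of a connected set, one checks that the vertices having it
  form a nonempty closed part.\<close>

definition connected_set :: "'a set set \<Rightarrow> 'a set \<Rightarrow> bool" where
  "connected_set E X \<longleftrightarrow> X \<noteq> {} \<and>
     (\<forall>A\<subseteq>X. A \<noteq> {} \<longrightarrow> (\<forall>x\<in>A. \<forall>y\<in>X. {x, y} \<in> E \<longrightarrow> y \<in> A) \<longrightarrow> A = X)"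

lemma connected_setI:
  assumes "x \<in> X"
    and "\<And>A. A \<subseteq> X \<Longrightarrow> A \<noteq> {} \<Longrightarrow> (\<And>x y. x \<in> A \<Longrightarrow> y \<in> X \<Longrightarrow> {x, y} \<in> E \<Longrightarrow> y \<in> A) \<Longrightarrow> X \<subseteq> A"
  shows "connected_set E X"
  unfolding connected_set_def
proof (intro conjI allI impI)
  show "X \<noteq> {}" using assms(1) by blast
  fix A assume "A \<subseteq> X" "A \<noteq> {}" "\<forall>x\<in>A. \<forall>y\<in>X. {x, y} \<in> E \<longrightarrow> y \<in> A"
  then show "A = X" using assms(2)[of A] by auto
qed

lemma connected_set_subset:
  assumes "connected_set E X" "x \<in> X" "x \<in> A"
    and "\<And>x y. x \<in> A \<Longrightarrow> x \<in> X \<Longrightarrow> y \<in> X \<Longrightarrow> {x, y} \<in> E \<Longrightarrow> y \<in> A"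
  shows "X \<subseteq> A"
proof -
  have "A \<inter> X \<noteq> {}" using assms(2,3) by blast
  moreover have "\<forall>x\<in>A \<inter> X. \<forall>y\<in>X. {x, y} \<in> E \<longrightarrow> y \<in> A \<inter> X" using assms(4) by blast
  moreover have "A \<inter> X \<noteq> {} \<longrightarrow> (\<forall>x\<in>A \<inter> X. \<forall>y\<in>X. {x, y} \<in> E \<longrightarrow> y \<in> A \<inter> X) \<longrightarrow> A \<inter> X = X"
    using assms(1) unfolding connected_set_def by (meson Int_lower2)
  ultimately have "A \<inter> X = X" by simp
  then show ?thesis by blast
qed

lemma connected_set_nonempty: "connected_set E X \<Longrightarrow> X \<noteq> {}"
  by (simp add: connected_set_def)

lemma connected_set_singleton: "connected_set E {x}"
  by (rule connected_setI[of x]) auto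

abbreviation connected_graph :: "'a ugraph \<Rightarrow> bool" where
  "connected_graph G \<equiv> connected_set (edges G) (vertices G)"

lemma connected_set_mono:
  assumes "connected_set E X" "\<And>x y. x \<in> X \<Longrightarrow> y \<in> X \<Longrightarrow> {x, y} \<in> E \<Longrightarrow> {x, y} \<in> E'"
  shows "connected_set E' X"
proof -
  obtain x where "x \<in> X" using connected_set_nonempty[OF assms(1)] by blast
  then show ?thesis
  proof (rule connected_setI)
    fix A assume A: "A \<subseteq> X" "A \<noteq> {}" "\<And>x y. x \<in> A \<Longrightarrow> y \<in> X \<Longrightarrow> {x, y} \<in> E' \<Longrightarrow> y \<in> A"
    then obtain a where "a \<in> A" by blast
    then show "X \<subseteq> A" using A assms by (intro connected_set_subset[of E X a]) auto
  qed
qed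

lemma connected_set_Union:
  assumes "\<And>X. X \<in> F \<Longrightarrow> connected_set E X" "\<And>X. X \<in> F \<Longrightarrow> c \<in> X" "F \<noteq> {}"
  shows "connected_set E (\<Union>F)"
proof -
  have c: "c \<in> \<Union>F" using assms(2,3) by blast
  then show ?thesis
  proof (rule connected_setI)
    fix A assume A: "A \<subseteq> \<Union>F" "A \<noteq> {}" "\<And>x y. x \<in> A \<Longrightarrow> y \<in> \<Union>F \<Longrightarrow> {x, y} \<in> E \<Longrightarrow> y \<in> A"
    have *: "X \<subseteq> A" if "X \<in> F" "x \<in> X" "x \<in> A" for X x
      using assms(1)[OF that(1)] that(2,3) by (rule connected_set_subset) (use A(3) that(1) in blast)
    obtain a where "a \<in> A" using A(2) by blast
    then obtain X where "X \<in> F" "a \<in> X" using A(1) by blast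
    then have "c \<in> A" using * \<open>a \<in> A\<close> assms(2) by blast
    then show "\<Union>F \<subseteq> A" using * assms(2) by blast
  qed
qed

text \<open>The shape in which most connected sets arise below: a connected centre with connected sets
  adjacent to it.\<close>

lemma connected_set_attach:
  assumes "connected_set E X" "\<And>Y. Y \<in> F \<Longrightarrow> connected_set E Y"
    and "\<And>Y. Y \<in> F \<Longrightarrow> \<exists>x\<in>X. \<exists>y\<in>Y. {x, y} \<in> E"
  shows "connected_set E (X \<union> \<Union>F)"
proof -
  obtain x0 where "x0 \<in> X" using connected_set_nonempty[OF assms(1)] by blast
  then have "x0 \<in> X \<union> \<Union>F" by blast
  then show ?thesis
  proof (rule connected_setI)
    fix A assume A: "A \<subseteq> X \<union> \<Union>F" "A \<noteq> {}"
      "\<And>x y. x \<in> A \<Longrightarrow> y \<in> X \<union> \<Union>F \<Longrightarrow> {x, y} \<in> E \<Longrightarrow> y \<in> A"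
    have X: "X \<subseteq> A" if "x \<in> X" "x \<in> A" for x
      using assms(1) that by (rule connected_set_subset) (use A(3) in blast)
    have Y: "Y \<subseteq> A" if "Y \<in> F" "y \<in> Y" "y \<in> A" for Y y
      using assms(2)[OF that(1)] that(2,3) by (rule connected_set_subset) (use A(3) that(1) in blast)
    have "\<exists>x\<in>X. x \<in> A"
    proof -
      obtain a where a: "a \<in> A" using A(2) by blast
      show ?thesis
      proof (cases "a \<in> X")
        case False
        then obtain Y' where "Y' \<in> F" "a \<in> Y'" using a A(1) by blast
        then obtain x y where "x \<in> X" "y \<in> A" "{y, x} \<in> E"
          using Y[OF _ _ a] assms(3) by (metis doubleton_eq_iff subsetD)
        then show ?thesis using A(3)[of y x] by blast
      qed (use a in blast)
    qed
    then have "X \<subseteq> A" using X by blast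
    moreover have "Y \<subseteq> A" if "Y \<in> F" for Y
    proof -
      obtain x y where "x \<in> X" "y \<in> Y" "{x, y} \<in> E" using assms(3)[OF \<open>Y \<in> F\<close>] by blast
      then have "y \<in> A" using A(3)[of x y] \<open>X \<subseteq> A\<close> that by blast
      then show ?thesis using Y that \<open>y \<in> Y\<close> by blast
    qed
    ultimately show "X \<union> \<Union>F \<subseteq> A" by blast
  qed
qed

definition component :: "'a set set \<Rightarrow> 'a set \<Rightarrow> 'a \<Rightarrow> 'a set" where
  "component E U x = \<Union>{X. X \<subseteq> U \<and> x \<in> X \<and> connected_set E X}"

lemma component_connected:
  assumes "x \<in> U"
  shows "connected_set E (component E U x)"
  unfolding component_def
proof (rule connected_set_Union[of _ _ x])
  have "{x} \<in> {X. X \<subseteq> U \<and> x \<in> X \<and> connected_set E X}"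
    using assms connected_set_singleton[of E x] by simp
  then show "{X. X \<subseteq> U \<and> x \<in> X \<and> connected_set E X} \<noteq> {}" by blast
qed simp_all

lemma component_subset: "component E U x \<subseteq> U"
  by (auto simp: component_def)

lemma component_max: "connected_set E X \<Longrightarrow> X \<subseteq> U \<Longrightarrow> x \<in> X \<Longrightarrow> X \<subseteq> component E U x"
  unfolding component_def by (intro Union_upper) simp

lemma component_self: "x \<in> U \<Longrightarrow> x \<in> component E U x"
  using component_max[OF connected_set_singleton[of E x], of U x] by simp

lemma component_closed:
  assumes "y \<in> component E U x" "z \<in> U" "{y, z} \<in> E"
  shows "z \<in> component E U x"
proof -
  obtain X where X: "X \<subseteq> U" "x \<in> X" "connected_set E X" "y \<in> X"
    using assms(1) by (auto simp: component_def)
  have "connected_set E (X \<union> \<Union>{{z}})"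
  proof (rule connected_set_attach[OF X(3)])
    fix Y assume "Y \<in> {{z}}"
    then show "connected_set E Y" "\<exists>x\<in>X. \<exists>y\<in>Y. {x, y} \<in> E"
      using connected_set_singleton[of E z] X(4) assms(3) by auto
  qed
  then have "X \<union> \<Union>{{z}} \<subseteq> component E U x"
    using X assms(2) by (intro component_max) auto
  then show ?thesis by simp
qed

lemma component_eq: "y \<in> component E U x \<Longrightarrow> x \<in> U \<Longrightarrow> component E U y = component E U x"
proof
  assume y: "y \<in> component E U x" and x: "x \<in> U"
  show sub: "component E U x \<subseteq> component E U y"
    using component_max[OF component_connected[OF x] component_subset y] .
  have "y \<in> U" by (rule subsetD[OF component_subset y])
  have "x \<in> component E U y" by (rule subsetD[OF sub component_self[OF x]])
  then show "component E U y \<subseteq> component E U x"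
    by (rule component_max[OF component_connected[OF \<open>y \<in> U\<close>] component_subset])
qed

text \<open>Models of the graph induced by \<open>U\<close> in \<open>E\<close>, inside the graph induced by \<open>W\<close> in \<open>E'\<close>. Branch sets
  are given by their vertices, as the subgraphs that these induce can serve as branch sets.
  Restricting to an induced subgraph only shrinks \<open>U\<close>.\<close>

definition set_model :: "('a \<Rightarrow> 'b set) \<Rightarrow> 'a set \<Rightarrow> 'a set set \<Rightarrow> 'b set \<Rightarrow> 'b set set \<Rightarrow> bool" where
  "set_model B U E W E' \<longleftrightarrow>
     (\<forall>u\<in>U. B u \<subseteq> W \<and> connected_set E' (B u)) \<and>
     (\<forall>u\<in>U. \<forall>v\<in>U. u \<noteq> v \<longrightarrow> B u \<inter> B v = {}) \<and>
     (\<forall>u\<in>U. \<forall>v\<in>U. u \<noteq> v \<longrightarrow> {u, v} \<in> E \<longrightarrow> (\<exists>x\<in>B u. \<exists>y\<in>B v. {x, y} \<in> E'))"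

abbreviation graph_model :: "('a \<Rightarrow> 'b set) \<Rightarrow> 'a ugraph \<Rightarrow> 'b ugraph \<Rightarrow> bool" where
  "graph_model B G H \<equiv> set_model B (vertices G) (edges G) (vertices H) (edges H)"

lemma set_modelI:
  assumes "\<And>u. u \<in> U \<Longrightarrow> B u \<subseteq> W" "\<And>u. u \<in> U \<Longrightarrow> connected_set E' (B u)"
    and "\<And>u v. u \<in> U \<Longrightarrow> v \<in> U \<Longrightarrow> u \<noteq> v \<Longrightarrow> B u \<inter> B v = {}"
    and "\<And>u v. u \<in> U \<Longrightarrow> v \<in> U \<Longrightarrow> u \<noteq> v \<Longrightarrow> {u, v} \<in> E \<Longrightarrow> \<exists>x\<in>B u. \<exists>y\<in>B v. {x, y} \<in> E'"
  shows "set_model B U E W E'"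
  using assms by (simp add: set_model_def)

lemma set_modelD:
  assumes "set_model B U E W E'"
  shows "\<And>u. u \<in> U \<Longrightarrow> B u \<subseteq> W" "\<And>u. u \<in> U \<Longrightarrow> connected_set E' (B u)"
    and "\<And>u v. u \<in> U \<Longrightarrow> v \<in> U \<Longrightarrow> u \<noteq> v \<Longrightarrow> B u \<inter> B v = {}"
    and "\<And>u v. u \<in> U \<Longrightarrow> v \<in> U \<Longrightarrow> u \<noteq> v \<Longrightarrow> {u, v} \<in> E \<Longrightarrow> \<exists>x\<in>B u. \<exists>y\<in>B v. {x, y} \<in> E'"
  using assms unfolding set_model_def by simp_all

lemma set_model_subset: "set_model B U E W E' \<Longrightarrow> U' \<subseteq> U \<Longrightarrow> set_model B U' E W E'"
  unfolding set_model_def by (meson subset_iff)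

lemma set_model_target: "set_model B U E W E' \<Longrightarrow> (\<And>u. u \<in> U \<Longrightarrow> B u \<subseteq> W') \<Longrightarrow> set_model B U E W' E'"
  unfolding set_model_def by simp

lemma set_model_embedding:
  assumes "inj_on f U" "f ` U \<subseteq> W"
    and "\<And>u v. u \<in> U \<Longrightarrow> v \<in> U \<Longrightarrow> {u, v} \<in> E \<Longrightarrow> {f u, f v} \<in> E'"
  shows "set_model (\<lambda>u. {f u}) U E W E'"
  by (rule set_modelI) (use assms connected_set_singleton in \<open>auto simp: inj_on_def\<close>)

lemma set_model_connected:
  assumes "set_model B U E W E'" "X \<subseteq> U" "connected_set E X"
  shows "connected_set E' (\<Union>(B ` X))"
proof -
  note M = set_modelD[OF assms(1)]
  obtain x where x: "x \<in> X" using connected_set_nonempty[OF assms(3)] by blast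
  then obtain b where "b \<in> B x" using M(2) connected_set_nonempty assms(2) by blast
  then have "b \<in> \<Union>(B ` X)" using x by blast
  then show ?thesis
  proof (rule connected_setI)
    fix A assume A: "A \<subseteq> \<Union>(B ` X)" "A \<noteq> {}"
      "\<And>x y. x \<in> A \<Longrightarrow> y \<in> \<Union>(B ` X) \<Longrightarrow> {x, y} \<in> E' \<Longrightarrow> y \<in> A"
    have full: "B v \<subseteq> A" if v: "v \<in> X" "a \<in> B v" "a \<in> A" for v a
      by (rule connected_set_subset[of E' "B v" a])
        (use v assms(2) M(2) A(3) in blast)+
    obtain a v where av: "a \<in> A" "v \<in> X" "a \<in> B v" using A(1,2) by blast
    have "X \<subseteq> {v. B v \<subseteq> A}"
    proof (rule connected_set_subset[OF assms(3) av(2)])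
      show "v \<in> {v. B v \<subseteq> A}" using full av by blast
      fix u w assume uw: "u \<in> {v. B v \<subseteq> A}" "u \<in> X" "w \<in> X" "{u, w} \<in> E"
      show "w \<in> {v. B v \<subseteq> A}"
      proof (cases "u = w")
        case False
        then obtain p q where pq: "p \<in> B u" "q \<in> B w" "{p, q} \<in> E'"
          using M(4)[of u w] uw assms(2) by blast
        then have "q \<in> A" using A(3)[of p q] uw by blast
        then show ?thesis using full[OF uw(3) pq(2)] by blast
      qed (use uw in simp)
    qed
    then show "\<Union>(B ` X) \<subseteq> A" by blast
  qed
qed

lemma set_model_trans:
  assumes "set_model B U E W E'" "set_model B' W E' W' E''"
  shows "set_model (\<lambda>u. \<Union>(B' ` B u)) U E W' E''"
proof -
  note M = set_modelD[OF assms(1)] and M' = set_modelD[OF assms(2)]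
  show ?thesis
  proof (rule set_modelI)
    fix u assume u: "u \<in> U"
    show "\<Union>(B' ` B u) \<subseteq> W'" using M(1)[OF u] M'(1) by blast
    show "connected_set E'' (\<Union>(B' ` B u))"
      using set_model_connected[OF assms(2) M(1)[OF u] M(2)[OF u]] .
  next
    fix u v assume uv: "u \<in> U" "v \<in> U" "u \<noteq> v"
    have "B' x \<inter> B' y = {}" if "x \<in> B u" "y \<in> B v" for x y
      using that M(1)[OF uv(1)] M(1)[OF uv(2)] M(3)[OF uv] by (intro M'(3)) auto
    then show "\<Union>(B' ` B u) \<inter> \<Union>(B' ` B v) = {}" by blast
  next
    fix u v assume uv: "u \<in> U" "v \<in> U" "u \<noteq> v" "{u, v} \<in> E"
    obtain x y where xy: "x \<in> B u" "y \<in> B v" "{x, y} \<in> E'" using M(4)[OF uv] by blast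
    moreover have "x \<in> W" "y \<in> W" "x \<noteq> y" using xy M(1,3) uv by blast+
    ultimately obtain p q where "p \<in> B' x" "q \<in> B' y" "{p, q} \<in> E''" using M'(4)[of x y] by blast
    then show "\<exists>x\<in>\<Union>(B' ` B u). \<exists>y\<in>\<Union>(B' ` B v). {x, y} \<in> E''" using xy by blast
  qed
qed


section \<open>Minors as models\<close>

lemma edge_vertices:
  assumes "wf_ugraph G" "{u, v} \<in> edges G"
  shows "u \<in> vertices G" "v \<in> vertices G" "u \<noteq> v"
proof -
  have "{u, v} \<subseteq> vertices G" "card {u, v} = 2" using assms unfolding wf_ugraph_def by blast+
  then show "u \<in> vertices G" "v \<in> vertices G" "u \<noteq> v" by auto
qed

lemma reachable_closed:
  assumes "reachable_in G x y" "x \<in> A" "\<And>u v. u \<in> A \<Longrightarrow> {u, v} \<in> edges G \<Longrightarrow> v \<in> A"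
  shows "y \<in> A"
  using assms(1,2) by (induction rule: rtranclp_induct) (auto simp: adjacent_def intro: assms(3))

lemma connected_set_iff_reachable:
  assumes "wf_ugraph G"
  shows "connected_graph G \<longleftrightarrow> nonempty_connected G"
proof
  assume c: "connected_graph G"
  have "vertices G \<subseteq> {y. reachable_in G x y}" if "x \<in> vertices G" for x
    using c that
  proof (rule connected_set_subset)
    fix u v assume "u \<in> {y. reachable_in G x y}" "{u, v} \<in> edges G"
    then show "v \<in> {y. reachable_in G x y}"
      by (auto simp: adjacent_def intro: rtranclp.rtrancl_into_rtrancl)
  qed simp
  then show "nonempty_connected G"
    using connected_set_nonempty[OF c] unfolding nonempty_connected_def by blast
next
  assume c: "nonempty_connected G"
  then obtain x where "x \<in> vertices G" unfolding nonempty_connected_def by blast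
  then show "connected_graph G"
  proof (rule connected_setI)
    fix A assume A: "A \<subseteq> vertices G" "A \<noteq> {}"
      "\<And>x y. x \<in> A \<Longrightarrow> y \<in> vertices G \<Longrightarrow> {x, y} \<in> edges G \<Longrightarrow> y \<in> A"
    then obtain a where a: "a \<in> A" by blast
    show "vertices G \<subseteq> A"
    proof
      fix y assume "y \<in> vertices G"
      then have "reachable_in G a y" using c a A(1) unfolding nonempty_connected_def by blast
      then show "y \<in> A" using a
        by (rule reachable_closed) (use A(3) edge_vertices[OF assms] in blast)
    qed
  qed
qed

lemma wf_induced_subgraph: "wf_ugraph G \<Longrightarrow> wf_ugraph (induced_subgraph G W)"
  by (auto simp: wf_ugraph_def induced_subgraph_def)

lemma minor_model_imp_set_model:
  assumes "wf_ugraph G" "minor_model B E G H"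
  shows "graph_model (\<lambda>v. vertices (B v)) G H"
proof (rule set_modelI)
  fix v assume "v \<in> vertices G"
  then have sub: "subgraph (B v) H" and con: "nonempty_connected (B v)"
    using assms(2) unfolding minor_model_def by auto
  show "vertices (B v) \<subseteq> vertices H" using sub by (simp add: subgraph_def)
  have "connected_graph (B v)"
    using con sub by (simp add: connected_set_iff_reachable subgraph_def)
  then show "connected_set (edges H) (vertices (B v))"
    using sub by (auto simp: subgraph_def intro: connected_set_mono)
next
  fix u v assume "u \<in> vertices G" "v \<in> vertices G" "u \<noteq> v"
  then show "vertices (B u) \<inter> vertices (B v) = {}" using assms(2) by (simp add: minor_model_def)
next
  fix u v assume "{u, v} \<in> edges G"
  then have "E {u, v} \<in> edges H \<and> (\<exists>x\<in>vertices (B u). \<exists>y\<in>vertices (B v). E {u, v} = {x, y})"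
    using assms(2) unfolding minor_model_def by blast
  then show "\<exists>x\<in>vertices (B u). \<exists>y\<in>vertices (B v). {x, y} \<in> edges H" by metis
qed

lemma set_model_imp_minor_model:
  assumes "wf_ugraph G" "wf_ugraph H"
    and M: "graph_model B G H"
  shows "\<exists>B' E. minor_model B' E G H \<and> (\<forall>v\<in>vertices G. vertices (B' v) = B v)"
proof -
  note M = set_modelD[OF M]
  let ?B = "\<lambda>v. induced_subgraph H (B v)"
  \<comment> \<open>An edge is assigned to the unordered pair \<open>e\<close>, so it has to fit both orders of its ends.\<close>
  define E where "E e = (SOME f. f \<in> edges H \<and>
    (\<forall>u v. e = {u, v} \<longrightarrow> (\<exists>x\<in>B u. \<exists>y\<in>B v. f = {x, y})))" for e
  have vB: "vertices (?B v) = B v" if "v \<in> vertices G" for v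
    using M(1)[OF that] by (auto simp: induced_subgraph_def)
  have E: "E {u, v} \<in> edges H \<and> (\<exists>x\<in>B u. \<exists>y\<in>B v. E {u, v} = {x, y})" if uv: "{u, v} \<in> edges G" for u v
  proof -
    obtain x y where xy: "x \<in> B u" "y \<in> B v" "{x, y} \<in> edges H"
      using M(4)[of u v] edge_vertices[OF assms(1) uv] uv by blast
    have "\<exists>p\<in>B u'. \<exists>q\<in>B v'. {x, y} = {p, q}" if "{u, v} = {u', v'}" for u' v'
    proof -
      have "u' = u \<and> v' = v \<or> u' = v \<and> v' = u" using that by (auto simp: doubleton_eq_iff)
      then show ?thesis using xy(1,2) by (auto simp: insert_commute)
    qed
    then have "\<exists>f. f \<in> edges H \<and> (\<forall>u' v'. {u, v} = {u', v'} \<longrightarrow> (\<exists>x\<in>B u'. \<exists>y\<in>B v'. f = {x, y}))"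
      using xy(3) by (intro exI[of _ "{x, y}"]) simp
    from someI_ex[OF this]
    have "E {u, v} \<in> edges H \<and>
        (\<forall>u' v'. {u, v} = {u', v'} \<longrightarrow> (\<exists>x\<in>B u'. \<exists>y\<in>B v'. E {u, v} = {x, y}))"
      unfolding E_def .
    then show ?thesis by simp
  qed
  have "minor_model ?B E G H"
    unfolding minor_model_def
  proof (intro conjI ballI impI allI)
    fix v assume v: "v \<in> vertices G"
    show "subgraph (?B v) H"
      using wf_induced_subgraph[OF assms(2)] by (auto simp: subgraph_def induced_subgraph_def)
    have "connected_set (edges (?B v)) (B v)"
      using M(2)[OF v] by (rule connected_set_mono) (auto simp: induced_subgraph_def)
    then show "nonempty_connected (?B v)"
      using connected_set_iff_reachable[OF wf_induced_subgraph[OF assms(2)], of "B v"] vB[OF v] by simp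
  next
    fix u v assume "u \<in> vertices G" "v \<in> vertices G" "u \<noteq> v"
    then show "vertices (?B u) \<inter> vertices (?B v) = {}" using M(3) vB by simp
  next
    fix u v assume uv: "{u, v} \<in> edges G"
    then show "E {u, v} \<in> edges H" using E[OF uv] by simp
    show "\<exists>x\<in>vertices (?B u). \<exists>y\<in>vertices (?B v). E {u, v} = {x, y}"
      using E[OF uv] vB edge_vertices[OF assms(1) uv] by simp
  qed
  then show ?thesis using vB by (intro exI[of _ ?B] exI[of _ E]) simp
qed

lemma minor_iff:
  assumes "wf_ugraph G" "wf_ugraph H"
  shows "minor G H \<longleftrightarrow> (\<exists>B. graph_model B G H)"
proof
  assume "minor G H"
  then show "\<exists>B. graph_model B G H"
    unfolding minor_def using minor_model_imp_set_model[OF assms(1)] by blast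
next
  assume "\<exists>B. graph_model B G H"
  then obtain B where "graph_model B G H" ..
  from set_model_imp_minor_model[OF assms this] show "minor G H"
    unfolding minor_def by blast
qed

lemma marked_minor_iff:
  assumes "wf_ugraph G" "wf_ugraph H" "M \<subseteq> vertices G"
  shows "marked_minor (G, M) (H, M') \<longleftrightarrow>
    (\<exists>B. graph_model B G H \<and> (\<forall>v\<in>M. B v \<inter> M' \<noteq> {}))"
    (is "_ \<longleftrightarrow> ?R")
proof
  assume "marked_minor (G, M) (H, M')"
  then obtain B E where "minor_model B E G H" "\<forall>v\<in>M. vertices (B v) \<inter> M' \<noteq> {}"
    by (auto simp: marked_minor_def)
  then show ?R using minor_model_imp_set_model[OF assms(1)] by blast
next
  assume ?R
  then obtain B where B: "graph_model B G H"
    "\<forall>v\<in>M. B v \<inter> M' \<noteq> {}" by blast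
  obtain B' E where "minor_model B' E G H" "\<forall>v\<in>vertices G. vertices (B' v) = B v"
    using set_model_imp_minor_model[OF assms(1,2) B(1)] by blast
  then have "minor_model B' E G H \<and> (\<forall>v\<in>M. vertices (B' v) \<inter> M' \<noteq> {})" using B(2) assms(3) by auto
  then show "marked_minor (G, M) (H, M')" unfolding marked_minor_def by blast
qed

lemma marked_minor_unmarked:
  assumes "wf_ugraph G" "wf_ugraph H"
  shows "marked_minor (G, {}) (H, {}) \<longleftrightarrow> minor G H"
  by (simp add: marked_minor_iff minor_iff assms)

lemma marked_minor_trans:
  assumes "wf_ugraph G" "wf_ugraph H" "wf_ugraph K" "M \<subseteq> vertices G" "M' \<subseteq> vertices H"
    and "marked_minor (G, M) (H, M')" "marked_minor (H, M') (K, M'')"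
  shows "marked_minor (G, M) (K, M'')"
proof -
  obtain B where B: "graph_model B G H" "\<forall>v\<in>M. B v \<inter> M' \<noteq> {}"
    using assms(6) unfolding marked_minor_iff[OF assms(1,2,4)] by blast
  obtain B' where B': "graph_model B' H K"
    "\<forall>v\<in>M'. B' v \<inter> M'' \<noteq> {}"
    using assms(7) unfolding marked_minor_iff[OF assms(2,3,5)] by blast
  have "\<Union>(B' ` B v) \<inter> M'' \<noteq> {}" if v: "v \<in> M" for v
  proof -
    obtain w where "w \<in> B v" "w \<in> M'" using B(2) v by blast
    then show ?thesis using B'(2) by blast
  qed
  then show ?thesis
    unfolding marked_minor_iff[OF assms(1,3,4)] using set_model_trans[OF B(1) B'(1)]
    by (intro exI[of _ "\<lambda>u. \<Union>(B' ` B u)"]) simp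
qed


section \<open>Rank\<close>

text \<open>The rank of induced subgraphs of a fixed graph with edge set \<open>E\<close>.  Quantifying over all connected
  sets that avoid \<open>S\<close>, rather than over components, makes rank \<open>0\<close> (only finite sets, as singletons are
  connected) an instance of the general clause, and the behaviour under minors immediate.\<close>

function rank_le :: "'a set set \<Rightarrow> countable_ordinal \<Rightarrow> 'a set \<Rightarrow> bool" where
  "rank_le E \<alpha> W \<longleftrightarrow>
     (\<exists>S. finite S \<and> (\<forall>X. X \<subseteq> W - S \<longrightarrow> connected_set E X \<longrightarrow> (\<exists>\<beta>\<in>{..<\<alpha>}. rank_le E \<beta> X)))"
  by pat_completeness auto
termination
  by (relation "{((E, \<alpha>, W), (E', \<beta>, W')). \<alpha> < \<beta>}")
    (auto intro: wf_subset[OF wf_inv_image[OF wf, of "\<lambda>(E, \<alpha>, W). \<alpha>"]] simp: inv_image_def)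

declare rank_le.simps [simp del]

abbreviation graph_rank_le :: "countable_ordinal \<Rightarrow> 'a ugraph \<Rightarrow> bool" where
  "graph_rank_le \<alpha> G \<equiv> rank_le (edges G) \<alpha> (vertices G)"

text \<open>A finite set whose deletion leaves only pieces of rank below \<open>\<alpha>\<close>; the number of its elements
  serves as a measure within one rank.\<close>

definition kernel :: "'a set set \<Rightarrow> countable_ordinal \<Rightarrow> 'a set \<Rightarrow> 'a set \<Rightarrow> bool" where
  "kernel E \<alpha> W S \<longleftrightarrow> finite S \<and> (\<forall>X. X \<subseteq> W - S \<longrightarrow> connected_set E X \<longrightarrow> (\<exists>\<beta><\<alpha>. rank_le E \<beta> X))"

lemma rank_le_iff: "rank_le E \<alpha> W \<longleftrightarrow> (\<exists>S. kernel E \<alpha> W S)"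
  unfolding kernel_def rank_le.simps[of E \<alpha> W] by (simp add: Bex_def)

lemma kernelI:
  assumes "finite S" "\<And>X. X \<subseteq> W - S \<Longrightarrow> connected_set E X \<Longrightarrow> \<exists>\<beta><\<alpha>. rank_le E \<beta> X"
  shows "kernel E \<alpha> W S"
  using assms by (simp add: kernel_def)

lemma kernelD:
  "kernel E \<alpha> W S \<Longrightarrow> X \<subseteq> W - S \<Longrightarrow> connected_set E X \<Longrightarrow> \<exists>\<beta><\<alpha>. rank_le E \<beta> X"
  by (simp add: kernel_def)

lemma kernel_finite: "kernel E \<alpha> W S \<Longrightarrow> finite S"
  by (simp add: kernel_def)

lemma rank_leI: "kernel E \<alpha> W S \<Longrightarrow> rank_le E \<alpha> W"
  unfolding rank_le_iff by (rule exI)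

lemma kernel_mono: "kernel E \<alpha> W S \<Longrightarrow> \<alpha> \<le> \<beta> \<Longrightarrow> kernel E \<beta> W S"
  unfolding kernel_def by (meson less_le_trans)

lemma kernel_superset:
  assumes "kernel E \<alpha> W S" "finite T" "S \<inter> W \<subseteq> T"
  shows "kernel E \<alpha> W T"
  using assms(2)
proof (rule kernelI)
  fix X assume "X \<subseteq> W - T" "connected_set E X"
  moreover from this have "X \<subseteq> W - S" using assms(3) by blast
  ultimately show "\<exists>\<beta><\<alpha>. rank_le E \<beta> X" using kernelD[OF assms(1)] by simp
qed

lemma kernel_Union:
  assumes I: "finite I" and S: "\<And>i. i \<in> I \<Longrightarrow> kernel E \<alpha> (W i) (S i)"
    and sep: "\<And>X. X \<subseteq> (\<Union>i\<in>I. W i) \<Longrightarrow> connected_set E X \<Longrightarrow> \<exists>i\<in>I. X \<subseteq> W i"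
  shows "kernel E \<alpha> (\<Union>i\<in>I. W i) (\<Union>i\<in>I. S i)"
proof (rule kernelI)
  show "finite (\<Union>i\<in>I. S i)" using I S kernel_finite by blast
  fix X assume X: "X \<subseteq> (\<Union>i\<in>I. W i) - (\<Union>i\<in>I. S i)" "connected_set E X"
  then have "X \<subseteq> (\<Union>i\<in>I. W i)" by blast
  from sep[OF this X(2)] obtain i where "i \<in> I" "X \<subseteq> W i" by blast
  then have "X \<subseteq> W i - S i" using X(1) by blast
  then show "\<exists>\<beta><\<alpha>. rank_le E \<beta> X" using kernelD[OF S[OF \<open>i \<in> I\<close>]] X(2) by simp
qed

text \<open>Meant for the vertices whose branch sets meet a kernel \<open>S\<close>: disjoint branch sets meet \<open>S\<close> in
  different elements.\<close>

lemma touched_finite: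
  assumes "finite S" and disj: "\<And>u v. u \<in> U \<Longrightarrow> v \<in> U \<Longrightarrow> u \<noteq> v \<Longrightarrow> B u \<inter> B v = {}"
  shows "finite {u \<in> U. B u \<inter> S \<noteq> {}}" "card {u \<in> U. B u \<inter> S \<noteq> {}} \<le> card S"
proof -
  let ?T = "{u \<in> U. B u \<inter> S \<noteq> {}}"
  have "\<forall>u\<in>?T. \<exists>x. x \<in> B u \<and> x \<in> S" by blast
  then obtain f where f: "\<forall>u\<in>?T. f u \<in> B u \<and> f u \<in> S"
    using bchoice[of ?T "\<lambda>u x. x \<in> B u \<and> x \<in> S"] by blast
  have "inj_on f ?T"
  proof (rule inj_onI)
    fix u v assume "u \<in> ?T" "v \<in> ?T" "f u = f v"
    then show "u = v" using f disj[of u v] by (metis (no_types, lifting) disjoint_iff mem_Collect_eq)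
  qed
  moreover have "f ` ?T \<subseteq> S" using f by blast
  ultimately show "finite ?T" "card ?T \<le> card S"
    using assms(1) by (auto intro: inj_on_finite card_inj_on_le)
qed

text \<open>A connected set of vertices whose branch sets avoid \<open>S\<close> has a connected union of branch sets
  avoiding \<open>S\<close>, and by induction inherits its rank.\<close>

lemma kernel_model:
  assumes "kernel E' \<alpha> W S" "set_model B U E W E'"
  shows "kernel E \<alpha> U {u \<in> U. B u \<inter> S \<noteq> {}}"
  using assms
proof (induction \<alpha> arbitrary: W U S rule: less_induct)
  case (less \<alpha>)
  note M = set_modelD[OF less.prems(2)]
  show ?case
  proof (rule kernelI)
    show "finite {u \<in> U. B u \<inter> S \<noteq> {}}"
      by (rule touched_finite(1)[OF kernel_finite[OF less.prems(1)] M(3)])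
    fix X assume X: "X \<subseteq> U - {u \<in> U. B u \<inter> S \<noteq> {}}" "connected_set E X"
    then have XU: "X \<subseteq> U" by blast
    have "\<Union>(B ` X) \<subseteq> W - S" using X(1) M(1) by blast
    then obtain \<beta> where \<beta>: "\<beta> < \<alpha>" "rank_le E' \<beta> (\<Union>(B ` X))"
      using kernelD[OF less.prems(1) _ set_model_connected[OF less.prems(2) XU X(2)]] by blast
    then obtain S' where S': "kernel E' \<beta> (\<Union>(B ` X)) S'" by (auto simp: rank_le_iff)
    have "set_model B X E (\<Union>(B ` X)) E'"
      by (rule set_model_target[OF set_model_subset[OF less.prems(2) XU]]) blast
    then have "rank_le E \<beta> X" using less.IH[OF \<beta>(1) S'] rank_leI by blast
    then show "\<exists>\<beta><\<alpha>. rank_le E \<beta> X" using \<beta>(1) by blast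
  qed
qed

lemma rank_le_model:
  assumes "rank_le E' \<alpha> W" "set_model B U E W E'"
  shows "rank_le E \<alpha> U"
proof -
  obtain S where "kernel E' \<alpha> W S" using assms(1) by (auto simp: rank_le_iff)
  then show ?thesis by (rule rank_leI[OF kernel_model[OF _ assms(2)]])
qed

lemma set_model_identity:
  assumes "U \<subseteq> W" "\<And>u v. u \<in> U \<Longrightarrow> v \<in> U \<Longrightarrow> {u, v} \<in> E \<Longrightarrow> {u, v} \<in> E'"
  shows "set_model (\<lambda>u. {u}) U E W E'"
  using set_model_embedding[of "\<lambda>u. u" U W E E'] assms by simp

lemma rank_le_subset:
  assumes "rank_le E' \<alpha> W" "U \<subseteq> W" "\<And>u v. u \<in> U \<Longrightarrow> v \<in> U \<Longrightarrow> {u, v} \<in> E \<Longrightarrow> {u, v} \<in> E'"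
  shows "rank_le E \<alpha> U"
  by (rule rank_le_model[OF assms(1) set_model_identity]) (use assms in auto)

lemma rank_le_finite:
  assumes "finite W"
  shows "rank_le E \<alpha> W"
proof (rule rank_leI)
  show "kernel E \<alpha> W W"
    using assms by (rule kernelI) (use connected_set_nonempty in auto)
qed

text \<open>A finite kernel misses one of infinitely many disjoint copies, and the branch sets of that copy
  would form a connected set of rank below \<open>\<rho>\<close>.\<close>

lemma not_rank_le_many_copies:
  assumes K: "infinite K" and D: "\<And>k. k \<in> K \<Longrightarrow> set_model (B k) U E (W - T) E'"
    and disj: "\<And>k l u v. k \<in> K \<Longrightarrow> l \<in> K \<Longrightarrow> k \<noteq> l \<Longrightarrow> u \<in> U \<Longrightarrow> v \<in> U \<Longrightarrow> B k u \<inter> B l v = {}"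
    and U: "connected_set E U" and rk: "\<And>\<beta>. \<beta> < \<rho> \<Longrightarrow> \<not> rank_le E \<beta> U"
  shows "\<not> rank_le E' \<rho> W"
proof
  assume "rank_le E' \<rho> W"
  then obtain S where S: "kernel E' \<rho> W S" by (auto simp: rank_le_iff)
  let ?D = "\<lambda>k. \<Union>(B k ` U)"
  have "?D k \<inter> ?D l = {}" if "k \<in> K" "l \<in> K" "k \<noteq> l" for k l
    using disj[OF that] by blast
  then have "finite {k \<in> K. ?D k \<inter> S \<noteq> {}}"
    by (rule touched_finite(1)[OF kernel_finite[OF S]])
  then obtain k where k: "k \<in> K" "?D k \<inter> S = {}"
    using K by (metis (mono_tags, lifting) mem_Collect_eq rev_finite_subset subsetI)
  have "?D k \<subseteq> W - S" using k set_modelD(1)[OF D[OF k(1)]] by blast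
  moreover have "connected_set E' (?D k)" by (rule set_model_connected[OF D[OF k(1)] order_refl U])
  ultimately obtain \<beta> where \<beta>: "\<beta> < \<rho>" "rank_le E' \<beta> (?D k)" using kernelD[OF S] by blast
  have "set_model (B k) U E (?D k) E'" by (rule set_model_target[OF D[OF k(1)]]) blast
  then have "rank_le E \<beta> U" by (rule rank_le_model[OF \<beta>(2)])
  then show False using rk \<beta>(1) by blast
qed

text \<open>A connected set avoiding \<open>S\<close> lies in a component of \<open>G - S\<close> and inherits its rank; conversely
  the components themselves are connected sets.\<close>

lemma Rank_iff_rank_le: "G \<in> Rank \<alpha> \<longleftrightarrow> wf_ugraph G \<and> graph_rank_le \<alpha> G"
proof (induction \<alpha> arbitrary: G rule: less_induct)
  case (less \<alpha>)
  show ?case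
  proof (cases "\<alpha> = 0")
    case True
    have "finite (vertices G)" if S: "kernel (edges G) \<alpha> (vertices G) S" for S
    proof -
      have "\<not> {x} \<subseteq> vertices G - S" for x
        using kernelD[OF S _ connected_set_singleton] True zero_least by (metis not_less)
      then have "vertices G \<subseteq> S" by blast
      then show ?thesis using kernel_finite[OF S] finite_subset by blast
    qed
    then have "graph_rank_le \<alpha> G \<longleftrightarrow> finite (vertices G)"
      using rank_le_finite[of "vertices G" "edges G" \<alpha>] unfolding rank_le_iff by blast
    then show ?thesis by (simp add: True Rank.simps[of 0])
  next
    case False
    have comp_wf: "wf_ugraph C" if "wf_ugraph G" "C \<in> graph_components (delete_vertices G S)" for C S
      using that by (auto simp: graph_components_def delete_vertices_def wf_induced_subgraph)
    have closed: "v \<in> vertices (delete_vertices G S)"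
      if "wf_ugraph G" "{u, v} \<in> edges (delete_vertices G S)" for u v S
      using edge_vertices[OF wf_induced_subgraph[OF that(1)]] that(2) unfolding delete_vertices_def
        by blast
    show ?thesis
    proof
      assume "G \<in> Rank \<alpha>"
      then obtain S where wf: "wf_ugraph G" and S: "finite S" "S \<subseteq> vertices G"
        "\<forall>C\<in>graph_components (delete_vertices G S). \<exists>\<beta>\<in>{..<\<alpha>}. C \<in> Rank \<beta>"
        using False by (auto simp: Rank.simps[of \<alpha>])
      have "kernel (edges G) \<alpha> (vertices G) S"
        using S(1)
      proof (rule kernelI)
        fix X assume X: "X \<subseteq> vertices G - S" "connected_set (edges G) X"
        let ?G' = "delete_vertices G S"
        obtain x where x: "x \<in> X" using connected_set_nonempty[OF X(2)] by blast
        let ?C = "induced_subgraph ?G' {y. reachable_in ?G' x y}"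
        have "x \<in> vertices ?G'" using x X(1) by (auto simp: delete_vertices_def induced_subgraph_def)
        then have C: "?C \<in> graph_components ?G'" unfolding graph_components_def by blast
        then obtain \<beta> where \<beta>: "\<beta> < \<alpha>" "?C \<in> Rank \<beta>" using S(3) by blast
        then have rk: "graph_rank_le \<beta> ?C" using less.IH by blast
        have reach: "X \<subseteq> {y. reachable_in ?G' x y}"
        proof (rule connected_set_subset[OF X(2) x])
          fix u v assume "u \<in> {y. reachable_in ?G' x y}" "u \<in> X" "v \<in> X" "{u, v} \<in> edges G"
          moreover from this have "{u, v} \<in> edges ?G'"
            using X(1) by (auto simp: delete_vertices_def induced_subgraph_def)
          ultimately show "v \<in> {y. reachable_in ?G' x y}"
            by (auto simp: adjacent_def intro: rtranclp.rtrancl_into_rtrancl)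
        qed simp
        have "rank_le (edges G) \<beta> X"
        proof (rule rank_le_subset[OF rk])
          show "X \<subseteq> vertices ?C" using reach X(1)
            by (auto simp: delete_vertices_def induced_subgraph_def)
          fix u v assume "u \<in> X" "v \<in> X" "{u, v} \<in> edges G"
          then show "{u, v} \<in> edges ?C"
            using reach X(1) by (auto simp: delete_vertices_def induced_subgraph_def)
        qed
        then show "\<exists>\<beta><\<alpha>. rank_le (edges G) \<beta> X" using \<beta>(1) by blast
      qed
      then show "wf_ugraph G \<and> graph_rank_le \<alpha> G" using wf rank_leI by blast
    next
      assume G: "wf_ugraph G \<and> graph_rank_le \<alpha> G"
      then obtain S' where S': "kernel (edges G) \<alpha> (vertices G) S'" by (auto simp: rank_le_iff)
      define S where "S = S' \<inter> vertices G"
      have S: "kernel (edges G) \<alpha> (vertices G) S"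
        by (rule kernel_superset[OF S']) (use kernel_finite[OF S'] in \<open>auto simp: S_def\<close>)
      have "\<exists>\<beta>\<in>{..<\<alpha>}. C \<in> Rank \<beta>" if C: "C \<in> graph_components (delete_vertices G S)" for C
      proof -
        let ?G' = "delete_vertices G S"
        obtain x where x: "x \<in> vertices ?G'" "C = induced_subgraph ?G' {y. reachable_in ?G' x y}"
          using C unfolding graph_components_def by blast
        have sub: "vertices C \<subseteq> vertices G - S"
          using x(2) by (auto simp: delete_vertices_def induced_subgraph_def)
        have "{u, v} \<in> edges C \<longleftrightarrow> {u, v} \<in> edges G" if "u \<in> vertices C" "v \<in> vertices C" for u v
          using that x(2) by (auto simp: delete_vertices_def induced_subgraph_def)
        note edges_C = this
        have xC: "x \<in> vertices C" using x by (auto simp: delete_vertices_def induced_subgraph_def)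
        then have "connected_set (edges G) (vertices C)"
        proof (rule connected_setI)
          fix A assume A: "A \<subseteq> vertices C" "A \<noteq> {}"
            "\<And>u v. u \<in> A \<Longrightarrow> v \<in> vertices C \<Longrightarrow> {u, v} \<in> edges G \<Longrightarrow> v \<in> A"
          have step: "v \<in> vertices C \<and> {u, v} \<in> edges G" if "u \<in> vertices C" "{u, v} \<in> edges ?G'" for u v
            using that x(2) closed[OF conjunct1[OF G] that(2)]
            by (auto simp: induced_subgraph_def adjacent_def delete_vertices_def
                intro: rtranclp.rtrancl_into_rtrancl)
          have reach_sym: "reachable_in ?G' u v" if "reachable_in ?G' v u" for u v
          proof -
            have "symp (adjacent ?G')" by (auto simp: symp_def adjacent_def insert_commute)
            then show ?thesis using that symp_rtranclp by (metis sympD)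
          qed
          obtain a where a: "a \<in> A" using A(2) by blast
          then have "reachable_in ?G' x a" using A(1) x(2) by (auto simp: induced_subgraph_def)
          then have "reachable_in ?G' a x" by (rule reach_sym)
          then have "x \<in> A" using a
            by (rule reachable_closed) (use A(1,3) step in blast)
          show "vertices C \<subseteq> A"
          proof
            fix y assume "y \<in> vertices C"
            then have "reachable_in ?G' x y" using x(2) by (simp add: induced_subgraph_def)
            then show "y \<in> A" using \<open>x \<in> A\<close>
              by (rule reachable_closed) (use A(1,3) step in blast)
          qed
        qed
        then obtain \<beta> where \<beta>: "\<beta> < \<alpha>" "rank_le (edges G) \<beta> (vertices C)"
          using kernelD[OF S sub] by blast
        have "graph_rank_le \<beta> C"
          by (rule rank_le_subset[OF \<beta>(2) order_refl]) (use edges_C in blast)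
        then have "C \<in> Rank \<beta>" using less.IH[OF \<beta>(1)] comp_wf C G by blast
        then show ?thesis using \<beta>(1) by blast
      qed
      then show "G \<in> Rank \<alpha>"
        using False G kernel_finite[OF S] by (auto simp: Rank.simps[of \<alpha>] S_def)
    qed
  qed
qed


section \<open>Raylessness\<close>

text \<open>If \<open>W\<close> has no rank, then after deleting a vertex \<open>x\<close> some component has no rank, since countably many
  ranks are bounded; repeating this inside that component, from a neighbour of \<open>x\<close>, yields a ray.\<close>

lemma unranked_component:
  fixes W :: "'a::countable set"
  assumes W: "\<And>\<alpha>. \<not> rank_le E \<alpha> W" and "finite S"
  shows "\<exists>x\<in>W - S. \<forall>\<alpha>. \<not> rank_le E \<alpha> (component E (W - S) x)"
proof (rule ccontr)
  assume "\<not> ?thesis"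
  then have "\<forall>x\<in>W - S. \<exists>\<alpha>. rank_le E \<alpha> (component E (W - S) x)" by blast
  then obtain r where r: "\<forall>x\<in>W - S. rank_le E (r x) (component E (W - S) x)"
    using bchoice[of "W - S" "\<lambda>x \<alpha>. rank_le E \<alpha> (component E (W - S) x)"] by blast
  have "countable (r ` (W - S))" by simp
  then obtain \<alpha> where \<alpha>: "\<forall>\<beta>\<in>r ` (W - S). \<beta> < \<alpha>" using countable_bounded by blast
  have "kernel E \<alpha> W S"
    using assms(2)
  proof (rule kernelI)
    fix X assume X: "X \<subseteq> W - S" "connected_set E X"
    then obtain x where x: "x \<in> X" using connected_set_nonempty by blast
    then have xW: "x \<in> W - S" using X by blast
    have "rank_le E (r x) X"
      by (rule rank_le_subset[OF r[rule_format, OF xW] component_max[OF X(2,1) x]])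
    then show "\<exists>\<beta><\<alpha>. rank_le E \<beta> X" using \<alpha> xW by blast
  qed
  then show False using W rank_leI by blast
qed

lemma rayless_imp_ranked:
  fixes G :: "'a::countable ugraph"
  assumes "rayless G"
  shows "\<exists>\<alpha>. graph_rank_le \<alpha> G"
proof (rule ccontr)
  assume unranked: "\<not> ?thesis"
  let ?E = "edges G"
  let ?P = "\<lambda>(X, x). connected_set ?E X \<and> x \<in> X \<and> (\<forall>\<alpha>. \<not> rank_le ?E \<alpha> X)"
  let ?R = "\<lambda>(X, x) (Y, y). Y \<subseteq> X - {x} \<and> {x, y} \<in> ?E"
  have start: "\<exists>s. ?P s"
  proof -
    obtain x where x: "x \<in> vertices G - {}" "\<forall>\<alpha>. \<not> rank_le ?E \<alpha> (component ?E (vertices G - {}) x)"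
      using unranked_component[of ?E "vertices G" "{}"] unranked by auto
    then have "?P (component ?E (vertices G - {}) x, x)"
      using component_connected[OF x(1)] component_self[OF x(1)] by simp
    then show ?thesis by (rule exI)
  qed
  have step: "\<exists>t. ?P t \<and> ?R s t" if s: "?P s" for s
  proof -
    obtain X x where sX: "s = (X, x)" by (cases s)
    have X: "connected_set ?E X" "x \<in> X" "\<forall>\<alpha>. \<not> rank_le ?E \<alpha> X" using s sX by simp_all
    obtain z where z: "z \<in> X - {x}" "\<forall>\<alpha>. \<not> rank_le ?E \<alpha> (component ?E (X - {x}) z)"
      using unranked_component[of ?E X "{x}"] X(3) by auto
    let ?Y = "component ?E (X - {x}) z"
    have "\<exists>y\<in>?Y. {x, y} \<in> ?E"
    proof (rule ccontr)
      assume no: "\<not> ?thesis"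
      have "z \<in> X" using z(1) by blast
      from X(1) this component_self[OF z(1)] have "X \<subseteq> ?Y"
      proof (rule connected_set_subset)
        fix u v assume uv: "u \<in> ?Y" "v \<in> X" "{u, v} \<in> ?E"
        then have "v \<noteq> x" using no by (auto simp: insert_commute)
        then show "v \<in> ?Y" using component_closed[OF uv(1)] uv by blast
      qed
      then show False using X(2) component_subset[of ?E "X - {x}" z] by blast
    qed
    then obtain y where y: "y \<in> ?Y" "{x, y} \<in> ?E" by blast
    have "?P (?Y, y) \<and> ?R s (?Y, y)"
      using y z(2) component_connected[OF z(1)] component_subset[of ?E "X - {x}" z] sX by simp
    then show ?thesis by (rule exI)
  qed
  have "\<exists>f. \<forall>n. ?P (f n) \<and> ?R (f n) (f (Suc n))"
  proof (rule dependent_nat_choice[where P = "\<lambda>n. ?P" and Q = "\<lambda>n. ?R"])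
    show "\<exists>s. ?P s" by (fact start)
    show "\<exists>t. ?P t \<and> ?R s t" if "?P s" for s n by (rule step[OF that])
  qed
  then obtain f where "\<forall>n. ?P (f n) \<and> ?R (f n) (f (Suc n))" ..
  then have f: "?P (f n)" "?R (f n) (f (Suc n))" for n by simp_all
  define p where "p n = snd (f n)" for n
  have edge: "{p n, p (Suc n)} \<in> ?E" and shrink: "fst (f (Suc n)) \<subseteq> fst (f n) - {p n}" for n
    using f(2)[of n] by (simp_all add: p_def split_beta)
  have in_set: "p n \<in> fst (f n)" for n using f(1)[of n] by (simp add: p_def split_beta)
  have later: "fst (f (Suc (n + k))) \<subseteq> fst (f n) - {p n}" for n k
  proof (induction k)
    case (Suc k)
    then show ?case using shrink[of "Suc (n + k)"] by auto
  qed (use shrink[of n] in simp)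
  have "p m \<noteq> p n" if less: "m < n" for m n
  proof -
    obtain k where k: "n = Suc (m + k)" using less_imp_Suc_add[OF less] ..
    have "p n \<in> fst (f n)" by (rule in_set)
    then have "p n \<in> fst (f m) - {p m}" unfolding k by (rule subsetD[OF later])
    then show ?thesis by (metis Diff_iff singletonI)
  qed
  then have "inj p" by (rule linorder_injI)
  then show False using assms edge unfolding rayless_def by blast
qed

text \<open>A tail of the ray avoids the kernel and is a connected set, of smaller rank, that contains a
  ray.\<close>

lemma ranked_imp_no_ray:
  assumes "rank_le E \<alpha> W" "inj p" "\<And>n::nat. {p n, p (Suc n)} \<in> E" "range p \<subseteq> W"
  shows False
  using assms
proof (induction \<alpha> arbitrary: W p rule: less_induct)
  case (less \<alpha>)
  obtain S where S: "kernel E \<alpha> W S" using less.prems(1) by (auto simp: rank_le_iff)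
  have "finite (p -` S)" using finite_vimageI[OF kernel_finite[OF S] less.prems(2)] .
  then obtain N where N: "\<forall>n\<in>p -` S. n < N" using finite_nat_set_iff_bounded by blast
  let ?q = "\<lambda>n. p (N + n)"
  have "range ?q \<subseteq> W - S" using less.prems(4) N by fastforce
  moreover have "connected_set E (range ?q)"
  proof (rule connected_setI[of "?q 0"])
    fix A assume A: "A \<subseteq> range ?q" "A \<noteq> {}"
      "\<And>x y. x \<in> A \<Longrightarrow> y \<in> range ?q \<Longrightarrow> {x, y} \<in> E \<Longrightarrow> y \<in> A"
    have up: "?q (Suc n) \<in> A" if "?q n \<in> A" for n
      using A(3)[OF that rangeI[of ?q "Suc n"]] less.prems(3)[of "N + n"] by simp
    have down: "?q n \<in> A" if "?q (Suc n) \<in> A" for n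
      using A(3)[OF that rangeI[of ?q n]] less.prems(3)[of "N + n"] by (simp add: insert_commute)
    obtain k where k: "?q k \<in> A" using A(1,2) by blast
    have "?q n \<in> A \<longleftrightarrow> ?q 0 \<in> A" for n
      by (induction n) (use up down in blast)+
    then have "?q n \<in> A" for n using k by blast
    then show "range ?q \<subseteq> A" by blast
  qed (rule rangeI[of ?q 0])
  ultimately obtain \<beta> where \<beta>: "\<beta> < \<alpha>" "rank_le E \<beta> (range ?q)" using kernelD[OF S] by blast
  have "inj ?q" using injD[OF less.prems(2)] by (intro injI) fastforce
  moreover have "{?q n, ?q (Suc n)} \<in> E" for n using less.prems(3)[of "N + n"] by simp
  ultimately show False using less.IH[OF \<beta>] by blast
qed

lemma rayless_iff_ranked:
  fixes G :: "'a::countable ugraph"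
  assumes "wf_ugraph G"
  shows "rayless G \<longleftrightarrow> (\<exists>\<alpha>. graph_rank_le \<alpha> G)"
proof
  assume "\<exists>\<alpha>. graph_rank_le \<alpha> G"
  then obtain \<alpha> where \<alpha>: "graph_rank_le \<alpha> G" ..
  show "rayless G"
    unfolding rayless_def
  proof
    assume "\<exists>p::nat \<Rightarrow> 'a. inj p \<and> (\<forall>n. {p n, p (Suc n)} \<in> edges G)"
    then obtain p :: "nat \<Rightarrow> 'a" where p: "inj p" "\<And>n. {p n, p (Suc n)} \<in> edges G" by blast
    have "p n \<in> vertices G" for n using edge_vertices(1)[OF assms p(2)] .
    then have "range p \<subseteq> vertices G" by blast
    then show False by (rule ranked_imp_no_ray[OF \<alpha> p])
  qed
qed (rule rayless_imp_ranked)

lemma Rank_rayless: "Rank \<alpha> \<subseteq> rayless_graphs"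
  by (auto simp: Rank_iff_rank_le rayless_graphs_def rayless_iff_ranked)

lemma rayless_in_Rank: "G \<in> rayless_graphs \<Longrightarrow> \<exists>\<alpha>. G \<in> Rank \<alpha>"
  by (auto simp: Rank_iff_rank_le rayless_graphs_def rayless_iff_ranked)


section \<open>Relabelling vertices\<close>

definition relabel :: "('a \<Rightarrow> 'b) \<Rightarrow> 'a ugraph \<Rightarrow> 'b ugraph" where
  "relabel f G = \<lparr>vertices = f ` vertices G, edges = (`) f ` edges G\<rparr>"

lemma wf_relabel:
  assumes "inj f" "wf_ugraph G"
  shows "wf_ugraph (relabel f G)"
  unfolding wf_ugraph_def
proof
  fix e assume "e \<in> edges (relabel f G)"
  then obtain e' where e': "e' \<in> edges G" "e = f ` e'" by (auto simp: relabel_def)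
  then have "e' \<subseteq> vertices G" "card e' = 2" using assms(2) by (auto simp: wf_ugraph_def)
  then show "e \<subseteq> vertices (relabel f G) \<and> card e = 2"
    using e'(2) card_image[OF inj_on_subset[OF assms(1) subset_UNIV], of e']
    by (auto simp: relabel_def)
qed

lemma relabel_edge:
  assumes "inj f"
  shows "{f u, f v} \<in> edges (relabel f G) \<longleftrightarrow> {u, v} \<in> edges G"
proof -
  have "{f u, f v} = f ` {u, v}" by simp
  then have "{f u, f v} \<in> edges (relabel f G) \<longleftrightarrow> f ` {u, v} \<in> (`) f ` edges G"
    by (simp add: relabel_def)
  also have "\<dots> \<longleftrightarrow> {u, v} \<in> edges G"
    by (rule inj_image_mem_iff) (simp add: inj_def inj_image_eq_iff[OF assms])
  finally show ?thesis .
qed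

lemma relabel_model:
  assumes "inj f"
  shows "graph_model (\<lambda>u. {f u}) G (relabel f G)"
proof (rule set_model_embedding)
  show "inj_on f (vertices G)" by (rule inj_on_subset[OF assms subset_UNIV])
  show "f ` vertices G \<subseteq> vertices (relabel f G)" by (simp add: relabel_def)
qed (simp add: relabel_edge[OF assms])

lemma unlabel_model:
  assumes "inj f"
  shows "graph_model (\<lambda>x. {inv f x}) (relabel f G) G"
proof (rule set_model_embedding)
  show "inj_on (inv f) (vertices (relabel f G))" "inv f ` vertices (relabel f G) \<subseteq> vertices G"
    using assms by (auto simp: relabel_def inj_on_def)
  fix u v assume "u \<in> vertices (relabel f G)" "v \<in> vertices (relabel f G)"
    and e: "{u, v} \<in> edges (relabel f G)"
  then obtain x y where "u = f x" "v = f y" by (auto simp: relabel_def)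
  then show "{inv f u, inv f v} \<in> edges G" using e assms by (simp add: relabel_edge)
qed

definition nat_graph :: "'a::countable ugraph \<Rightarrow> nat ugraph" where
  "nat_graph G = relabel to_nat G"

lemma wf_nat_graph: "wf_ugraph G \<Longrightarrow> wf_ugraph (nat_graph G)"
  unfolding nat_graph_def by (rule wf_relabel[OF inj_to_nat])

lemma to_nat_graph_model:
  "graph_model (\<lambda>u. {to_nat u}) G (nat_graph G)"
  unfolding nat_graph_def by (rule relabel_model[OF inj_to_nat])

lemma from_nat_graph_model:
  "graph_model (\<lambda>x. {inv to_nat x}) (nat_graph G) G"
  unfolding nat_graph_def by (rule unlabel_model[OF inj_to_nat])

lemma nat_graph_rank: "graph_rank_le \<alpha> G \<Longrightarrow> graph_rank_le \<alpha> (nat_graph G)"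
  by (rule rank_le_model[OF _ from_nat_graph_model])

lemma nat_graph_rayless:
  assumes "wf_ugraph G" "rayless G"
  shows "nat_graph G \<in> rayless_graphs"
proof -
  obtain \<alpha> where "graph_rank_le \<alpha> G" using rayless_imp_ranked[OF assms(2)] ..
  then have "graph_rank_le \<alpha> (nat_graph G)" by (rule nat_graph_rank)
  then show ?thesis
    unfolding rayless_graphs_def using rayless_iff_ranked wf_nat_graph[OF assms(1)] by blast
qed

lemma nat_graph_connected:
  assumes "connected_graph G"
  shows "connected_graph (nat_graph G)"
proof -
  have "\<Union>((\<lambda>u. {to_nat u}) ` vertices G) = vertices (nat_graph G)"
    by (auto simp: nat_graph_def relabel_def)
  then show ?thesis using set_model_connected[OF to_nat_graph_model order_refl assms] by simp
qed

lemma minor_nat_graph: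
  assumes "wf_ugraph G" "wf_ugraph H"
  shows "minor (nat_graph G) (nat_graph H) \<longleftrightarrow>
    (\<exists>B. graph_model B G H)" (is "?L \<longleftrightarrow> ?R")
proof
  assume ?L
  then obtain B where "graph_model B (nat_graph G) (nat_graph H)"
    unfolding minor_iff[OF wf_nat_graph[OF assms(1)] wf_nat_graph[OF assms(2)]] ..
  note m = set_model_trans[OF set_model_trans[OF to_nat_graph_model this] from_nat_graph_model]
  show ?R by (rule exI, rule m)
next
  assume ?R
  then obtain B where "graph_model B G H" ..
  note m = set_model_trans[OF set_model_trans[OF from_nat_graph_model this] to_nat_graph_model]
  show ?L
    unfolding minor_iff[OF wf_nat_graph[OF assms(1)] wf_nat_graph[OF assms(2)]] by (rule exI, rule m)
qed


section \<open>Spreading out a bad sequence of connected graphs\<close>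

definition connected_rayless_graphs :: "nat ugraph set" where
  "connected_rayless_graphs = {G \<in> rayless_graphs. connected_graph G}"

definition copies :: "(nat \<Rightarrow> nat) \<Rightarrow> (nat \<Rightarrow> nat ugraph) \<Rightarrow> nat set \<Rightarrow> (nat \<times> nat \<times> nat) ugraph" where
  "copies n G X =
     \<lparr>vertices = {(i, c, v). i \<in> X \<and> c < n i \<and> v \<in> vertices (G i)},
      edges = {{(i, c, u), (i, c, v)} | i c u v. i \<in> X \<and> c < n i \<and> {u, v} \<in> edges (G i)}\<rparr>"

lemma copies_vertices: "(i, c, v) \<in> vertices (copies n G X) \<longleftrightarrow> i \<in> X \<and> c < n i \<and> v \<in> vertices (G i)"
  by (simp add: copies_def)

lemma copies_edge:
  "{(i, c, u), (j, d, v)} \<in> edges (copies n G X) \<longleftrightarrow>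
     i = j \<and> c = d \<and> i \<in> X \<and> c < n i \<and> {u, v} \<in> edges (G i)"
proof
  assume "{(i, c, u), (j, d, v)} \<in> edges (copies n G X)"
  then obtain k b x y where *: "{(i, c, u), (j, d, v)} = {(k, b, x), (k, b, y)}" "k \<in> X" "b < n k"
      "{x, y} \<in> edges (G k)"
    unfolding copies_def by auto
  from *(1) consider "(i, c, u) = (k, b, x)" "(j, d, v) = (k, b, y)"
    | "(i, c, u) = (k, b, y)" "(j, d, v) = (k, b, x)"
    by (auto simp: doubleton_eq_iff)
  then show "i = j \<and> c = d \<and> i \<in> X \<and> c < n i \<and> {u, v} \<in> edges (G i)"
    using *(2-4) by cases (simp_all add: insert_commute)
next
  assume "i = j \<and> c = d \<and> i \<in> X \<and> c < n i \<and> {u, v} \<in> edges (G i)"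
  then show "{(i, c, u), (j, d, v)} \<in> edges (copies n G X)"
    unfolding copies_def by auto
qed

lemma wf_copies:
  assumes "\<And>i. wf_ugraph (G i)"
  shows "wf_ugraph (copies n G X)"
  unfolding wf_ugraph_def
proof
  fix e assume "e \<in> edges (copies n G X)"
  then obtain i c u v where e: "e = {(i, c, u), (i, c, v)}" "i \<in> X" "c < n i" "{u, v} \<in> edges (G i)"
    unfolding copies_def by auto
  then show "e \<subseteq> vertices (copies n G X) \<and> card e = 2"
    using edge_vertices[OF assms e(4)] by (simp add: copies_vertices)
qed

definition copy :: "(nat \<Rightarrow> nat ugraph) \<Rightarrow> nat \<Rightarrow> nat \<Rightarrow> (nat \<times> nat \<times> nat) set" where
  "copy G i c = (\<lambda>v. (i, c, v)) ` vertices (G i)"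

lemma connected_in_copy:
  assumes "connected_set (edges (copies n G X)) D" "D \<subseteq> vertices (copies n G X)"
  shows "\<exists>i c. i \<in> X \<and> c < n i \<and> D \<subseteq> copy G i c"
proof -
  obtain x where x: "x \<in> D" using connected_set_nonempty[OF assms(1)] by blast
  obtain i c v where icv: "x = (i, c, v)" by (cases x)
  have "D \<subseteq> {y. fst y = i \<and> fst (snd y) = c}"
    using assms(1) x
  proof (rule connected_set_subset)
    fix y z assume "y \<in> {y. fst y = i \<and> fst (snd y) = c}" "{y, z} \<in> edges (copies n G X)"
    then show "z \<in> {y. fst y = i \<and> fst (snd y) = c}"
      by (cases y; cases z) (simp add: copies_edge)
  qed (simp add: icv)
  moreover have "i \<in> X \<and> c < n i" using x assms(2) icv by (auto simp: copies_vertices)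
  moreover have "y \<in> copy G i c" if "y \<in> D" "fst y = i" "fst (snd y) = c" for y
    using that assms(2) by (cases y) (auto simp: copy_def copies_vertices)
  ultimately show ?thesis by blast
qed

lemma copy_model:
  "set_model (\<lambda>x. {snd (snd x)}) (copy G i c) (edges (copies n G X)) (vertices (G i)) (edges (G i))"
  by (rule set_model_embedding) (auto simp: copy_def inj_on_def copies_edge)

lemma into_copy_model:
  assumes "i \<in> X" "c < n i"
  shows "graph_model (\<lambda>v. {(i, c, v)}) (G i) (copies n G X)"
  by (rule set_model_embedding) (use assms in \<open>auto simp: copies_vertices inj_on_def copies_edge\<close>)

lemma copies_mono: "X \<subseteq> Y \<Longrightarrow> graph_model (\<lambda>x. {x}) (copies n G X) (copies n G Y)"
proof (rule set_model_identity)
  assume "X \<subseteq> Y"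
  then show "vertices (copies n G X) \<subseteq> vertices (copies n G Y)" by (auto simp: copies_def)
  fix x y assume "{x, y} \<in> edges (copies n G X)"
  then show "{x, y} \<in> edges (copies n G Y)"
    using \<open>X \<subseteq> Y\<close> by (cases x; cases y) (auto simp: copies_edge)
qed

lemma nondecreasing_subsequence:
  fixes f :: "nat \<Rightarrow> 'a::wellorder"
  shows "\<exists>\<phi> :: nat \<Rightarrow> nat. strict_mono \<phi> \<and> (\<forall>i j. i \<le> j \<longrightarrow> f (\<phi> i) \<le> f (\<phi> j))"
proof -
  have ex: "\<exists>m\<ge>N. \<forall>k\<ge>m. f m \<le> f k" for N
  proof -
    have "\<exists>y. y \<in> f ` {N..}" by blast
    then have "(LEAST y. y \<in> f ` {N..}) \<in> f ` {N..}" by (rule LeastI_ex)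
    then obtain m where m: "m \<ge> N" "f m = (LEAST y. y \<in> f ` {N..})" by auto
    have "f m \<le> f k" if "k \<ge> m" for k
      unfolding m(2) by (rule Least_le) (use that m(1) in auto)
    then show ?thesis using m(1) by blast
  qed
  have "\<exists>\<phi>. \<forall>n. (\<forall>k\<ge>\<phi> n. f (\<phi> n) \<le> f k) \<and> \<phi> n < \<phi> (Suc n)"
  proof (rule dependent_nat_choice[where P = "\<lambda>_ m. \<forall>k\<ge>m. f m \<le> f k" and Q = "\<lambda>_ m m'. m < m'"])
    show "\<exists>m. \<forall>k\<ge>m. f m \<le> f k" using ex[of 0] by blast
    show "\<exists>m'. (\<forall>k\<ge>m'. f m' \<le> f k) \<and> m < m'" for m using ex[of "Suc m"] by (auto simp: Suc_le_eq)
  qed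
  then obtain \<phi> where \<phi>: "\<And>n k. k \<ge> \<phi> n \<Longrightarrow> f (\<phi> n) \<le> f k" "\<And>n. \<phi> n < \<phi> (Suc n)" by blast
  have "strict_mono \<phi>" using \<phi>(2) by (simp add: strict_mono_Suc_iff)
  then have "\<forall>i j. i \<le> j \<longrightarrow> f (\<phi> i) \<le> f (\<phi> j)"
    using \<phi>(1) by (simp add: strict_mono_less_eq)
  with \<open>strict_mono \<phi>\<close> show ?thesis by blast
qed

text \<open>Suppose that \<open>i \<in> X - Y\<close>. The \<open>n i\<close> copies of \<open>G i\<close> are all modelled in copies of \<open>G j\<close> with
  \<open>j < i\<close>, because the sequence is bad. The kernels \<open>S j\<close> of these copies together form a kernel
  at rank \<open>r i\<close>, by monotonicity of \<open>r\<close>, and it has fewer than \<open>n i\<close> elements. So it misses one of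
  the copies of \<open>G i\<close>, which contradicts the minimality of \<open>r i\<close>.\<close>

lemma spread_aux:
  assumes G: "\<And>i. G i \<in> connected_rayless_graphs"
    and bad: "\<And>i j. i < j \<Longrightarrow> \<not> minor (G i) (G j)"
    and rank: "\<And>i. graph_rank_le (r i) (G i)"
    and least: "\<And>i \<beta>. \<beta> < r i \<Longrightarrow> \<not> graph_rank_le \<beta> (G i)"
    and mono: "\<And>i j. i \<le> j \<Longrightarrow> r i \<le> r j"
  shows "\<exists>n. \<forall>X Y B. graph_model B (copies n G X) (copies n G Y) \<longrightarrow> X \<subseteq> Y"
proof -
  have wf: "wf_ugraph (G i)" and con: "connected_graph (G i)" for i
    using G[of i] by (auto simp: connected_rayless_graphs_def rayless_graphs_def)
  have "\<exists>S. kernel (edges (G i)) (r i) (vertices (G i)) S" for i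
    using rank[of i] by (simp add: rank_le_iff)
  then obtain S where S: "\<And>i. kernel (edges (G i)) (r i) (vertices (G i)) (S i)" by metis
  \<comment> \<open>\<open>s i\<close> counts the kernel vertices in all copies with index below \<open>i\<close>, so
    these vertices cannot hit all of \<open>s i + 1\<close> disjoint sets.\<close>
  define s where "s = rec_nat 0 (\<lambda>i m. m + (m + 1) * card (S i))"
  define n where "n i = s i + 1" for i
  have s_sum: "s i = (\<Sum>j<i. n j * card (S j))" for i
    by (induction i) (simp_all add: s_def n_def)
  have "i \<in> Y"
    if B: "graph_model B (copies n G X) (copies n G Y)" and i: "i \<in> X" for X Y B i
  proof (rule ccontr)
    assume iY: "i \<notin> Y"
    let ?E = "edges (copies n G Y)"
    let ?D = "\<lambda>c. \<Union>v\<in>vertices (G i). B (i, c, v)"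
    let ?I = "SIGMA j:{..<i} \<inter> Y. {..<n j}"
    let ?W = "\<Union>p\<in>?I. copy G (fst p) (snd p)"
    have model: "set_model (\<lambda>v. B (i, c, v)) (vertices (G i)) (edges (G i)) (vertices (copies n G Y)) ?E"
      if "c < n i" for c
      using set_model_trans[OF into_copy_model[of i X c n G, OF i that] B] by simp
    have D_con: "connected_set ?E (?D c)" if "c < n i" for c
      using set_model_connected[OF model[OF that] order_refl con] .
    have D_sub: "?D c \<subseteq> ?W" if c: "c < n i" for c
    proof -
      have "?D c \<subseteq> vertices (copies n G Y)" using set_modelD(1)[OF model[OF c]] by blast
      from connected_in_copy[OF D_con[OF c] this]
      obtain j d where jd: "j \<in> Y" "d < n j" "?D c \<subseteq> copy G j d" by blast
      have "set_model (\<lambda>v. B (i, c, v)) (vertices (G i)) (edges (G i)) (copy G j d) ?E"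
        by (rule set_model_target[OF model[OF c]]) (use jd(3) in blast)
      note m = set_model_trans[OF this copy_model]
      have "minor (G i) (G j)"
        unfolding minor_iff[OF wf wf] by (rule exI, rule m)
      then have "\<not> i < j" using bad by blast
      moreover have "i \<noteq> j" using iY jd(1) by blast
      ultimately have "(j, d) \<in> ?I" using jd by simp
      then show ?thesis using jd(3) by fastforce
    qed
    let ?S = "\<lambda>p. {x \<in> copy G (fst p) (snd p). {snd (snd x)} \<inter> S (fst p) \<noteq> {}}"
    have S_card: "card (?S p) \<le> card (S (fst p))" for p
    proof (rule touched_finite(2)[OF kernel_finite[OF S]])
      fix x y assume "x \<in> copy G (fst p) (snd p)" "y \<in> copy G (fst p) (snd p)" "x \<noteq> y"
      then show "{snd (snd x)} \<inter> {snd (snd y)} = {}" by (auto simp: copy_def)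
    qed
    have "kernel ?E (r i) ?W (\<Union>p\<in>?I. ?S p)"
    proof (rule kernel_Union)
      show "finite ?I" by simp
      fix p assume p: "p \<in> ?I"
      then have "fst p < i" by auto
      then have "kernel (edges (G (fst p))) (r i) (vertices (G (fst p))) (S (fst p))"
        using kernel_mono[OF S mono] by simp
      then show "kernel ?E (r i) (copy G (fst p) (snd p)) (?S p)"
        by (rule kernel_model[OF _ copy_model])
    next
      fix Z assume Z: "Z \<subseteq> ?W" "connected_set ?E Z"
      have "?W \<subseteq> vertices (copies n G Y)" by (auto simp: copy_def copies_vertices)
      then have "Z \<subseteq> vertices (copies n G Y)" using Z(1) by blast
      from connected_in_copy[OF Z(2) this]
      obtain j d where jd: "j \<in> Y" "d < n j" "Z \<subseteq> copy G j d" by blast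
      obtain z where z: "z \<in> Z" using connected_set_nonempty[OF Z(2)] by blast
      then obtain p where p: "p \<in> ?I" "z \<in> copy G (fst p) (snd p)" using Z(1) by blast
      have "z \<in> copy G j d" using z jd(3) by blast
      then have "p = (j, d)" using p(2) by (cases p) (auto simp: copy_def)
      then show "\<exists>p\<in>?I. Z \<subseteq> copy G (fst p) (snd p)" using p(1) jd(3) by force
    qed
    note K = this
    have "card (\<Union>p\<in>?I. ?S p) \<le> (\<Sum>p\<in>?I. card (?S p))" by (rule card_UN_le) simp
    also have "\<dots> \<le> (\<Sum>p\<in>?I. card (S (fst p)))" by (rule sum_mono[OF S_card])
    also have "\<dots> = (\<Sum>j\<in>{..<i} \<inter> Y. \<Sum>d<n j. card (S j))"
      by (subst sum.Sigma) (simp_all add: split_beta)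
    also have "\<dots> \<le> (\<Sum>j<i. n j * card (S j))"
      by simp (rule sum_mono2, auto)
    also have "\<dots> < n i" unfolding n_def using s_sum[of i] by (simp add: n_def)
    finally have small: "card (\<Union>p\<in>?I. ?S p) < n i" .
    have D_disj: "?D c \<inter> ?D d = {}" if "c \<in> {..<n i}" "d \<in> {..<n i}" "c \<noteq> d" for c d
    proof -
      have "B (i, c, u) \<inter> B (i, d, v) = {}" if "u \<in> vertices (G i)" "v \<in> vertices (G i)" for u v
        using that i \<open>c \<in> _\<close> \<open>d \<in> _\<close> \<open>c \<noteq> d\<close>
        by (intro set_modelD(3)[OF B]) (simp_all add: copies_vertices)
      then show ?thesis by blast
    qed
    have "card {c \<in> {..<n i}. ?D c \<inter> (\<Union>p\<in>?I. ?S p) \<noteq> {}} \<le> card (\<Union>p\<in>?I. ?S p)"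
      by (rule touched_finite(2)[OF kernel_finite[OF K] D_disj])
    then have "{c \<in> {..<n i}. ?D c \<inter> (\<Union>p\<in>?I. ?S p) \<noteq> {}} \<noteq> {..<n i}"
      using small by (metis (no_types, lifting) card_lessThan not_less)
    then obtain c where c: "c < n i" "?D c \<inter> (\<Union>p\<in>?I. ?S p) = {}" by blast
    have "?D c \<subseteq> ?W - (\<Union>p\<in>?I. ?S p)" using D_sub[OF c(1)] c(2) by blast
    from kernelD[OF K this D_con[OF c(1)]]
    obtain \<beta> where \<beta>: "\<beta> < r i" "rank_le ?E \<beta> (?D c)" by blast
    have "set_model (\<lambda>v. B (i, c, v)) (vertices (G i)) (edges (G i)) (?D c) ?E"
      by (rule set_model_target[OF model[OF c(1)]]) blast
    then have "graph_rank_le \<beta> (G i)" by (rule rank_le_model[OF \<beta>(2)])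
    then show False using least[OF \<beta>(1)] by blast
  qed
  then have "X \<subseteq> Y"
    if "graph_model B (copies n G X) (copies n G Y)" for X Y B
    using that by blast
  then show ?thesis by (intro exI[of _ n]) simp
qed

lemma not_wqo_on_iff:
  "\<not> wqo_on le Q \<longleftrightarrow> (\<exists>q :: nat \<Rightarrow> _. (\<forall>n. q n \<in> Q) \<and> (\<forall>i j. i < j \<longrightarrow> \<not> le (q i) (q j)))"
  by (simp add: wqo_on_def image_subset_iff)

text \<open>A single bad sequence of connected graphs gives a copy of the subset order on sets of numbers,
  at bounded rank.\<close>

theorem spread:
  assumes "\<not> wqo_on minor connected_rayless_graphs"
  shows "\<exists>\<alpha> H. \<forall>X Y. H X \<in> Rank \<alpha> \<and> (minor (H X) (H Y) \<longleftrightarrow> X \<subseteq> (Y :: nat set))"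
proof -
  obtain F :: "nat \<Rightarrow> nat ugraph" where "(\<forall>n. F n \<in> connected_rayless_graphs) \<and> (\<forall>i j. i < j
    \<longrightarrow> \<not> minor (F i) (F j))"
    using assms unfolding not_wqo_on_iff ..
  then have F: "\<And>n. F n \<in> connected_rayless_graphs" "\<And>i j. i < j \<Longrightarrow> \<not> minor (F i) (F j)"
    by simp_all
  define r where "r G = (LEAST \<alpha>. graph_rank_le \<alpha> G)" for G :: "nat ugraph"
  obtain \<phi> :: "nat \<Rightarrow> nat" where "strict_mono \<phi> \<and> (\<forall>i j. i \<le> j \<longrightarrow> r (F (\<phi> i)) \<le> r (F (\<phi> j)))"
    using nondecreasing_subsequence[of "\<lambda>i. r (F i)"] ..
  then have \<phi>: "strict_mono \<phi>" "\<And>i j. i \<le> j \<Longrightarrow> r (F (\<phi> i)) \<le> r (F (\<phi> j))" by simp_all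
  define G where "G i = F (\<phi> i)" for i
  have G: "G i \<in> connected_rayless_graphs" for i using F(1) by (auto simp: G_def)
  have wf: "wf_ugraph (G i)" and ray: "rayless (G i)" for i
    using G[of i] by (auto simp: connected_rayless_graphs_def rayless_graphs_def)
  have rank: "graph_rank_le (r (G i)) (G i)" for i
    unfolding r_def by (rule LeastI_ex[OF rayless_imp_ranked[OF ray]])
  have "\<exists>n. \<forall>X Y B. graph_model B (copies n G X) (copies n G Y) \<longrightarrow> X \<subseteq> Y"
  proof (rule spread_aux[OF G])
    show "\<not> minor (G i) (G j)" if "i < j" for i j
      unfolding G_def by (rule F(2)) (use \<phi>(1) that in \<open>simp add: strict_mono_less\<close>)
    show "graph_rank_le (r (G i)) (G i)" for i by (rule rank)
    show "\<not> graph_rank_le \<beta> (G i)" if "\<beta> < r (G i)" for i \<beta>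
      using that unfolding r_def by (rule not_less_Least)
    show "r (G i) \<le> r (G j)" if "i \<le> j" for i j unfolding G_def by (rule \<phi>(2)[OF that])
  qed
  then obtain n where "\<forall>X Y B. graph_model B (copies n G X) (copies n G Y) \<longrightarrow> X \<subseteq> Y" ..
  then have n: "X \<subseteq> Y" if "graph_model B (copies n G X) (copies n G Y)" for X Y B using that by blast
  have "countable (range (\<lambda>i. r (G i)))" by simp
  from countable_bounded[OF this]
  obtain \<alpha> where \<alpha>: "\<forall>\<beta>\<in>range (\<lambda>i. r (G i)). \<beta> < \<alpha>" ..
  define H where "H X = nat_graph (copies n G X)" for X
  have "H X \<in> Rank \<alpha>" for X
  proof -
    have "kernel (edges (copies n G X)) \<alpha> (vertices (copies n G X)) {}"
    proof (rule kernelI)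
      fix D assume D: "D \<subseteq> vertices (copies n G X) - {}" "connected_set (edges (copies n G X)) D"
      then obtain i c where "D \<subseteq> copy G i c" using connected_in_copy[OF D(2)] by blast
      then have "rank_le (edges (copies n G X)) (r (G i)) D"
        by (rule rank_le_model[OF rank set_model_subset[OF copy_model]])
      then show "\<exists>\<beta><\<alpha>. rank_le (edges (copies n G X)) \<beta> D" using \<alpha> by blast
    qed simp
    note k = this
    show ?thesis
      unfolding H_def Rank_iff_rank_le
      using wf_nat_graph[OF wf_copies[of G, OF wf]] nat_graph_rank[OF rank_leI[OF k]] by simp
  qed
  moreover have "minor (H X) (H Y) \<longleftrightarrow> X \<subseteq> Y" for X Y
    unfolding H_def minor_nat_graph[OF wf_copies[of G, OF wf] wf_copies[of G, OF wf]]
    using n[of _ X Y] copies_mono[of X Y n G] by meson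
  ultimately show ?thesis by (intro exI[of _ \<alpha>] exI[of _ H]) simp
qed


section \<open>Attaching graphs to vertices\<close>

lemma doubleton_in_edges:
  assumes "\<And>x y. P x y \<Longrightarrow> P y x"
  shows "{x, y} \<in> {{a, b} | a b. P a b} \<longleftrightarrow> P x y"
  using assms by (auto simp: doubleton_eq_iff)

text \<open>Joining \<open>v\<close> to all vertices of its copies makes the result connected whenever \<open>J\<close> is, also for
  disconnected \<open>F v k\<close>, and leaves \<open>v\<close> as the only gate between a copy and the rest.\<close>

fun attach_adj :: "'a ugraph \<Rightarrow> ('a \<Rightarrow> nat \<Rightarrow> 'b ugraph) \<Rightarrow> 'a + 'a \<times> nat \<times> 'b \<Rightarrow> 'a + 'a \<times> nat \<times> 'b
  \<Rightarrow> bool" where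
  "attach_adj J F (Inl u) (Inl v) \<longleftrightarrow> {u, v} \<in> edges J"
| "attach_adj J F (Inl u) (Inr (v, k, z)) \<longleftrightarrow> u = v \<and> v \<in> vertices J \<and> z \<in> vertices (F v k)"
| "attach_adj J F (Inr (v, k, z)) (Inl u) \<longleftrightarrow> u = v \<and> v \<in> vertices J \<and> z \<in> vertices (F v k)"
| "attach_adj J F (Inr (v, k, y)) (Inr (w, l, z)) \<longleftrightarrow>
     v = w \<and> k = l \<and> v \<in> vertices J \<and> {y, z} \<in> edges (F v k)"

definition attach :: "'a ugraph \<Rightarrow> ('a \<Rightarrow> nat \<Rightarrow> 'b ugraph) \<Rightarrow> ('a + 'a \<times> nat \<times> 'b) ugraph" where
  "attach J F =
     \<lparr>vertices = Inl ` vertices J \<union> {Inr (v, k, z) | v k z. v \<in> vertices J \<and> z \<in> vertices (F v k)},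
      edges = {{x, y} | x y. attach_adj J F x y}\<rparr>"

lemma attach_edge: "{x, y} \<in> edges (attach J F) \<longleftrightarrow> attach_adj J F x y"
proof -
  have "attach_adj J F y x" if "attach_adj J F x y" for x y
    using that by (induction J F x y rule: attach_adj.induct) (auto simp: insert_commute)
  then show ?thesis using doubleton_in_edges[of "attach_adj J F"] by (simp add: attach_def)
qed

lemma attach_vertices:
  "Inl v \<in> vertices (attach J F) \<longleftrightarrow> v \<in> vertices J"
  "Inr (v, k, z) \<in> vertices (attach J F) \<longleftrightarrow> v \<in> vertices J \<and> z \<in> vertices (F v k)"
  by (auto simp: attach_def)

lemma wf_by_adjacency:
  assumes "edges G = {{x, y} | x y. P x y}"
    and "\<And>x y. P x y \<Longrightarrow> x \<in> vertices G \<and> y \<in> vertices G \<and> x \<noteq> y"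
  shows "wf_ugraph G"
  unfolding wf_ugraph_def
proof
  fix e assume "e \<in> edges G"
  then obtain x y where "e = {x, y}" "P x y" unfolding assms(1) by blast
  then show "e \<subseteq> vertices G \<and> card e = 2" using assms(2)[of x y] by simp
qed

lemma wf_attach:
  assumes "wf_ugraph J" "\<And>v k. wf_ugraph (F v k)"
  shows "wf_ugraph (attach J F)"
proof (rule wf_by_adjacency[where P = "attach_adj J F"])
  show "edges (attach J F) = {{x, y} | x y. attach_adj J F x y}" by (simp add: attach_def)
  have no_loop: "{z} \<notin> edges (F v k)" for v k z using edge_vertices(3)[OF assms(2), of z z] by auto
  fix x y assume "attach_adj J F x y"
  then show "x \<in> vertices (attach J F) \<and> y \<in> vertices (attach J F) \<and> x \<noteq> y"
  proof (cases x)
    case (Inl u)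
    then show ?thesis using \<open>attach_adj J F x y\<close> edge_vertices[OF assms(1)]
      by (cases y) (auto simp: attach_vertices)
  next
    case (Inr a)
    obtain v k z where "a = (v, k, z)" by (cases a)
    then show ?thesis using \<open>attach_adj J F x y\<close> Inr edge_vertices[OF assms(2)]
      by (cases y) (auto simp: attach_vertices no_loop)
  qed
qed

text \<open>A copy is separated from the rest by the vertex it is attached to.\<close>

lemma attach_gate:
  assumes "connected_set (edges (attach J F)) X" "Inr (v, k, z) \<in> X" "Inl v \<notin> X"
  shows "X \<subseteq> {Inr (v, k, y) | y. True}"
  using assms(1,2)
proof (rule connected_set_subset)
  fix x y assume "x \<in> {Inr (v, k, y) | y. True}" "y \<in> X" "{x, y} \<in> edges (attach J F)"
  then obtain a where a: "attach_adj J F (Inr (v, k, a)) y" "y \<in> X" by (auto simp: attach_edge)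
  show "y \<in> {Inr (v, k, y) | y. True}"
  proof (cases y)
    case (Inl u)
    then show ?thesis using a assms(3) by simp
  next
    case (Inr b)
    then show ?thesis using a by (cases b) simp
  qed
qed simp

text \<open>Walking through a copy never changes the vertex it is attached to, so the trace on \<open>J\<close> of a
  connected set is connected.\<close>

lemma attach_base_connected:
  assumes "connected_set (edges (attach J F)) X" "Inl v \<in> X"
  shows "connected_set (edges J) (Inl -` X)"
proof (rule connected_setI)
  show "v \<in> Inl -` X" using assms(2) by simp
  fix A assume A: "A \<subseteq> Inl -` X" "A \<noteq> {}"
    "\<And>x y. x \<in> A \<Longrightarrow> y \<in> Inl -` X \<Longrightarrow> {x, y} \<in> edges J \<Longrightarrow> y \<in> A"
  let ?base = "case_sum (\<lambda>v. v) fst"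
  obtain a where a: "a \<in> A" using A(2) by blast
  have "X \<subseteq> {x. ?base x \<in> A}"
  proof (rule connected_set_subset[OF assms(1)])
    show "Inl a \<in> X" using a A(1) by blast
    show "Inl a \<in> {x. ?base x \<in> A}" using a by simp
    fix x y assume xy: "x \<in> {x. ?base x \<in> A}" "y \<in> X" "{x, y} \<in> edges (attach J F)"
    then have adj: "attach_adj J F x y" by (simp add: attach_edge)
    show "y \<in> {x. ?base x \<in> A}"
    proof (cases x)
      case (Inl u)
      then show ?thesis using xy(1,2) adj A(3)[of u] by (cases y) auto
    next
      case (Inr b)
      then show ?thesis using xy(1) adj by (cases b; cases y) auto
    qed
  qed
  then show "Inl -` X \<subseteq> A" by auto
qed

text \<open>An edge inside a copy, or between a copy and its gate, cannot connect the two sets: both would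
  contain the gate.\<close>

lemma attach_base_edge:
  assumes X: "connected_set (edges (attach J F)) X" "Inl a \<in> X"
    and Y: "connected_set (edges (attach J F)) Y" "Inl b \<in> Y"
    and disj: "X \<inter> Y = {}" and xy: "x \<in> X" "y \<in> Y" "{x, y} \<in> edges (attach J F)"
  shows "\<exists>u v. Inl u \<in> X \<and> Inl v \<in> Y \<and> {u, v} \<in> edges J"
proof -
  have adj: "attach_adj J F x y" using xy(3) by (simp add: attach_edge)
  have gate: "Inl w \<in> Z" if "connected_set (edges (attach J F)) Z" "Inl c \<in> Z" "Inr (w, k, z) \<in> Z"
    for Z c w k z
    using attach_gate[OF that(1,3)] that(2) by blast
  show ?thesis
  proof (cases x)
    case (Inl u)
    show ?thesis
    proof (cases y)
      case (Inl v)
      then show ?thesis using adj xy \<open>x = Inl u\<close> by auto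
    next
      case (Inr q)
      then obtain k z where "q = (u, k, z)" using adj \<open>x = Inl u\<close> by (cases q) auto
      then have "Inl u \<in> Y" using gate[OF Y] xy(2) Inr by blast
      then show ?thesis using disj xy(1) \<open>x = Inl u\<close> by blast
    qed
  next
    case (Inr q)
    obtain w k z where q: "q = (w, k, z)" by (cases q)
    then have w: "Inl w \<in> X" using gate[OF X] xy(1) Inr by blast
    have "Inl w \<in> Y"
    proof (cases y)
      case (Inl v)
      then show ?thesis using adj Inr q xy(2) by simp
    next
      case (Inr p)
      then obtain z' where "p = (w, k, z')" using adj \<open>x = Inr q\<close> q by (cases p) auto
      then show ?thesis using gate[OF Y] xy(2) Inr by blast
    qed
    then show ?thesis using w disj by blast
  qed
qed

lemma attach_connected:
  fixes J :: "'a ugraph" and F :: "'a \<Rightarrow> nat \<Rightarrow> 'b ugraph"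
  assumes "connected_graph J"
  shows "connected_graph (attach J F)"
proof -
  let ?C = "{{Inr (v, k, z)} | v k z. v \<in> vertices J \<and> z \<in> vertices (F v k)} ::
    ('a + 'a \<times> nat \<times> 'b) set set"
  have "graph_model (\<lambda>v. {Inl v}) J (attach J F)"
    by (rule set_model_embedding) (auto simp: attach_edge attach_vertices)
  from set_model_connected[OF this order_refl assms]
  have "connected_set (edges (attach J F)) (Inl ` vertices J)"
    by (simp only: UNION_singleton_eq_range)
  then have "connected_set (edges (attach J F)) (Inl ` vertices J \<union> \<Union>?C)"
  proof (rule connected_set_attach)
    fix Y assume "Y \<in> ?C"
    then obtain v k z where Y: "Y = {Inr (v, k, z)}" "v \<in> vertices J" "z \<in> vertices (F v k)" by blast
    show "connected_set (edges (attach J F)) Y" unfolding Y(1) by (rule connected_set_singleton)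
    show "\<exists>x\<in>Inl ` vertices J. \<exists>y\<in>Y. {x, y} \<in> edges (attach J F)"
      using Y by (simp add: attach_edge)
  qed
  moreover have "\<Union>?C = {Inr (v, k, z) | v k z. v \<in> vertices J \<and> z \<in> vertices (F v k)}" by blast
  then have "vertices (attach J F) = Inl ` vertices J \<union> \<Union>?C" by (simp add: attach_def)
  ultimately show ?thesis by simp
qed

text \<open>A ray that enters a copy cannot leave it again, since it has used up the only way out.\<close>

lemma rayless_attach:
  assumes J: "rayless J" and F: "\<And>v k. rayless (F v k)"
  shows "rayless (attach J F)"
  unfolding rayless_def
proof
  assume "\<exists>p::nat \<Rightarrow> _. inj p \<and> (\<forall>n. {p n, p (Suc n)} \<in> edges (attach J F))"
  then obtain p :: "nat \<Rightarrow> _" where p: "inj p" "\<And>n. attach_adj J F (p n) (p (Suc n))"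
    by (auto simp: attach_edge)
  have no_base: False if base: "\<forall>n\<ge>N. \<exists>u. p n = Inl u" for N
  proof -
    define q where "q n = projl (p (N + n))" for n
    have q: "p (N + n) = Inl (q n)" for n using base by (metis le_add1 q_def sum.sel(1))
    have "inj q" by (rule injI) (metis q injD[OF p(1)] add_left_cancel)
    moreover have "{q n, q (Suc n)} \<in> edges J" for n
      using p(2)[of "N + n"] q[of n] q[of "Suc n"] by simp
    ultimately show False using J unfolding rayless_def by blast
  qed
  have no_copy: False if copy: "\<forall>n\<ge>N. \<exists>z. p n = Inr (v, k, z)" for N v k
  proof -
    define q where "q n = snd (snd (projr (p (N + n))))" for n
    have q: "p (N + n) = Inr (v, k, q n)" for n
    proof -
      obtain z where "p (N + n) = Inr (v, k, z)" using copy le_add1[of N n] by blast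
      then show ?thesis by (simp add: q_def)
    qed
    have "inj q" by (rule injI) (metis q injD[OF p(1)] add_left_cancel)
    moreover have "{q n, q (Suc n)} \<in> edges (F v k)" for n
      using p(2)[of "N + n"] q[of n] q[of "Suc n"] by simp
    ultimately show False using F[of v k] unfolding rayless_def by blast
  qed
  have stay: "\<exists>z. p (Suc n) = Inr (v, k, z)" if "p n = Inr (v, k, z)" "p (Suc n) \<noteq> Inl v" for n v k z
  proof (cases "p (Suc n)")
    case (Inl u)
    then show ?thesis using p(2)[of n] that by simp
  next
    case (Inr b)
    then show ?thesis using p(2)[of n] that(1) by (cases b) simp
  qed
  have leave: "\<exists>u. p (Suc m) = Inl u" if m: "p m = Inl v" for m v
  proof (rule ccontr)
    assume "\<not> ?thesis"
    then obtain b where b: "p (Suc m) = Inr b" by (cases "p (Suc m)") auto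
    obtain w k z where wkz: "b = (w, k, z)" by (cases b)
    have "w = v" using p(2)[of m] m b wkz by simp
    have "\<exists>z. p (Suc m + n) = Inr (v, k, z)" for n
    proof (induction n)
      case (Suc n)
      then obtain z where z: "p (Suc m + n) = Inr (v, k, z)" by blast
      have "p (Suc (Suc m + n)) \<noteq> Inl v"
      proof
        assume "p (Suc (Suc m + n)) = Inl v"
        then have "p (Suc (Suc m + n)) = p m" using m by simp
        then show False using injD[OF p(1)] by fastforce
      qed
      then show ?case using stay[OF z] by simp
    qed (use b wkz \<open>w = v\<close> in simp)
    then have "\<forall>n\<ge>Suc m. \<exists>z. p n = Inr (v, k, z)" by (metis le_iff_add)
    then show False by (rule no_copy)
  qed
  show False
  proof (cases "\<exists>m v. p m = Inl v")
    case True
    then obtain m v where m: "p m = Inl v" by blast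
    have "\<exists>u. p (m + n) = Inl u" for n
    proof (induction n)
      case (Suc n)
      then obtain u where "p (m + n) = Inl u" by blast
      from leave[OF this] show ?case by simp
    qed (use m in simp)
    then have "\<forall>n\<ge>m. \<exists>u. p n = Inl u" by (metis le_iff_add)
    then show False by (rule no_base)
  next
    case False
    then obtain b where b: "p 0 = Inr b" by (cases "p 0") auto
    obtain v k z where "b = (v, k, z)" by (cases b)
    have "\<exists>z. p n = Inr (v, k, z)" for n
    proof (induction n)
      case (Suc n)
      then obtain z where z: "p n = Inr (v, k, z)" by blast
      have "p (Suc n) \<noteq> Inl v" using False by blast
      then show ?case by (rule stay[OF z])
    qed (use b \<open>b = _\<close> in simp)
    then have "\<forall>n\<ge>0. \<exists>z. p n = Inr (v, k, z)" by blast
    then show False by (rule no_copy)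
  qed
qed

text \<open>If infinitely many copies of a connected graph \<open>Z\<close> are attached at \<open>v\<close> and the branch set of \<open>v\<close>
  avoids a finite set \<open>T\<close>, then the branch set lies in a connected set avoiding \<open>T\<close> whose rank exceeds
  that of \<open>Z\<close>, because only finitely many copies are hit by \<open>T\<close>.\<close>

lemma attached_copies_force_rank:
  assumes B: "set_model B (vertices (attach J F)) (edges (attach J F)) W E'"
    and v: "v \<in> vertices J" "\<And>k. F v k = Z"
    and Z: "connected_graph Z" "\<And>\<beta>. \<beta> < \<rho> \<Longrightarrow> \<not> graph_rank_le \<beta> Z"
    and T: "finite T" "B (Inl v) \<inter> T = {}"
  shows "\<exists>Y. Y \<subseteq> W - T \<and> connected_set E' Y \<and> B (Inl v) \<subseteq> Y \<and> \<not> rank_le E' \<rho> Y"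
proof -
  let ?D = "\<lambda>k. \<Union>z\<in>vertices Z. B (Inr (v, k, z))"
  have "graph_model (\<lambda>z. {Inr (v, k, z)}) Z (attach J F)" for k
    by (rule set_model_embedding) (use v in \<open>auto simp: attach_edge attach_vertices inj_on_def\<close>)
  from set_model_trans[OF this B]
  have model: "set_model (\<lambda>z. B (Inr (v, k, z))) (vertices Z) (edges Z) W E'" for k by simp
  have disj: "B (Inr (v, k, y)) \<inter> B (Inr (v, l, z)) = {}"
    if "k \<noteq> l" "y \<in> vertices Z" "z \<in> vertices Z" for k l y z
    by (rule set_modelD(3)[OF B]) (use that v in \<open>simp_all add: attach_vertices\<close>)
  define K where "K = {k. ?D k \<inter> T = {}}"
  have "?D k \<inter> ?D l = {}" if "k \<noteq> l" for k l
    using disj[OF that] by blast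
  then have "finite {k \<in> UNIV. ?D k \<inter> T \<noteq> {}}"
    by (intro touched_finite(1)[OF T(1)])
  then have "finite (- K)" by (simp add: K_def Compl_eq)
  then have K: "infinite K" using infinite_UNIV_nat finite_compl by blast
  let ?Y = "B (Inl v) \<union> \<Union>(?D ` K)"
  have base: "Inl v \<in> vertices (attach J F)" using v(1) by (simp add: attach_vertices)
  have Y_conn: "connected_set E' ?Y"
  proof (rule connected_set_attach[OF set_modelD(2)[OF B base]])
    fix X assume "X \<in> ?D ` K"
    then obtain k where X: "X = ?D k" by blast
    show "connected_set E' X" unfolding X by (rule set_model_connected[OF model order_refl Z(1)])
    obtain z where z: "z \<in> vertices Z" using connected_set_nonempty[OF Z(1)] by blast
    have "\<exists>x\<in>B (Inl v). \<exists>y\<in>B (Inr (v, k, z)). {x, y} \<in> E'"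
      by (rule set_modelD(4)[OF B base]) (use z v in \<open>simp_all add: attach_vertices attach_edge\<close>)
    then show "\<exists>x\<in>B (Inl v). \<exists>y\<in>X. {x, y} \<in> E'" unfolding X using z by blast
  qed
  have Y_sub: "?Y \<subseteq> W - T"
  proof -
    have "B (Inl v) \<subseteq> W - T" using set_modelD(1)[OF B base] T(2) by blast
    moreover have "?D k \<subseteq> W - T" if "k \<in> K" for k
      using set_modelD(1)[OF model[of k]] that unfolding K_def by blast
    ultimately show ?thesis by blast
  qed
  have "\<not> rank_le E' \<rho> ?Y"
  proof (rule not_rank_le_many_copies[OF K _ _ Z])
    show "set_model (\<lambda>z. B (Inr (v, k, z))) (vertices Z) (edges Z) (?Y - {}) E'" if "k \<in> K" for k
      by (rule set_model_target[OF model]) (use that in blast)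
    show "B (Inr (v, k, y)) \<inter> B (Inr (v, l, z)) = {}"
      if "k \<noteq> l" "y \<in> vertices Z" "z \<in> vertices Z" for k l y z by (rule disj[OF that])
  qed
  then show ?thesis using Y_conn Y_sub by (intro exI[of _ ?Y]) simp
qed

text \<open>A connected graph containing all \<open>G j\<close>, so that its rank \<open>\<rho>\<close> bounds theirs, is obtained by
  joining one new vertex to a disjoint union of the \<open>G j\<close>.\<close>

lemma heavy_graph_exists:
  fixes G :: "nat \<Rightarrow> 'b::countable ugraph"
  assumes "\<And>j. wf_ugraph (G j)" "\<And>j. rayless (G j)"
  shows "\<exists>(Z :: nat ugraph) \<rho>. wf_ugraph Z \<and> rayless Z \<and> connected_graph Z \<and>
    graph_rank_le \<rho> Z \<and> (\<forall>\<beta><\<rho>. \<not> graph_rank_le \<beta> Z) \<and>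
    (\<forall>j. graph_rank_le \<rho> (G j))"
proof -
  let ?P = "\<lparr>vertices = {()}, edges = {}\<rparr>"
  let ?A = "attach ?P (\<lambda>_. G)"
  have wf: "wf_ugraph ?A" by (rule wf_attach) (simp add: wf_ugraph_def, rule assms(1))
  have ray: "rayless ?A" by (rule rayless_attach) (simp add: rayless_def, rule assms(2))
  have "connected_graph ?P" using connected_set_singleton by simp
  then have con: "connected_graph ?A" by (rule attach_connected)
  define Z where "Z = nat_graph ?A"
  have Z: "wf_ugraph Z" "rayless Z" "connected_graph Z"
    using nat_graph_rayless[OF wf ray] nat_graph_connected[OF con]
    by (auto simp: Z_def rayless_graphs_def)
  define \<rho> where "\<rho> = (LEAST \<alpha>. graph_rank_le \<alpha> Z)"
  have \<rho>: "graph_rank_le \<rho> Z"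
    unfolding \<rho>_def by (rule LeastI_ex[OF rayless_imp_ranked[OF Z(2)]])
  have least: "\<not> graph_rank_le \<beta> Z" if "\<beta> < \<rho>" for \<beta>
    using that unfolding \<rho>_def by (rule not_less_Least)
  have "graph_rank_le \<rho> (G j)" for j
  proof -
    have "graph_model (\<lambda>z. {Inr ((), j, z)}) (G j) ?A"
      by (rule set_model_embedding) (auto simp: attach_edge attach_vertices inj_on_def)
    from set_model_trans[OF this to_nat_graph_model] show ?thesis
      by (rule rank_le_model[OF \<rho>[unfolded Z_def]])
  qed
  then show ?thesis using Z \<rho> least by (intro exI[of _ Z] exI[of _ \<rho>]) simp
qed


section \<open>Encoding marked graphs by connected unmarked graphs\<close>

text \<open>Every vertex of \<open>G\<close> is adjacent to both new vertices, whereas a vertex inside an attached copy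
  can reach them only through the gate of that copy.\<close>

fun suspension_adj :: "'a ugraph \<Rightarrow> bool + 'a \<Rightarrow> bool + 'a \<Rightarrow> bool" where
  "suspension_adj G (Inl c) (Inl d) \<longleftrightarrow> c \<noteq> d"
| "suspension_adj G (Inl c) (Inr v) \<longleftrightarrow> v \<in> vertices G"
| "suspension_adj G (Inr v) (Inl c) \<longleftrightarrow> v \<in> vertices G"
| "suspension_adj G (Inr u) (Inr v) \<longleftrightarrow> {u, v} \<in> edges G"

definition suspension :: "'a ugraph \<Rightarrow> (bool + 'a) ugraph" where
  "suspension G =
     \<lparr>vertices = range Inl \<union> Inr ` vertices G, edges = {{x, y} | x y. suspension_adj G x y}\<rparr>"

lemma suspension_edge: "{x, y} \<in> edges (suspension G) \<longleftrightarrow> suspension_adj G x y"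
proof -
  have "suspension_adj G y x" if "suspension_adj G x y" for x y
    using that by (induction G x y rule: suspension_adj.induct) (auto simp: insert_commute)
  then show ?thesis using doubleton_in_edges[of "suspension_adj G"] by (simp add: suspension_def)
qed

lemma suspension_vertices: "Inl c \<in> vertices (suspension G)"
  "Inr v \<in> vertices (suspension G) \<longleftrightarrow> v \<in> vertices G"
  by (auto simp: suspension_def)

lemma wf_suspension:
  assumes "wf_ugraph G"
  shows "wf_ugraph (suspension G)"
proof (rule wf_by_adjacency[where P = "suspension_adj G"])
  show "edges (suspension G) = {{x, y} | x y. suspension_adj G x y}" by (simp add: suspension_def)
  fix x y assume "suspension_adj G x y"
  then show "x \<in> vertices (suspension G) \<and> y \<in> vertices (suspension G) \<and> x \<noteq> y"
    using edge_vertices[OF assms] by (cases x; cases y) (auto simp: suspension_vertices)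
qed

lemma suspension_connected: "connected_graph (suspension G)"
proof (rule connected_setI[of "Inl True"])
  show "Inl True \<in> vertices (suspension G)" by (rule suspension_vertices)
  fix A assume A: "A \<subseteq> vertices (suspension G)" "A \<noteq> {}"
    "\<And>x y. x \<in> A \<Longrightarrow> y \<in> vertices (suspension G) \<Longrightarrow> {x, y} \<in> edges (suspension G) \<Longrightarrow> y \<in> A"
  obtain a where a: "a \<in> A" using A(2) by blast
  have heavy: "Inl c \<in> A" for c
  proof (cases "a = Inl c")
    case False
    then have "suspension_adj G a (Inl c)" using a A(1) by (cases a) (auto simp: suspension_def)
    then show ?thesis using A(3)[OF a suspension_vertices(1)] by (simp add: suspension_edge)
  qed (use a in simp)
  have "y \<in> A" if y: "y \<in> vertices (suspension G)" for y
  proof (cases y)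
    case (Inr v)
    then have "{Inl True, y} \<in> edges (suspension G)" using y
      by (simp add: suspension_edge suspension_vertices)
    then show ?thesis by (rule A(3)[OF heavy y])
  qed (use heavy in simp)
  then show "vertices (suspension G) \<subseteq> A" by blast
qed

lemma rayless_suspension:
  fixes G :: "'a::countable ugraph"
  assumes "wf_ugraph G" "rayless G"
  shows "rayless (suspension G)"
proof -
  obtain \<alpha> where \<alpha>: "graph_rank_le \<alpha> G" using rayless_imp_ranked[OF assms(2)] ..
  obtain \<beta> where \<beta>: "\<alpha> < \<beta>" using countable_bounded[of "{\<alpha>}"] by auto
  have "kernel (edges (suspension G)) \<beta> (vertices (suspension G)) (range Inl)"
  proof (rule kernelI)
    fix X assume X: "X \<subseteq> vertices (suspension G) - range Inl"
    have "set_model (\<lambda>x. {projr x}) X (edges (suspension G)) (vertices G) (edges G)"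
    proof (rule set_model_embedding)
      have "X \<subseteq> Inr ` vertices G" using X by (auto simp: suspension_def)
      moreover have "inj_on projr (Inr ` vertices G)" by (simp add: inj_on_def)
      ultimately show "inj_on projr X" "projr ` X \<subseteq> vertices G" by (auto intro: inj_on_subset)
      fix x y assume "x \<in> X" "y \<in> X" "{x, y} \<in> edges (suspension G)"
      then show "{projr x, projr y} \<in> edges G"
        using X by (cases x; cases y) (auto simp: suspension_edge)
    qed
    then have "rank_le (edges (suspension G)) \<alpha> X" by (rule rank_le_model[OF \<alpha>])
    then show "\<exists>\<alpha><\<beta>. rank_le (edges (suspension G)) \<alpha> X" using \<beta> by blast
  qed simp
  then have "graph_rank_le \<beta> (suspension G)" by (rule rank_leI)
  then show ?thesis using rayless_iff_ranked[OF wf_suspension[OF assms(1)]] by blast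
qed

definition null_graph :: "'a ugraph" where
  "null_graph = \<lparr>vertices = {}, edges = {}\<rparr>"

definition decoration :: "'a set \<Rightarrow> 'b ugraph \<Rightarrow> 'b ugraph \<Rightarrow> bool + 'a \<Rightarrow> nat \<Rightarrow> 'b ugraph" where
  "decoration M Z Z' x k = (case x of Inl c \<Rightarrow> Z' | Inr v \<Rightarrow> if v \<in> M then Z else null_graph)"

definition encoding :: "'a ugraph \<Rightarrow> 'a set \<Rightarrow> 'b ugraph \<Rightarrow> 'b ugraph \<Rightarrow> _ ugraph" where
  "encoding G M Z Z' = attach (suspension G) (decoration M Z Z')"

lemma null_graph_simps [simp]: "vertices null_graph = {}" "edges null_graph = {}"
  by (simp_all add: null_graph_def)

lemma decoration_simps [simp]:
  "decoration M Z Z' (Inl c) k = Z'"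
  "decoration M Z Z' (Inr v) k = (if v \<in> M then Z else null_graph)"
  by (simp_all add: decoration_def)

lemma wf_encoding:
  assumes "wf_ugraph G" "wf_ugraph Z" "wf_ugraph Z'"
  shows "wf_ugraph (encoding G M Z Z')"
  unfolding encoding_def
proof (rule wf_attach[OF wf_suspension[OF assms(1)]])
  show "wf_ugraph (decoration M Z Z' x k)" for x k
    using assms by (cases x) (auto simp: wf_ugraph_def)
qed

lemma rayless_encoding:
  fixes G :: "'a::countable ugraph"
  assumes "wf_ugraph G" "rayless G" "rayless Z" "rayless Z'"
  shows "rayless (encoding G M Z Z')"
  unfolding encoding_def
proof (rule rayless_attach[OF rayless_suspension[OF assms(1,2)]])
  show "rayless (decoration M Z Z' x k)" for x k
    using assms(3,4) by (cases x) (auto simp: rayless_def)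
qed

lemma encoding_connected: "connected_graph (encoding G M Z Z')"
  unfolding encoding_def by (rule attach_connected[OF suspension_connected])

text \<open>The rank of \<open>Z\<close> is at least that of \<open>H\<close>, and the rank of \<open>Z'\<close> at least that of the encoding of
  \<open>H\<close> without the copies of \<open>Z'\<close>. Infinitely many attached copies force a larger rank, so the
  branch set of a suspension point must contain a suspension point, and the branch set of a marked
  vertex must contain a marked vertex.\<close>

lemma encoding_reflects:
  assumes wf: "wf_ugraph G" "wf_ugraph H" and M: "M \<subseteq> vertices G" "M' \<subseteq> vertices H" "finite M'"
    and Z: "connected_graph Z" "\<And>\<beta>. \<beta> < \<rho> \<Longrightarrow> \<not> graph_rank_le \<beta> Z"
    and H_rank: "graph_rank_le \<rho> H"
    and Z': "connected_graph Z'" "\<And>\<beta>. \<beta> < \<rho>' \<Longrightarrow> \<not> graph_rank_le \<beta> Z'"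
    and Z'_rank: "graph_rank_le \<rho>' Z'"
    and core_rank: "graph_rank_le \<rho>' (encoding H M' Z null_graph)"
    and B: "graph_model B (encoding G M Z Z') (encoding H M' Z Z')"
  shows "marked_minor (G, M) (H, M')"
proof -
  let ?V = "vertices (encoding H M' Z Z')" and ?E = "edges (encoding H M' Z Z')"
  let ?hv = "Inl ` range Inl :: ((bool + 'b) + (bool + 'b) \<times> nat \<times> 'c) set"
  note BD = set_modelD[OF B]
  note gate = attach_gate[of "suspension H" "decoration M' Z Z'", folded encoding_def]
  have edge: "{x, y} \<in> ?E \<longleftrightarrow> attach_adj (suspension H) (decoration M' Z Z') x y" for x y
    by (simp add: encoding_def attach_edge)
  have vG: "Inl (Inl c) \<in> vertices (encoding G M Z Z')"
    "Inl (Inr u) \<in> vertices (encoding G M Z Z') \<longleftrightarrow> u \<in> vertices G" for c u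
    by (simp_all add: encoding_def attach_vertices suspension_vertices)
  have adjG: "{Inl (Inr u), Inl (Inl c)} \<in> edges (encoding G M Z Z')" if "u \<in> vertices G" for u c
    using that by (simp add: encoding_def attach_edge suspension_edge)

  \<comment> \<open>Such a set lies inside a copy of \<open>Z'\<close>, or it avoids all of these copies.\<close>
  have avoiding: "rank_le ?E \<rho>' Y" if Y: "Y \<subseteq> ?V - ?hv" "connected_set ?E Y" for Y
  proof (cases "\<exists>c k z. Inr (Inl c, k, z) \<in> Y")
    case True
    then obtain c k z where "Inr (Inl c, k, z) \<in> Y" by blast
    then have sub: "Y \<subseteq> {Inr (Inl c, k, y) | y. True}"
      by (rule gate[OF Y(2)]) (use Y(1) in blast)
    have "set_model (\<lambda>x. {snd (snd (projr x))}) Y ?E (vertices Z') (edges Z')"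
    proof (rule set_model_embedding)
      show "inj_on (\<lambda>x. snd (snd (projr x))) Y"
      proof (rule inj_onI)
        fix x y assume xy: "x \<in> Y" "y \<in> Y" "snd (snd (projr x)) = snd (snd (projr y))"
        then obtain a b where "x = Inr (Inl c, k, a)" "y = Inr (Inl c, k, b)" using sub by blast
        then show "x = y" using xy(3) by simp
      qed
      show "(\<lambda>x. snd (snd (projr x))) ` Y \<subseteq> vertices Z'"
      proof
        fix a assume "a \<in> (\<lambda>x. snd (snd (projr x))) ` Y"
        then obtain x where x: "x \<in> Y" "a = snd (snd (projr x))" by blast
        then obtain y where "x = Inr (Inl c, k, y)" using sub by blast
        then show "a \<in> vertices Z'" using x Y(1) by (auto simp: encoding_def attach_vertices)
      qed
      fix x y assume xy: "x \<in> Y" "y \<in> Y" "{x, y} \<in> ?E"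
      then obtain a b where "x = Inr (Inl c, k, a)" "y = Inr (Inl c, k, b)" using sub by blast
      then show "{snd (snd (projr x)), snd (snd (projr y))} \<in> edges Z'" using xy(3) by (simp add: edge)
    qed
    then show ?thesis by (rule rank_le_model[OF Z'_rank])
  next
    case False
    have "set_model (\<lambda>x. {x}) Y ?E (vertices (encoding H M' Z null_graph)) (edges
      (encoding H M' Z null_graph))"
    proof (rule set_model_identity)
      show "Y \<subseteq> vertices (encoding H M' Z null_graph)"
      proof
        fix x assume x: "x \<in> Y"
        then have xV: "x \<in> ?V" using Y(1) by blast
        show "x \<in> vertices (encoding H M' Z null_graph)"
        proof (cases x)
          case (Inl w)
          then show ?thesis using xV by (simp add: encoding_def attach_vertices)
        next
          case (Inr q)
          obtain w k z where q: "q = (w, k, z)" by (cases q)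
          then obtain v where "w = Inr v" using False x Inr by (cases w) auto
          then show ?thesis using xV Inr q by (simp add: encoding_def attach_vertices)
        qed
      qed
      fix x y assume xy: "x \<in> Y" "y \<in> Y" "{x, y} \<in> ?E"
      have deco: "decoration M' Z null_graph w k = decoration M' Z Z' w k" if "Inr (w, k, z) \<in> Y"
        for w k z
        using that False by (cases w) auto
      have "attach_adj (suspension H) (decoration M' Z null_graph) x y"
      proof (cases x)
        case (Inl u)
        then show ?thesis using xy deco by (cases y) (auto simp: edge)
      next
        case (Inr q)
        then show ?thesis using xy deco by (cases q; cases y) (auto simp: edge)
      qed
      then show "{x, y} \<in> edges (encoding H M' Z null_graph)" by (simp add: encoding_def attach_edge)
    qed
    then show ?thesis by (rule rank_le_model[OF core_rank])
  qed

  \<comment> \<open>Otherwise the copies of \<open>Z'\<close> attached at this point would give a connected set of rank above \<open>\<rho>'\<close>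
    that avoids both suspension points of \<open>H\<close>.\<close>
  have "\<exists>d. Inl (Inl d) \<in> B (Inl (Inl c))" for c
  proof (rule ccontr)
    assume "\<not> ?thesis"
    then have no: "B (Inl (Inl c)) \<inter> ?hv = {}" by blast
    have "\<exists>Y. Y \<subseteq> ?V - ?hv \<and> connected_set ?E Y \<and> B (Inl (Inl c)) \<subseteq> Y \<and> \<not> rank_le ?E \<rho>' Y"
      by (rule attached_copies_force_rank[OF B[unfolded encoding_def[of G]] _ _ Z' _ no])
        (simp_all add: suspension_vertices)
    then show False using avoiding by blast
  qed
  then obtain \<tau> where \<tau>: "\<And>c. Inl (Inl (\<tau> c)) \<in> B (Inl (Inl c))" by metis
  have "\<tau> True \<noteq> \<tau> False"
  proof
    assume "\<tau> True = \<tau> False"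
    then have "B (Inl (Inl True)) \<inter> B (Inl (Inl False)) \<noteq> {}" using \<tau>[of True] \<tau>[of False] by auto
    then show False using BD(3)[OF vG(1) vG(1), of True False] by simp
  qed
  then have \<tau>_onto: "\<exists>c. \<tau> c = d" for d by (metis (full_types))
  have free: "B (Inl (Inr u)) \<inter> ?hv = {}" if u: "u \<in> vertices G" for u
  proof -
    have "Inl (Inl d) \<notin> B (Inl (Inr u))" for d
    proof -
      obtain c where c: "\<tau> c = d" using \<tau>_onto by blast
      have "B (Inl (Inl c)) \<inter> B (Inl (Inr u)) = {}"
        by (rule BD(3)) (use u vG in simp_all)
      then show ?thesis using \<tau>[of c] c by blast
    qed
    then show ?thesis by blast
  qed

  \<comment> \<open>The branch set of a vertex of \<open>G\<close> cannot lie inside a copy: it is adjacent to the branch sets of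
    both suspension points, and only one of these can use the gate of the copy.\<close>
  have base: "\<exists>w. Inl (Inr w) \<in> B (Inl (Inr u))" if u: "u \<in> vertices G" for u
  proof (rule ccontr)
    assume no: "\<not> ?thesis"
    have uV: "Inl (Inr u) \<in> vertices (encoding G M Z Z')" using u vG by simp
    have no_base: "Inl x \<notin> B (Inl (Inr u))" for x using no free[OF u] by (cases x) auto
    obtain b where b: "b \<in> B (Inl (Inr u))" using connected_set_nonempty[OF BD(2)[OF uV]] by blast
    obtain x k z where bx: "b = Inr (x, k, z)" using b no_base by (cases b) auto
    have inside: "B (Inl (Inr u)) \<subseteq> {Inr (x, k, y) | y. True}"
      by (rule gate[OF BD(2)[OF uV] b[unfolded bx] no_base])
    have "Inl x \<in> B (Inl (Inl c))" for c
    proof (rule ccontr)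
      assume not_gate: "Inl x \<notin> B (Inl (Inl c))"
      obtain p q where pq: "p \<in> B (Inl (Inr u))" "q \<in> B (Inl (Inl c))" "{p, q} \<in> ?E"
        using BD(4)[OF uV vG(1) _ adjG[OF u]] by blast
      obtain y where "p = Inr (x, k, y)" using pq(1) inside by blast
      then have adj: "attach_adj (suspension H) (decoration M' Z Z') (Inr (x, k, y)) q"
        using pq(3) by (simp add: edge)
      have "q \<noteq> Inl x" using not_gate pq(2) by blast
      then obtain y' where "q = Inr (x, k, y')" using adj by (cases q) auto
      then have "B (Inl (Inl c)) \<subseteq> {Inr (x, k, y) | y. True}"
        using gate[OF BD(2)[OF vG(1)] _ not_gate] pq(2) by blast
      then show False using \<tau>[of c] by blast
    qed
    then show False using BD(3)[OF vG(1) vG(1), of True False] by blast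
  qed

  define B' where "B' u = {w. Inl (Inr w) \<in> B (Inl (Inr u))}" for u
  have base_eq: "Inl -` B (Inl (Inr u)) = Inr ` B' u" if "u \<in> vertices G" for u
  proof (rule set_eqI)
    fix x show "x \<in> Inl -` B (Inl (Inr u)) \<longleftrightarrow> x \<in> Inr ` B' u"
      using free[OF that] by (cases x) (auto simp: B'_def)
  qed
  have "graph_model B' G H"
  proof (rule set_modelI)
    fix u assume u: "u \<in> vertices G"
    then have uV: "Inl (Inr u) \<in> vertices (encoding G M Z Z')" using vG by simp
    show sub: "B' u \<subseteq> vertices H"
      using BD(1)[OF uV] by (auto simp: B'_def encoding_def attach_vertices suspension_vertices)
    obtain w where "Inl (Inr w) \<in> B (Inl (Inr u))" using base[OF u] by blast
    from attach_base_connected[OF BD(2)[OF uV, unfolded encoding_def] this]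
    have con: "connected_set (edges (suspension H)) (Inr ` B' u)" using base_eq[OF u] by simp
    have "set_model (\<lambda>x. {projr x}) (Inr ` B' u) (edges (suspension H)) (vertices H) (edges H)"
      by (rule set_model_embedding) (use sub in \<open>auto simp: inj_on_def suspension_edge\<close>)
    from set_model_connected[OF this order_refl con]
    show "connected_set (edges H) (B' u)" by simp
  next
    fix u v assume uv: "u \<in> vertices G" "v \<in> vertices G" "u \<noteq> v"
    then have "B (Inl (Inr u)) \<inter> B (Inl (Inr v)) = {}" by (intro BD(3)) (simp_all add: vG)
    then show "B' u \<inter> B' v = {}" by (auto simp: B'_def)
  next
    fix u v assume uv: "u \<in> vertices G" "v \<in> vertices G" "u \<noteq> v" "{u, v} \<in> edges G"
    have uV: "Inl (Inr u) \<in> vertices (encoding G M Z Z')" "Inl (Inr v) \<in> vertices (encoding G M Z Z')"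
      using uv vG by simp_all
    have disj: "B (Inl (Inr u)) \<inter> B (Inl (Inr v)) = {}" by (rule BD(3)) (use uV uv in simp_all)
    have "\<exists>x\<in>B (Inl (Inr u)). \<exists>y\<in>B (Inl (Inr v)). {x, y} \<in> ?E"
      by (rule BD(4)) (use uV uv in \<open>simp_all add: encoding_def attach_edge suspension_edge\<close>)
    then obtain x y where xy: "x \<in> B (Inl (Inr u))" "y \<in> B (Inl (Inr v))" "{x, y} \<in> ?E" by blast
    obtain a where a: "Inl (Inr a) \<in> B (Inl (Inr u))" using base[OF uv(1)] by blast
    obtain b where b: "Inl (Inr b) \<in> B (Inl (Inr v))" using base[OF uv(2)] by blast
    obtain p q where pq: "Inl p \<in> B (Inl (Inr u))" "Inl q \<in> B (Inl (Inr v))"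
      "{p, q} \<in> edges (suspension H)"
      using attach_base_edge[OF BD(2)[OF uV(1), unfolded encoding_def] a
          BD(2)[OF uV(2), unfolded encoding_def] b disj xy(1,2) xy(3)[unfolded encoding_def]] by blast
    obtain p' q' where "p = Inr p'" "q = Inr q'"
      using pq(1,2) base_eq[OF uv(1)] base_eq[OF uv(2)] by blast
    then show "\<exists>x\<in>B' u. \<exists>y\<in>B' v. {x, y} \<in> edges H"
      using pq by (auto simp: B'_def suspension_edge)
  qed
  moreover have "B' v \<inter> M' \<noteq> {}" if v: "v \<in> M" for v
  proof
    assume no_mark: "B' v \<inter> M' = {}"
    have vV: "v \<in> vertices G" using v M(1) by blast
    let ?T = "?hv \<union> Inl ` Inr ` M'"
    have T: "finite ?T" using M(3) by simp
    have avoid: "B (Inl (Inr v)) \<inter> ?T = {}" using no_mark free[OF vV] by (auto simp: B'_def)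
    have "\<exists>Y. Y \<subseteq> ?V - ?T \<and> connected_set ?E Y \<and> B (Inl (Inr v)) \<subseteq> Y \<and> \<not> rank_le ?E \<rho> Y"
      by (rule attached_copies_force_rank[OF B[unfolded encoding_def[of G]] _ _ Z T avoid])
        (use vV v in \<open>simp_all add: suspension_vertices\<close>)
    then obtain Y where Y: "Y \<subseteq> ?V - ?T" "connected_set ?E Y" "B (Inl (Inr v)) \<subseteq> Y" "\<not> rank_le ?E \<rho> Y"
      by blast
    obtain w where w: "Inl (Inr w) \<in> Y" using base[OF vV] Y(3) by blast
    \<comment> \<open>A copy meeting \<open>Y\<close> is attached at a mark or a suspension point, and these gates are in \<open>?T\<close>.\<close>
    have "Inr (x, k, z) \<notin> Y" for x k z
    proof
      assume in_Y: "Inr (x, k, z) \<in> Y"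
      then have "Inr (x, k, z) \<in> ?V" using Y(1) by blast
      then have "Inl x \<in> ?T" by (cases x) (auto simp: encoding_def attach_vertices split: if_splits)
      then have "Inl x \<notin> Y" using Y(1) by blast
      from gate[OF Y(2) in_Y this] show False using w by blast
    qed
    note no_copy = this
    have Y_base: "\<exists>w\<in>vertices H. y = Inl (Inr w)" if y: "y \<in> Y" for y
    proof (cases y)
      case (Inl x)
      then have "x \<in> vertices (suspension H)" using y Y(1) by (auto simp: encoding_def attach_vertices)
      moreover have "x \<notin> range Inl" using Inl y Y(1) by blast
      ultimately show ?thesis using Inl by (auto simp: suspension_def)
    next
      case (Inr p)
      then show ?thesis using no_copy y by (cases p) blast
    qed
    have "set_model (\<lambda>y. {projr (projl y)}) Y ?E (vertices H) (edges H)"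
    proof (rule set_model_embedding)
      show "inj_on (\<lambda>y. projr (projl y)) Y"
      proof (rule inj_onI)
        fix x y assume xy: "x \<in> Y" "y \<in> Y" "projr (projl x) = projr (projl y)"
        obtain a b where "x = Inl (Inr a)" "y = Inl (Inr b)" using xy(1,2) Y_base by meson
        then show "x = y" using xy(3) by simp
      qed
      show "(\<lambda>y. projr (projl y)) ` Y \<subseteq> vertices H" using Y_base by fastforce
      fix x y assume xy: "x \<in> Y" "y \<in> Y" "{x, y} \<in> ?E"
      obtain a b where "x = Inl (Inr a)" "y = Inl (Inr b)" using xy(1,2) Y_base by meson
      then show "{projr (projl x), projr (projl y)} \<in> edges H" using xy(3)
        by (simp add: edge suspension_edge)
    qed
    then have "rank_le ?E \<rho> Y" by (rule rank_le_model[OF H_rank])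
    then show False using Y(4) by simp
  qed
  ultimately show ?thesis unfolding marked_minor_iff[OF wf M(1)] by (intro exI[of _ B']) simp
qed

text \<open>One pair of heavy graphs is chosen for the whole sequence, so that all its members are encoded
  in the same way: first \<open>Z\<close> above all graphs of the sequence, then \<open>Z'\<close> above all of them with
  \<open>Z\<close> attached.\<close>

theorem connected_wqo_imp_marked_wqo:
  assumes "wqo_on minor connected_rayless_graphs"
  shows "wqo_on marked_minor rayless_marked"
proof (rule ccontr)
  assume "\<not> ?thesis"
  then obtain q :: "nat \<Rightarrow> nat marked_graph" where
    "(\<forall>n. q n \<in> rayless_marked) \<and> (\<forall>i j. i < j \<longrightarrow> \<not> marked_minor (q i) (q j))"
    unfolding not_wqo_on_iff ..
  then have q: "\<And>n. q n \<in> rayless_marked" "\<And>i j. i < j \<Longrightarrow> \<not> marked_minor (q i) (q j)" by simp_all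
  define G where "G n = fst (q n)" for n
  define M where "M n = snd (q n)" for n
  have G: "wf_ugraph (G n)" "rayless (G n)" and M: "M n \<subseteq> vertices (G n)" "finite (M n)" for n
    using q(1)[of n] by (auto simp: G_def M_def rayless_marked_def rayless_graphs_def)
  obtain Z :: "nat ugraph" and \<rho> where Z: "wf_ugraph Z" "rayless Z" "connected_graph Z"
    "graph_rank_le \<rho> Z" "\<forall>\<beta><\<rho>. \<not> graph_rank_le \<beta> Z"
    "\<forall>j. graph_rank_le \<rho> (G j)"
    using heavy_graph_exists[of G, OF G] by blast
  have null: "wf_ugraph (null_graph :: nat ugraph)" "rayless (null_graph :: nat ugraph)"
    by (simp_all add: wf_ugraph_def rayless_def)
  define F where "F j = encoding (G j) (M j) Z null_graph" for j
  have F: "wf_ugraph (F j)" "rayless (F j)" for j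
    unfolding F_def using wf_encoding[OF G(1) Z(1) null(1)] rayless_encoding[OF G Z(2) null(2)]
      by simp_all
  obtain Z' :: "nat ugraph" and \<rho>' where Z': "wf_ugraph Z'" "rayless Z'" "connected_graph Z'"
    "graph_rank_le \<rho>' Z'" "\<forall>\<beta><\<rho>'. \<not> graph_rank_le \<beta> Z'"
    "\<forall>j. graph_rank_le \<rho>' (F j)"
    using heavy_graph_exists[of F, OF F] by blast
  define C where "C j = encoding (G j) (M j) Z Z'" for j
  have wf: "wf_ugraph (C j)" for j unfolding C_def by (rule wf_encoding[OF G(1) Z(1) Z'(1)])
  have "nat_graph (C j) \<in> connected_rayless_graphs" for j
    unfolding connected_rayless_graphs_def C_def
    using nat_graph_rayless[OF wf[of j, unfolded C_def] rayless_encoding[OF G Z(2) Z'(2)]]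
      nat_graph_connected[OF encoding_connected] by simp
  then have "range (\<lambda>j. nat_graph (C j)) \<subseteq> connected_rayless_graphs" by blast
  then obtain i j where ij: "i < j" "minor (nat_graph (C i)) (nat_graph (C j))"
    using assms unfolding wqo_on_def by blast
  obtain B where B: "graph_model B (C i) (C j)"
    using ij(2) unfolding minor_nat_graph[OF wf wf] ..
  have "marked_minor (G i, M i) (G j, M j)"
    by (rule encoding_reflects[OF G(1) G(1) M(1) M(1) M(2) Z(3) _ Z(6)[rule_format] Z'(3) _ Z'(4)
          Z'(6)[rule_format, unfolded F_def] B[unfolded C_def]])
      (use Z(5) Z'(5) in simp_all)
  then show False using q(2)[OF ij(1)] by (simp add: G_def M_def)
qed


section \<open>Rooted graphs\<close>

text \<open>The roots of a graph are the vertices \<open>0, \<dots>, m - 1\<close>, in this order.\<close>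

definition rooted_minor :: "nat \<Rightarrow> nat ugraph \<Rightarrow> nat ugraph \<Rightarrow> bool" where
  "rooted_minor m G H \<longleftrightarrow>
     (\<exists>B. graph_model B G H \<and> (\<forall>i<m. i \<in> B i))"

lemma rooted_minor_refl: "rooted_minor m G G"
  unfolding rooted_minor_def
  by (rule exI[of _ "\<lambda>u. {u}"]) (simp add: set_model_identity)

lemma rooted_minor_trans:
  assumes "rooted_minor m G H" "rooted_minor m H K"
  shows "rooted_minor m G K"
proof -
  obtain B where B: "graph_model B G H" "\<forall>i<m. i \<in> B i"
    using assms(1) unfolding rooted_minor_def by blast
  obtain B' where B': "graph_model B' H K" "\<forall>i<m. i \<in> B' i"
    using assms(2) unfolding rooted_minor_def by blast
  have "\<forall>i<m. i \<in> \<Union>(B' ` B i)" using B(2) B'(2) by blast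
  then show ?thesis
    unfolding rooted_minor_def using set_model_trans[OF B(1) B'(1)]
    by (intro exI[of _ "\<lambda>u. \<Union>(B' ` B u)"]) simp
qed

text \<open>Only finitely many terms of a sequence are below no later term, since these form a bad sequence.\<close>

lemma wqo_chain:
  fixes q :: "nat \<Rightarrow> 'q"
  assumes "wqo_on le Q" "\<And>n. q n \<in> Q"
  shows "\<exists>\<phi> :: nat \<Rightarrow> nat. \<forall>k. \<phi> k < \<phi> (Suc k) \<and> le (q (\<phi> k)) (q (\<phi> (Suc k)))"
proof -
  define T where "T = {i. \<forall>j>i. \<not> le (q i) (q j)}"
  have "finite T"
  proof (rule ccontr)
    assume inf: "infinite T"
    let ?e = "enumerate T"
    have "range (\<lambda>n. q (?e n)) \<subseteq> Q" using assms(2) by blast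
    then have "\<exists>i j. i < j \<and> le (q (?e i)) (q (?e j))"
      using assms(1) unfolding wqo_on_def by (elim allE[of _ "\<lambda>n. q (?e n)"]) simp
    then obtain i j where ij: "i < j" "le (q (?e i)) (q (?e j))" by blast
    have "?e i \<in> T" by (rule enumerate_in_set[OF inf])
    moreover have "?e i < ?e j" by (rule enumerate_mono[OF ij(1) inf])
    ultimately show False using ij(2) by (simp add: T_def)
  qed
  then obtain N where N: "\<forall>i\<in>T. i < N" using finite_nat_set_iff_bounded by blast
  have "\<exists>\<phi>. \<forall>k. N \<le> \<phi> k \<and> (\<phi> k < \<phi> (Suc k) \<and> le (q (\<phi> k)) (q (\<phi> (Suc k))))"
  proof (rule dependent_nat_choice[where P = "\<lambda>_ m. N \<le> m" and Q = "\<lambda>_ m m'. m < m' \<and> le (q m) (q m')"])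
    show "\<exists>m. N \<le> m" by blast
    fix m :: nat assume "N \<le> m"
    then have "m \<notin> T" using N by (meson not_less)
    then obtain m' where "m < m'" "le (q m) (q m')" by (auto simp: T_def)
    then show "\<exists>m'. N \<le> m' \<and> m < m' \<and> le (q m) (q m')" using \<open>N \<le> m\<close> by (intro exI[of _ m']) simp
  qed
  then show ?thesis by blast
qed

text \<open>A marked minor between graphs with the same \<open>m\<close> marked vertices permutes the marks.  Along an
  ascending chain, two of the partial products of these permutations agree, and between those two indices
  the permutation is the identity.\<close>

lemma rooted_wqo:
  assumes "wqo_on marked_minor (Rank_marked_below_le m \<alpha>)"
  shows "wqo_on (rooted_minor m) {G \<in> Rank_below \<alpha>. {..<m} \<subseteq> vertices G}"
  unfolding wqo_on_def
proof (intro allI impI)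
  fix q :: "nat \<Rightarrow> nat ugraph"
  assume q: "range q \<subseteq> {G \<in> Rank_below \<alpha>. {..<m} \<subseteq> vertices G}"
  then have qn: "q n \<in> Rank_below \<alpha>" "{..<m} \<subseteq> vertices (q n)" for n by blast+
  have wf: "wf_ugraph (q n)" for n using qn(1)[of n] by (auto simp: Rank_below_def Rank_iff_rank_le)
  have mem: "(q n, {..<m}) \<in> Rank_marked_below_le m \<alpha>" for n
    using qn[of n] by (simp add: Rank_marked_below_le_def)
  obtain \<phi> :: "nat \<Rightarrow> nat" where
    \<phi>: "\<forall>k. \<phi> k < \<phi> (Suc k) \<and> marked_minor (q (\<phi> k), {..<m}) (q (\<phi> (Suc k)), {..<m})"
    using wqo_chain[OF assms, of "\<lambda>n. (q n, {..<m})", OF mem] by blast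
  define T where "T f G H \<longleftrightarrow> (\<exists>B. graph_model B G H \<and>
    (\<forall>i<m. f i \<in> B i))" for f :: "nat \<Rightarrow> nat" and G H :: "nat ugraph"
  have "\<exists>f. bij_betw f {..<m} {..<m} \<and> T f (q (\<phi> k)) (q (\<phi> (Suc k)))" for k
  proof -
    obtain B where B: "graph_model B (q (\<phi> k)) (q (\<phi> (Suc k)))" "\<forall>i\<in>{..<m}. B i \<inter> {..<m} \<noteq> {}"
      using \<phi> unfolding marked_minor_iff[OF wf wf qn(2)] by blast
    have "\<forall>i\<in>{..<m}. \<exists>w. w \<in> B i \<and> w < m" using B(2) by blast
    then obtain f where f: "\<forall>i\<in>{..<m}. f i \<in> B i \<and> f i < m"
      using bchoice[of "{..<m}" "\<lambda>i w. w \<in> B i \<and> w < m"] by blast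
    have "inj_on f {..<m}"
    proof (rule inj_onI)
      fix i j assume ij: "i \<in> {..<m}" "j \<in> {..<m}" "f i = f j"
      show "i = j"
      proof (rule ccontr)
        assume "i \<noteq> j"
        then have "B i \<inter> B j = {}" using set_modelD(3)[OF B(1)] qn(2)[of "\<phi> k"] ij(1,2) by blast
        moreover have "f i \<in> B i" "f j \<in> B j" using f ij(1,2) by blast+
        ultimately show False using ij(3) by auto
      qed
    qed
    moreover have "f ` {..<m} \<subseteq> {..<m}" using f by blast
    ultimately have "bij_betw f {..<m} {..<m}"
      unfolding bij_betw_def using endo_inj_surj[of "{..<m}" f] by blast
    moreover have "T f (q (\<phi> k)) (q (\<phi> (Suc k)))" unfolding T_def using B(1) f by blast
    ultimately show ?thesis by (intro exI[of _ f]) simp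
  qed
  then obtain \<sigma> where \<sigma>: "\<And>k. bij_betw (\<sigma> k) {..<m} {..<m}" "\<And>k. T (\<sigma> k) (q (\<phi> k)) (q (\<phi> (Suc k)))"
    by metis
  define \<pi> where "\<pi> = rec_nat id (\<lambda>k f. \<sigma> k \<circ> f)"
  have \<pi>_simps: "\<pi> 0 = id" "\<pi> (Suc k) = \<sigma> k \<circ> \<pi> k" for k by (simp_all add: \<pi>_def)
  have \<pi>_bij: "bij_betw (\<pi> k) {..<m} {..<m}" for k
  proof (induction k)
    case (Suc k)
    then show ?case unfolding \<pi>_simps by (rule bij_betw_trans[OF _ \<sigma>(1)])
  qed (simp add: \<pi>_simps bij_betw_def inj_on_def)
  have compose: "\<exists>f. T f (q (\<phi> k)) (q (\<phi> l)) \<and> f ` {..<m} \<subseteq> {..<m} \<and> (\<forall>i<m. \<pi> l i = f (\<pi> k i))"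
    if "k < l" for k l
    using that
  proof (induction l)
    case (Suc l)
    show ?case
    proof (cases "k = l")
      case True
      then show ?thesis
        using \<sigma>(2)[of k] bij_betw_imp_surj_on[OF \<sigma>(1)[of k]]
          by (intro exI[of _ "\<sigma> k"]) (simp add: \<pi>_simps)
    next
      case False
      then obtain f where f: "T f (q (\<phi> k)) (q (\<phi> l))" "f ` {..<m} \<subseteq> {..<m}" "\<forall>i<m. \<pi> l i = f (\<pi> k i)"
        using Suc by auto
      obtain B where B: "graph_model B (q (\<phi> k)) (q (\<phi> l))"
        "\<forall>i<m. f i \<in> B i" using f(1) unfolding T_def by blast
      obtain B' where B': "graph_model B' (q (\<phi> l)) (q (\<phi> (Suc l)))"
        "\<forall>i<m. \<sigma> l i \<in> B' i" using \<sigma>(2)[of l] unfolding T_def by blast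
      have "(\<sigma> l \<circ> f) i \<in> \<Union>(B' ` B i)" if "i < m" for i
      proof -
        have "f i < m" using f(2) that by blast
        then have "\<sigma> l (f i) \<in> B' (f i)" using B'(2) by blast
        then show ?thesis using B(2) that by auto
      qed
      then have "T (\<sigma> l \<circ> f) (q (\<phi> k)) (q (\<phi> (Suc l)))"
        unfolding T_def using set_model_trans[OF B(1) B'(1)]
        by (intro exI[of _ "\<lambda>u. \<Union>(B' ` B u)"]) simp
      moreover have "(\<sigma> l \<circ> f) ` {..<m} \<subseteq> {..<m}"
        using f(2) bij_betw_imp_surj_on[OF \<sigma>(1)[of l]] by (metis image_comp image_mono)
      moreover have "\<forall>i<m. \<pi> (Suc l) i = (\<sigma> l \<circ> f) (\<pi> k i)" using f(3) by (simp add: \<pi>_simps)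
      ultimately show ?thesis by (intro exI[of _ "\<sigma> l \<circ> f"] conjI)
    qed
  qed simp
  let ?r = "\<lambda>k. restrict (\<pi> k) {..<m}"
  have "range ?r \<subseteq> {..<m} \<rightarrow>\<^sub>E {..<m}"
  proof
    fix g assume "g \<in> range ?r"
    then obtain k where "g = ?r k" by blast
    then show "g \<in> {..<m} \<rightarrow>\<^sub>E {..<m}" using bij_betw_imp_surj_on[OF \<pi>_bij[of k]] by auto
  qed
  then have "finite (range ?r)" by (rule finite_subset) (simp add: finite_PiE)
  then have "\<not> inj ?r" using finite_imageD infinite_UNIV_nat by blast
  then obtain k l where kl: "?r k = ?r l" "k \<noteq> l" by (auto simp: inj_def)
  have "\<exists>k l. k < l \<and> ?r k = ?r l"
  proof (cases "k < l")
    case False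
    then show ?thesis using kl by (intro exI[of _ l] exI[of _ k]) simp
  qed (use kl in blast)
  then obtain k l where kl: "k < l" "?r k = ?r l" by blast
  obtain f where f: "T f (q (\<phi> k)) (q (\<phi> l))" "\<forall>i<m. \<pi> l i = f (\<pi> k i)" using compose[OF kl(1)] by blast
  have "f j = j" if "j < m" for j
  proof -
    have "j \<in> \<pi> k ` {..<m}" using bij_betw_imp_surj_on[OF \<pi>_bij[of k]] that by simp
    then obtain i where i: "i < m" "j = \<pi> k i" by blast
    have "\<pi> k i = \<pi> l i" using fun_cong[OF kl(2), of i] i(1) by simp
    then show ?thesis using f(2) i by simp
  qed
  then have "T f (q (\<phi> k)) (q (\<phi> l)) \<longleftrightarrow> rooted_minor m (q (\<phi> k)) (q (\<phi> l))"
    unfolding T_def rooted_minor_def by simp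
  then have "rooted_minor m (q (\<phi> k)) (q (\<phi> l))" using f(1) by simp
  moreover have "\<phi> n < \<phi> (Suc n)" for n using \<phi> by simp
  then have "\<phi> k < \<phi> l" using kl(1) by (rule lift_Suc_mono_less)
  ultimately show "\<exists>i j. i < j \<and> rooted_minor m (q i) (q j)" by blast
qed


section \<open>Counting graphs of bounded rank\<close>

text \<open>The empty set is included as a piece to account for the edges between roots.\<close>

definition pieces :: "nat \<Rightarrow> nat ugraph \<Rightarrow> nat set set" where
  "pieces m G = insert {} (component (edges G) (vertices G - {..<m}) ` (vertices G - {..<m}))"

definition piece_graph :: "nat \<Rightarrow> nat ugraph \<Rightarrow> nat set \<Rightarrow> nat ugraph" where
  "piece_graph m G C = induced_subgraph G ({..<m} \<union> C)"

lemma pieces_disjoint: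
  assumes "C \<in> pieces m G" "D \<in> pieces m G" "x \<in> C" "x \<in> D"
  shows "C = D"
proof -
  let ?c = "component (edges G) (vertices G - {..<m})"
  obtain y where y: "y \<in> vertices G - {..<m}" "C = ?c y" using assms(1,3) by (auto simp: pieces_def)
  obtain z where z: "z \<in> vertices G - {..<m}" "D = ?c z" using assms(2,4) by (auto simp: pieces_def)
  have "?c x = ?c y" by (rule component_eq) (use assms(3) y in simp_all)
  moreover have "?c x = ?c z" by (rule component_eq) (use assms(4) z in simp_all)
  ultimately show ?thesis using y z by simp
qed

lemma pieces_subset: "C \<in> pieces m G \<Longrightarrow> C \<subseteq> vertices G - {..<m}"
  using component_subset[of "edges G" "vertices G - {..<m}"] by (auto simp: pieces_def)

lemma piece_graph_vertices:
  "{..<m} \<subseteq> vertices G \<Longrightarrow> C \<in> pieces m G \<Longrightarrow> vertices (piece_graph m G C) = {..<m} \<union> C"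
  using pieces_subset[of C m G] by (auto simp: piece_graph_def induced_subgraph_def)

lemma piece_graph_edge:
  "{u, v} \<in> edges (piece_graph m G C) \<longleftrightarrow> {u, v} \<in> edges G \<and> u \<in> {..<m} \<union> C \<and> v \<in> {..<m} \<union> C"
  by (auto simp: piece_graph_def induced_subgraph_def)

lemma vertex_in_piece:
  assumes "v \<in> vertices G"
  shows "\<exists>C\<in>pieces m G. v \<in> {..<m} \<union> C"
proof (cases "v < m")
  case False
  then have v: "v \<in> vertices G - {..<m}" using assms by simp
  then show ?thesis using component_self[OF v, of "edges G"] unfolding pieces_def by blast
next
  case True
  then show ?thesis by (intro bexI[of _ "{}"]) (simp_all add: pieces_def)
qed

lemma edge_in_piece:
  assumes wf: "wf_ugraph G" and e: "{u, v} \<in> edges G"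
  shows "\<exists>C\<in>pieces m G. u \<in> {..<m} \<union> C \<and> v \<in> {..<m} \<union> C"
proof -
  let ?U = "vertices G - {..<m}"
  have closed: "\<exists>C\<in>pieces m G. x \<in> {..<m} \<union> C \<and> y \<in> {..<m} \<union> C"
    if xy: "{x, y} \<in> edges G" "x \<ge> m" for x y
  proof -
    have x: "x \<in> ?U" using edge_vertices[OF wf xy(1)] xy(2) by simp
    have "y \<in> {..<m} \<union> component (edges G) ?U x"
    proof (cases "y < m")
      case False
      then have "y \<in> ?U" using edge_vertices[OF wf xy(1)] by simp
      then show ?thesis using component_closed[OF component_self[OF x] _ xy(1)] by simp
    qed simp
    then show ?thesis using component_self[OF x, of "edges G"] x unfolding pieces_def by blast
  qed
  consider "u \<ge> m" | "v \<ge> m" | "u < m" "v < m" by linarith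
  then show ?thesis
  proof cases
    case 1
    then show ?thesis using closed[OF e] by simp
  next
    case 2
    then show ?thesis using closed[of v u] e by (auto simp: insert_commute)
  next
    case 3
    then show ?thesis by (intro bexI[of _ "{}"]) (simp_all add: pieces_def)
  qed
qed

text \<open>Models of the pieces glue along the roots: the branch sets of a root have that root in common,
  and injectivity of \<open>f\<close> keeps everything else disjoint.\<close>

lemma glue_pieces:
  assumes wf: "wf_ugraph G" and roots: "{..<m} \<subseteq> vertices G" "{..<m} \<subseteq> vertices H"
    and f: "inj_on f (pieces m G)" "f ` pieces m G \<subseteq> pieces m H"
    and le: "\<And>C. C \<in> pieces m G \<Longrightarrow> rooted_minor m (piece_graph m G C) (piece_graph m H (f C))"
  shows "rooted_minor m G H"
proof -
  let ?P = "pieces m G"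
  have "\<forall>C\<in>?P. \<exists>B. graph_model B (piece_graph m G C) (piece_graph m H (f C)) \<and> (\<forall>i<m. i \<in> B i)"
    using le unfolding rooted_minor_def by blast
  then obtain B where B: "\<And>C. C \<in> ?P \<Longrightarrow> graph_model (B C) (piece_graph m G C) (piece_graph m H (f C))"
    and B_root: "\<And>C i. C \<in> ?P \<Longrightarrow> i < m \<Longrightarrow> i \<in> B C i" by metis
  have vG: "vertices (piece_graph m G C) = {..<m} \<union> C" if "C \<in> ?P" for C
    by (rule piece_graph_vertices[OF roots(1) that])
  have vH: "vertices (piece_graph m H (f C)) = {..<m} \<union> f C" if "C \<in> ?P" for C
    by (rule piece_graph_vertices[OF roots(2)]) (use f(2) that in blast)
  have B_sub: "B C v \<subseteq> {..<m} \<union> f C" if "C \<in> ?P" "v \<in> {..<m} \<union> C" for C v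
    using set_modelD(1)[OF B[OF that(1)], of v] vG[OF that(1)] vH[OF that(1)] that(2) by simp
  have B_con: "connected_set (edges H) (B C v)" if "C \<in> ?P" "v \<in> {..<m} \<union> C" for C v
  proof -
    have "connected_set (edges (piece_graph m H (f C))) (B C v)"
      using set_modelD(2)[OF B[OF that(1)], of v] vG[OF that(1)] that(2) by simp
    then show ?thesis by (rule connected_set_mono) (simp add: piece_graph_edge)
  qed
  have B_disj: "B C u \<inter> B C v = {}"
    if "C \<in> ?P" "u \<in> {..<m} \<union> C" "v \<in> {..<m} \<union> C" "u \<noteq> v" for C u v
    by (rule set_modelD(3)[OF B[OF that(1)]]) (use vG[OF that(1)] that in simp_all)
  have only_root: "x = v" if "C \<in> ?P" "v \<in> {..<m} \<union> C" "x \<in> B C v" "x < m" for C v x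
  proof (rule ccontr)
    assume "x \<noteq> v"
    then have "B C x \<inter> B C v = {}" using B_disj[OF that(1), of x v] that by simp
    then show False using B_root[OF that(1,4)] that(3) by blast
  qed
  define F where "F v = {B C v | C. C \<in> ?P \<and> v \<in> {..<m} \<union> C}" for v
  have unique: "C = D" if "C \<in> ?P" "D \<in> ?P" "v \<in> {..<m} \<union> C" "v \<in> {..<m} \<union> D" "\<not> v < m" for C D v
    using pieces_disjoint[OF that(1,2)] that(3-5) by blast
  have "graph_model (\<lambda>v. \<Union>(F v)) G H"
  proof (rule set_modelI)
    fix v assume v: "v \<in> vertices G"
    have "B C v \<subseteq> vertices H" if "C \<in> ?P" "v \<in> {..<m} \<union> C" for C
    proof -
      have "f C \<subseteq> vertices H" using pieces_subset[of "f C" m H] f(2) that(1) by blast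
      then show ?thesis using B_sub[OF that] roots(2) by blast
    qed
    then show "\<Union>(F v) \<subseteq> vertices H" unfolding F_def by blast
    obtain C where C: "C \<in> ?P" "v \<in> {..<m} \<union> C" using vertex_in_piece[OF v, of m] by blast
    have CF: "B C v \<in> F v" unfolding F_def using C by blast
    obtain x where x: "x \<in> B C v" using connected_set_nonempty[OF B_con[OF C]] by blast
    have common: "(if v < m then v else x) \<in> X" if X: "X \<in> F v" for X
    proof -
      obtain D where D: "X = B D v" "D \<in> ?P" "v \<in> {..<m} \<union> D" using X unfolding F_def by blast
      show ?thesis
      proof (cases "v < m")
        case True
        then show ?thesis using B_root[OF D(2)] D(1) by simp
      next
        case False
        then show ?thesis using unique[OF C(1) D(2) C(2) D(3)] D(1) x by simp
      qed
    qed
    show "connected_set (edges H) (\<Union>(F v))"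
    proof (rule connected_set_Union)
      show "connected_set (edges H) X" if "X \<in> F v" for X
        using that B_con unfolding F_def by blast
      show "F v \<noteq> {}" using CF by blast
    qed (rule common)
  next
    fix u v assume uv: "u \<in> vertices G" "v \<in> vertices G" "u \<noteq> v"
    have "B C u \<inter> B D v = {}" if C: "C \<in> ?P" "u \<in> {..<m} \<union> C" and D: "D \<in> ?P" "v \<in> {..<m} \<union> D" for C D
    proof (cases "C = D")
      case True
      then show ?thesis using B_disj[OF C(1)] C D uv(3) by simp
    next
      case False
      then have "f C \<noteq> f D" using f(1) C(1) D(1) by (simp add: inj_on_eq_iff)
      show ?thesis
      proof (rule ccontr)
        assume "B C u \<inter> B D v \<noteq> {}"
        then obtain x where x: "x \<in> B C u" "x \<in> B D v" by blast
        have "x < m"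
        proof (rule ccontr)
          assume "\<not> x < m"
          then have "x \<in> f C" "x \<in> f D" using x B_sub[OF C] B_sub[OF D] by auto
          moreover have "f C \<in> pieces m H" "f D \<in> pieces m H" using f(2) C(1) D(1) by auto
          ultimately show False using pieces_disjoint \<open>f C \<noteq> f D\<close> by blast
        qed
        then have "x = u" "x = v" using only_root[OF C x(1)] only_root[OF D x(2)] by auto
        then show False using uv(3) by simp
      qed
    qed
    then show "\<Union>(F u) \<inter> \<Union>(F v) = {}" unfolding F_def by blast
  next
    fix u v assume uv: "u \<in> vertices G" "v \<in> vertices G" "u \<noteq> v" "{u, v} \<in> edges G"
    obtain C where C: "C \<in> ?P" "u \<in> {..<m} \<union> C" "v \<in> {..<m} \<union> C"
      using edge_in_piece[OF wf uv(4), of m] by blast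
    have "\<exists>x\<in>B C u. \<exists>y\<in>B C v. {x, y} \<in> edges (piece_graph m H (f C))"
      by (rule set_modelD(4)[OF B[OF C(1)]]) (use C uv vG[OF C(1)] in \<open>simp_all add: piece_graph_edge\<close>)
    then obtain x y where "x \<in> B C u" "y \<in> B C v" "{x, y} \<in> edges H" by (auto simp: piece_graph_edge)
    then show "\<exists>x\<in>\<Union>(F u). \<exists>y\<in>\<Union>(F v). {x, y} \<in> edges H"
      using C unfolding F_def by blast
  qed
  moreover have "i \<in> \<Union>(F i)" if "i < m" for i
  proof -
    have "{} \<in> ?P" by (simp add: pieces_def)
    then show ?thesis using B_root[of "{}" i] that unfolding F_def by blast
  qed
  ultimately show ?thesis
    unfolding rooted_minor_def by (intro exI[of _ "\<lambda>v. \<Union>(F v)"]) simp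
qed

definition rooted_Rank :: "countable_ordinal \<Rightarrow> nat \<Rightarrow> nat ugraph set" where
  "rooted_Rank \<alpha> m = {G \<in> Rank \<alpha>. {..<m} \<subseteq> vertices G}"

definition rooted_at_kernel :: "countable_ordinal \<Rightarrow> nat \<Rightarrow> nat ugraph set" where
  "rooted_at_kernel \<alpha> m =
     {G. wf_ugraph G \<and> {..<m} \<subseteq> vertices G \<and> kernel (edges G) \<alpha> (vertices G) {..<m}}"

text \<open>The roots can be added to a component without raising its rank, by adding them to its kernel.\<close>

lemma piece_rank:
  assumes G: "G \<in> rooted_at_kernel \<alpha> m" and "0 < \<alpha>" and C: "C \<in> pieces m G"
  shows "\<exists>\<beta><\<alpha>. piece_graph m G C \<in> rooted_Rank \<beta> m"
proof -
  have wf: "wf_ugraph G" and roots: "{..<m} \<subseteq> vertices G" and K: "kernel (edges G) \<alpha> (vertices G) {..<m}"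
    using G by (auto simp: rooted_at_kernel_def)
  have V: "vertices (piece_graph m G C) = {..<m} \<union> C" by (rule piece_graph_vertices[OF roots C])
  have "\<exists>\<beta><\<alpha>. rank_le (edges G) \<beta> ({..<m} \<union> C)"
  proof (cases "C = {}")
    case True
    then show ?thesis using rank_le_finite[of "{..<m}" "edges G" 0] \<open>0 < \<alpha>\<close> by auto
  next
    case False
    then obtain x where x: "x \<in> vertices G - {..<m}" "C = component (edges G) (vertices G - {..<m}) x"
      using C by (auto simp: pieces_def)
    have "connected_set (edges G) C" unfolding x(2) by (rule component_connected[OF x(1)])
    then obtain \<beta> where \<beta>: "\<beta> < \<alpha>" "rank_le (edges G) \<beta> C" using kernelD[OF K pieces_subset[OF C]]
      by blast
    then obtain S where S: "kernel (edges G) \<beta> C S" by (auto simp: rank_le_iff)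
    have "kernel (edges G) \<beta> ({..<m} \<union> C) ({..<m} \<union> S)"
    proof (rule kernelI)
      show "finite ({..<m} \<union> S)" using kernel_finite[OF S] by simp
      fix X assume X: "X \<subseteq> ({..<m} \<union> C) - ({..<m} \<union> S)" "connected_set (edges G) X"
      then have "X \<subseteq> C - S" by blast
      then show "\<exists>\<gamma><\<beta>. rank_le (edges G) \<gamma> X" by (rule kernelD[OF S _ X(2)])
    qed
    then show ?thesis using \<beta>(1) rank_leI by blast
  qed
  then obtain \<beta> where \<beta>: "\<beta> < \<alpha>" "rank_le (edges G) \<beta> ({..<m} \<union> C)" by blast
  have "rank_le (edges (piece_graph m G C)) \<beta> ({..<m} \<union> C)"
    by (rule rank_le_subset[OF \<beta>(2)]) (simp_all add: piece_graph_edge)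
  then have "piece_graph m G C \<in> rooted_Rank \<beta> m"
    using V wf_induced_subgraph[OF wf] by (simp add: rooted_Rank_def Rank_iff_rank_le piece_graph_def)
  then show ?thesis using \<beta>(1) by blast
qed

lemma rooted_Rank_zero_countable: "essentially_countable (rooted_minor m) (rooted_Rank 0 m)"
proof (rule essentially_countable_by_invariant[where sig = "\<lambda>G. (vertices G, edges G)"])
  let ?K = "{T :: nat set. finite T} \<times> {F. finite F \<and> F \<subseteq> {T :: nat set. finite T}}"
  show "countable ?K"
    using countable_Collect_finite[where 'a = nat]
    by (intro countable_SIGMA countable_Collect_finite_subset) auto
  show "(vertices G, edges G) \<in> ?K" if "G \<in> rooted_Rank 0 m" for G
  proof -
    have wf: "wf_ugraph G" and fin: "finite (vertices G)"
      using that by (auto simp: rooted_Rank_def Rank.simps[of 0])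
    have sub: "edges G \<subseteq> Pow (vertices G)" using wf by (auto simp: wf_ugraph_def)
    then have "finite (edges G)" using fin finite_subset by blast
    moreover have "finite e" if "e \<in> edges G" for e using sub that fin finite_subset by blast
    ultimately show ?thesis using fin by auto
  qed
  show "rooted_minor m G H" if "(vertices G, edges G) = (vertices H, edges H)" for G H :: "nat ugraph"
    using that rooted_minor_refl[of m G] by (simp add: rooted_minor_def)
qed

lemma essentially_countable_UN:
  assumes "countable I" "\<And>i. i \<in> I \<Longrightarrow> essentially_countable le (Q i)"
  shows "essentially_countable le (\<Union>i\<in>I. Q i)"
proof -
  have "\<forall>i\<in>I. \<exists>C. countable C \<and> C \<subseteq> Q i \<and> (\<forall>x\<in>Q i. \<exists>c\<in>C. le x c \<and> le c x)"
    using assms(2) unfolding essentially_countable_def by blast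
  from bchoice[OF this]
  obtain C where C: "\<forall>i\<in>I. countable (C i) \<and> C i \<subseteq> Q i \<and> (\<forall>x\<in>Q i. \<exists>c\<in>C i. le x c \<and> le c x)" ..
  have "countable (\<Union>i\<in>I. C i)" using assms(1) C by (intro countable_UN) auto
  moreover have "(\<Union>i\<in>I. C i) \<subseteq> (\<Union>i\<in>I. Q i)" using C by blast
  moreover have "\<forall>x\<in>(\<Union>i\<in>I. Q i). \<exists>c\<in>(\<Union>i\<in>I. C i). le x c \<and> le c x"
  proof
    fix x assume "x \<in> (\<Union>i\<in>I. Q i)"
    then obtain i where i: "i \<in> I" "x \<in> Q i" by blast
    then obtain c where "c \<in> C i" "le x c" "le c x" using C by blast
    then show "\<exists>c\<in>(\<Union>i\<in>I. C i). le x c \<and> le c x" using i(1) by blast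
  qed
  ultimately show ?thesis unfolding essentially_countable_def by (intro exI[of _ "\<Union>i\<in>I. C i"]) simp
qed

text \<open>Up to rooted twins, a graph rooted at a kernel is determined by its pieces up to injective
  domination, and by induction the pieces form a well-quasi-order with countably many classes.\<close>

lemma rooted_at_kernel_countable:
  assumes wqo: "wqo_on marked_minor (Rank_marked_below_le m \<alpha>)" and "0 < \<alpha>"
    and IH: "\<And>\<beta>. \<beta> < \<alpha> \<Longrightarrow> essentially_countable (rooted_minor m) (rooted_Rank \<beta> m)"
  shows "essentially_countable (rooted_minor m) (rooted_at_kernel \<alpha> m)"
proof -
  let ?Q = "\<Union>\<beta>\<in>{\<beta>. \<beta> < \<alpha>}. rooted_Rank \<beta> m"
  have cnt: "essentially_countable (rooted_minor m) ?Q"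
    by (rule essentially_countable_UN[OF countable_initial_segment]) (simp add: IH)
  have "?Q = {G \<in> Rank_below \<alpha>. {..<m} \<subseteq> vertices G}" by (auto simp: rooted_Rank_def Rank_below_def)
  then have wqo': "wqo_on (rooted_minor m) ?Q" using rooted_wqo[OF wqo] by simp
  have ctb: "countable (pieces m G)" for G by (simp add: pieces_def)
  have mem: "piece_graph m G C \<in> ?Q" if "G \<in> rooted_at_kernel \<alpha> m" "C \<in> pieces m G" for G C
    using piece_rank[OF that(1) \<open>0 < \<alpha>\<close> that(2)] by blast
  let ?A = "rooted_at_kernel \<alpha> m"
  have "\<exists>(K :: (nat ugraph list \<times> nat ugraph set) set) sig. countable K \<and> sig ` ?A \<subseteq> K \<and>
      (\<forall>G\<in>?A. \<forall>H\<in>?A. sig G = sig H \<longrightarrow>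
        (\<exists>f. inj_on f (pieces m G) \<and> f ` pieces m G \<subseteq> pieces m H \<and>
          (\<forall>C\<in>pieces m G. rooted_minor m (piece_graph m G C) (piece_graph m H (f C)))))"
  proof (rule family_invariant[OF wqo' cnt])
    show "rooted_minor m G K" if "rooted_minor m G H" "rooted_minor m H K" for G H K
      using that by (rule rooted_minor_trans)
  qed (use ctb mem in simp_all)
  then obtain K :: "(nat ugraph list \<times> nat ugraph set) set" and sig where
    "countable K" "sig ` ?A \<subseteq> K"
    and sig: "\<forall>G\<in>?A. \<forall>H\<in>?A. sig G = sig H \<longrightarrow>
      (\<exists>f. inj_on f (pieces m G) \<and> f ` pieces m G \<subseteq> pieces m H \<and>
        (\<forall>C\<in>pieces m G. rooted_minor m (piece_graph m G C) (piece_graph m H (f C))))"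
    by (elim exE conjE)
  show ?thesis
  proof (rule essentially_countable_by_invariant[OF \<open>countable K\<close>])
    show "sig G \<in> K" if "G \<in> rooted_at_kernel \<alpha> m" for G
      using \<open>sig ` _ \<subseteq> K\<close> that by blast
    fix G H assume GH: "G \<in> rooted_at_kernel \<alpha> m" "H \<in> rooted_at_kernel \<alpha> m" "sig G = sig H"
    then obtain f where f: "inj_on f (pieces m G)" "f ` pieces m G \<subseteq> pieces m H"
      "\<forall>C\<in>pieces m G. rooted_minor m (piece_graph m G C) (piece_graph m H (f C))"
      using sig by blast
    show "rooted_minor m G H"
      by (rule glue_pieces[OF _ _ _ f(1,2)]) (use GH(1,2) f(3) in \<open>simp_all add: rooted_at_kernel_def\<close>)
  qed
qed

text \<open>Some relabelling turns a finite set into an initial segment, so that it can serve as the roots.\<close>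

lemma relabelling_exists:
  fixes T :: "nat set"
  assumes "finite T" "{..<n} \<subseteq> T"
  shows "\<exists>f :: nat \<Rightarrow> nat. inj f \<and> (\<forall>i<n. f i = i) \<and> f ` T = {..<card T}"
proof -
  let ?m = "card T"
  have "card (T - {..<n}) = ?m - n" using assms by (simp add: card_Diff_subset)
  moreover have nm: "n \<le> ?m" using card_mono[OF assms] by simp
  ultimately have "card (T - {..<n}) = card {n..<?m}" by simp
  then obtain h where h: "bij_betw h (T - {..<n}) {n..<?m}"
    using assms(1) by (metis finite_Diff finite_atLeastLessThan finite_same_card_bij)
  define f where "f v = (if v < n then v else if v \<in> T then h v else v + ?m)" for v
  have h_range: "n \<le> h v" "h v < ?m" if "v \<in> T" "\<not> v < n" for v
    using bij_betw_apply[OF h, of v] that by auto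
  have "inj f"
  proof (rule injI)
    fix u v assume eq: "f u = f v"
    have cls: "f x < n \<longleftrightarrow> x < n" "f x < ?m \<longleftrightarrow> x \<in> T" for x
      using h_range[of x] nm assms(2) by (auto simp: f_def)
    show "u = v"
    proof (cases "u < n")
      case True
      then show ?thesis using cls(1)[of u] cls(1)[of v] eq by (simp add: f_def)
    next
      case False
      then have v: "\<not> v < n" using cls(1)[of u] cls(1)[of v] eq by simp
      show ?thesis
      proof (cases "u \<in> T")
        case True
        then have "v \<in> T" using cls(2)[of u] cls(2)[of v] eq by simp
        then have "h u = h v" using eq True False v by (simp add: f_def)
        then show ?thesis
          using inj_onD[OF bij_betw_imp_inj_on[OF h], of u v] True \<open>v \<in> T\<close> False v by simp
      next
        case u: False
        then have "v \<notin> T" using cls(2)[of u] cls(2)[of v] eq by simp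
        then show ?thesis using eq u False v by (simp add: f_def)
      qed
    qed
  qed
  moreover have "f ` T = {..<?m}"
  proof -
    have "f ` T = f ` {..<n} \<union> f ` (T - {..<n})" using assms(2) by blast
    also have "f ` {..<n} = {..<n}" by (simp add: f_def)
    also have "f ` (T - {..<n}) = h ` (T - {..<n})" by (rule image_cong) (auto simp: f_def)
    also have "\<dots> = {n..<?m}" by (rule bij_betw_imp_surj_on[OF h])
    also have "{..<n} \<union> {n..<?m} = {..<?m}" using nm by auto
    finally show ?thesis .
  qed
  ultimately show ?thesis by (intro exI[of _ f]) (simp add: f_def)
qed

text \<open>Further roots are added until they form a kernel. Rooted minors with more roots are more
  restrictive, so it suffices to count these.\<close>

lemma relabel_to_kernel:
  assumes "G \<in> rooted_Rank \<alpha> n"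
  shows "\<exists>m f. n \<le> m \<and> inj f \<and> (\<forall>i<n. f i = i) \<and> relabel f G \<in> rooted_at_kernel \<alpha> m"
proof -
  have wf: "wf_ugraph G" and roots: "{..<n} \<subseteq> vertices G" and rk: "graph_rank_le \<alpha> G"
    using assms by (auto simp: rooted_Rank_def Rank_iff_rank_le)
  obtain S where S: "kernel (edges G) \<alpha> (vertices G) S" using rk by (auto simp: rank_le_iff)
  define T where "T = {..<n} \<union> (S \<inter> vertices G)"
  have T: "finite T" "{..<n} \<subseteq> T" "T \<subseteq> vertices G"
    using kernel_finite[OF S] roots by (auto simp: T_def)
  have KT: "kernel (edges G) \<alpha> (vertices G) T" by (rule kernel_superset[OF S T(1)]) (auto simp: T_def)
  obtain f :: "nat \<Rightarrow> nat" where f: "inj f" "\<forall>i<n. f i = i" "f ` T = {..<card T}"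
    using relabelling_exists[OF T(1,2)] by blast
  let ?G = "relabel f G"
  have "kernel (edges ?G) \<alpha> (vertices ?G) {x \<in> vertices ?G. {inv f x} \<inter> T \<noteq> {}}"
    by (rule kernel_model[OF KT unlabel_model[OF f(1)]])
  then have "kernel (edges ?G) \<alpha> (vertices ?G) {..<card T}"
  proof (rule kernel_superset)
    show "{x \<in> vertices ?G. {inv f x} \<inter> T \<noteq> {}} \<inter> vertices ?G \<subseteq> {..<card T}"
      unfolding f(3)[symmetric] using f(1) by (auto simp: relabel_def)
  qed simp
  moreover have "{..<card T} \<subseteq> vertices ?G" unfolding f(3)[symmetric] using T(3)
    by (auto simp: relabel_def)
  ultimately have "?G \<in> rooted_at_kernel \<alpha> (card T)"
    using wf_relabel[OF f(1) wf] by (simp add: rooted_at_kernel_def)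
  moreover have "n \<le> card T" using card_mono[OF T(1,2)] by simp
  ultimately show ?thesis using f(1,2) by blast
qed

lemma relabelled_rooted_minor:
  assumes f: "inj f" and g: "inj g"
    and le: "rooted_minor m (relabel f G) c" "rooted_minor m c (relabel g H)"
  shows "\<exists>B. graph_model B G H \<and> (\<forall>v w. f v < m \<longrightarrow> f v = g w \<longrightarrow> w \<in> B v)"
proof -
  obtain B where B: "graph_model B (relabel f G) (relabel g H)" "\<forall>i<m. i \<in> B i"
    using rooted_minor_trans[OF le] unfolding rooted_minor_def by blast
  let ?B = "\<lambda>v. \<Union>((\<lambda>x. {inv g x}) ` \<Union>(B ` {f v}))"
  have "w \<in> ?B v" if "f v < m" "f v = g w" for v w
  proof -
    have "f v \<in> B (f v)" using B(2) that(1) by blast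
    moreover have "inv g (f v) = w" using inv_f_f[OF g] that(2) by simp
    ultimately show ?thesis by auto
  qed
  moreover have "graph_model ?B G H"
    by (rule set_model_trans[OF set_model_trans[OF relabel_model[OF f] B(1)] unlabel_model[OF g]])
  ultimately show ?thesis by (intro exI[of _ ?B]) blast
qed

lemma rooted_Rank_countable:
  assumes wqo: "\<And>n \<beta>. wqo_on marked_minor (Rank_marked_below_le n \<beta>)"
  shows "essentially_countable (rooted_minor n) (rooted_Rank \<alpha> n)"
proof (induction \<alpha> arbitrary: n rule: less_induct)
  case (less \<alpha>)
  show ?case
  proof (cases "\<alpha> = 0")
    case True
    then show ?thesis using rooted_Rank_zero_countable by simp
  next
    case False
    then have pos: "0 < \<alpha>" using zero_least[of \<alpha>] by simp
    let ?code = "\<lambda>G m G'. \<exists>f. n \<le> m \<and> inj f \<and> (\<forall>i<n. f i = i) \<and> G' = relabel f G"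
    show ?thesis
    proof (rule essentially_countable_by_encoding[where code = ?code])
      show "essentially_countable (rooted_minor m) (rooted_at_kernel \<alpha> m)" for m
        by (rule rooted_at_kernel_countable[OF wqo pos less.IH])
      show "\<exists>m G'. G' \<in> rooted_at_kernel \<alpha> m \<and> ?code G m G'" if "G \<in> rooted_Rank \<alpha> n" for G
        using relabel_to_kernel[OF that] by blast
      fix G H m G' H' c
      assume "?code G m G'" "?code H m H'" and le: "rooted_minor m G' c" "rooted_minor m c H'"
      then obtain f g where f: "n \<le> m" "inj f" "\<forall>i<n. f i = i" "G' = relabel f G"
        and g: "inj g" "\<forall>i<n. g i = i" "H' = relabel g H" by blast
      obtain B where B: "graph_model B G H" "\<forall>v w. f v < m \<longrightarrow> f v = g w \<longrightarrow> w \<in> B v"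
        using relabelled_rooted_minor[OF f(2) g(1) le[unfolded f(4) g(3)]] by blast
      have "\<forall>i<n. i \<in> B i" using B(2) f(1,3) g(2) by simp
      then show "rooted_minor n G H" unfolding rooted_minor_def using B(1) by blast
    qed
  qed
qed

text \<open>Marked vertices become roots, numbered arbitrarily; rooted minors then respect the marks.\<close>

lemma Rank_marked_countable:
  assumes wqo: "\<And>n \<beta>. wqo_on marked_minor (Rank_marked_below_le n \<beta>)"
  shows "essentially_countable marked_minor (Rank_marked \<alpha>)"
proof -
  let ?code = "\<lambda>x n G'. \<exists>f. inj f \<and> f ` snd x = {..<n} \<and> G' = relabel f (fst x)"
  show ?thesis
  proof (rule essentially_countable_by_encoding[OF rooted_Rank_countable[OF wqo], where code = ?code])
    fix x assume "x \<in> Rank_marked \<alpha>"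
    then have x: "fst x \<in> Rank \<alpha>" "snd x \<subseteq> vertices (fst x)" "finite (snd x)"
      by (auto simp: Rank_marked_def)
    obtain f :: "nat \<Rightarrow> nat" where f: "inj f" "f ` snd x = {..<card (snd x)}"
      using relabelling_exists[OF x(3), of 0] by auto
    let ?G = "relabel f (fst x)"
    have "?G \<in> Rank \<alpha>"
      using x(1) wf_relabel[OF f(1)] rank_le_model[OF _ unlabel_model[OF f(1)]]
      unfolding Rank_iff_rank_le by blast
    moreover have "{..<card (snd x)} \<subseteq> vertices ?G"
      unfolding f(2)[symmetric] using x(2) by (auto simp: relabel_def)
    ultimately have "?G \<in> rooted_Rank \<alpha> (card (snd x))" by (simp add: rooted_Rank_def)
    then show "\<exists>n G'. G' \<in> rooted_Rank \<alpha> n \<and> ?code x n G'" using f by blast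
  next
    fix x y n G' H' c
    assume xy: "x \<in> Rank_marked \<alpha>" "y \<in> Rank_marked \<alpha>" and "?code x n G'" "?code y n H'"
      and le: "rooted_minor n G' c" "rooted_minor n c H'"
    then obtain f g where f: "inj f" "f ` snd x = {..<n}" "G' = relabel f (fst x)"
      and g: "inj g" "g ` snd y = {..<n}" "H' = relabel g (fst y)" by blast
    obtain B where B: "graph_model B (fst x) (fst y)" "\<forall>v w. f v < n \<longrightarrow> f v = g w \<longrightarrow> w \<in> B v"
      using relabelled_rooted_minor[OF f(1) g(1) le[unfolded f(3) g(3)]] by blast
    have "B v \<inter> snd y \<noteq> {}" if v: "v \<in> snd x" for v
    proof -
      have "f v \<in> {..<n}" using f(2) v by blast
      moreover from this obtain w where "w \<in> snd y" "f v = g w" unfolding g(2)[symmetric] by blast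
      ultimately show ?thesis using B(2) by blast
    qed
    moreover have "wf_ugraph (fst x)" "wf_ugraph (fst y)" "snd x \<subseteq> vertices (fst x)"
      using xy by (auto simp: Rank_marked_def Rank_iff_rank_le)
    ultimately have "marked_minor (fst x, snd x) (fst y, snd y)"
      using B(1) marked_minor_iff[of "fst x" "fst y" "snd x" "snd y"] by blast
    then show "marked_minor x y" by simp
  qed
qed


section \<open>The equivalences\<close>

text \<open>The final segments of the natural numbers form a descending chain of sets.\<close>

lemma not_wqo_imp_descending_chain:
  assumes "\<not> wqo_on minor connected_rayless_graphs"
  shows "\<exists>\<alpha> q. descending_chain minor (Rank \<alpha>) q"
proof -
  obtain \<alpha> and H :: "nat set \<Rightarrow> nat ugraph" where
    H: "\<forall>X Y. H X \<in> Rank \<alpha> \<and> (minor (H X) (H Y) \<longleftrightarrow> X \<subseteq> Y)"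
    using spread[OF assms] by blast
  have "descending_chain minor (Rank \<alpha>) (\<lambda>n. H {n..})"
    unfolding descending_chain_def
  proof (intro conjI allI)
    show "range (\<lambda>n. H {n..}) \<subseteq> Rank \<alpha>" using H by blast
    show "minor (H {Suc n..}) (H {n..})" for n using H by simp
    show "\<not> minor (H {n..}) (H {Suc n..})" for n using H by simp
  qed
  then show ?thesis by blast
qed

text \<open>Coding each \<open>k\<close> by \<open>2 k\<close> or \<open>2 k + 1\<close>, according to whether it is in \<open>S\<close>, turns different sets
  into incomparable ones.\<close>

lemma not_wqo_imp_antichain:
  assumes "\<not> wqo_on minor connected_rayless_graphs"
  shows "\<exists>A. antichain minor rayless_graphs A \<and> A \<approx> (UNIV :: nat set set)"
proof -
  obtain \<alpha> and H :: "nat set \<Rightarrow> nat ugraph" where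
    H: "\<forall>X Y. H X \<in> Rank \<alpha> \<and> (minor (H X) (H Y) \<longleftrightarrow> X \<subseteq> Y)"
    using spread[OF assms] by blast
  define X where "X S = (\<lambda>k. 2 * k) ` S \<union> (\<lambda>k. 2 * k + 1) ` (- S)" for S :: "nat set"
  have X: "S = T" if "X S \<subseteq> X T" for S T
  proof -
    have "2 * k \<in> X U \<longleftrightarrow> k \<in> U" "2 * k + 1 \<in> X U \<longleftrightarrow> k \<notin> U" for k U
      unfolding X_def by (auto, presburger+)
    then show ?thesis using that by (metis subsetD subsetI subset_antisym)
  qed
  have inj: "inj (\<lambda>S. H (X S))"
  proof (rule injI)
    fix S T assume eq: "H (X S) = H (X T)"
    have "minor (H (X S)) (H (X S))" using H by simp
    then have "minor (H (X S)) (H (X T))" using eq by simp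
    then have "X S \<subseteq> X T" using H by simp
    then show "S = T" by (rule X)
  qed
  have "antichain minor rayless_graphs (range (\<lambda>S. H (X S)))"
    unfolding antichain_def
  proof (intro conjI pairwiseI)
    show "range (\<lambda>S. H (X S)) \<subseteq> rayless_graphs" using H Rank_rayless by blast
    fix G K assume "G \<in> range (\<lambda>S. H (X S))" "K \<in> range (\<lambda>S. H (X S))" "G \<noteq> K"
    then obtain S T where ST: "G = H (X S)" "K = H (X T)" "S \<noteq> T" by blast
    then have "\<not> X S \<subseteq> X T" "\<not> X T \<subseteq> X S" using X[of S T] X[of T S] by auto
    then show "\<not> minor G K" "\<not> minor K G" unfolding ST(1,2) using H by simp_all
  qed
  moreover have "range (\<lambda>S. H (X S)) \<approx> (UNIV :: nat set set)"
    by (rule inj_on_image_eqpoll_self[OF inj])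
  ultimately show ?thesis by blast
qed

lemma not_wqo_imp_many_classes:
  assumes "\<not> wqo_on minor connected_rayless_graphs"
  shows "\<exists>\<alpha>. \<not> twin_classes minor (Rank \<alpha>) \<prec> (UNIV :: nat set set)"
proof -
  obtain \<alpha> and H :: "nat set \<Rightarrow> nat ugraph" where
    H: "\<forall>X Y. H X \<in> Rank \<alpha> \<and> (minor (H X) (H Y) \<longleftrightarrow> X \<subseteq> Y)"
    using spread[OF assms] by blast
  let ?R = "{(G, K). G \<in> Rank \<alpha> \<and> K \<in> Rank \<alpha> \<and> minor G K \<and> minor K G}"
  let ?c = "\<lambda>X. ?R `` {H X}"
  have self: "H X \<in> ?c X" for X using H by simp
  have "inj ?c"
  proof (rule injI)
    fix X Y assume "?c X = ?c Y"
    then have "H X \<in> ?c Y" using self[of X] by simp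
    then have "minor (H X) (H Y)" "minor (H Y) (H X)" by simp_all
    then have "X \<subseteq> Y" "Y \<subseteq> X" using H by simp_all
    then show "X = Y" by (rule subset_antisym)
  qed
  moreover have "range ?c \<subseteq> twin_classes minor (Rank \<alpha>)"
    unfolding twin_classes_def using H by (intro image_subsetI quotientI) simp
  ultimately have "(UNIV :: nat set set) \<lesssim> twin_classes minor (Rank \<alpha>)"
    unfolding lepoll_def by blast
  then have "\<not> twin_classes minor (Rank \<alpha>) \<prec> (UNIV :: nat set set)"
    using lesspoll_trans1 lesspoll_not_refl by blast
  then show ?thesis by blast
qed

lemma wqo_on_subset: "wqo_on le Q \<Longrightarrow> P \<subseteq> Q \<Longrightarrow> wqo_on le P"
  unfolding wqo_on_def by (meson subset_trans)

text \<open>The ranks occurring in a single sequence are bounded.\<close>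

lemma bounded_rank_wqo_imp_wqo:
  assumes "\<And>\<alpha>. wqo_on marked_minor (Rank_marked_below_le 0 \<alpha>)"
  shows "wqo_on minor rayless_graphs"
  unfolding wqo_on_def
proof (intro allI impI)
  fix q :: "nat \<Rightarrow> nat ugraph" assume q: "range q \<subseteq> rayless_graphs"
  have "\<forall>n. \<exists>\<beta>. q n \<in> Rank \<beta>" using q rayless_in_Rank by blast
  from choice[OF this] obtain r where r: "\<forall>n. q n \<in> Rank (r n)" ..
  have "countable (range r)" by simp
  from countable_bounded[OF this] obtain \<alpha> where \<alpha>: "\<forall>\<beta>\<in>range r. \<beta> < \<alpha>" ..
  have "q n \<in> Rank_below \<alpha>" for n using r \<alpha> unfolding Rank_below_def by blast
  then have "range (\<lambda>n. (q n, {})) \<subseteq> Rank_marked_below_le 0 \<alpha>" by (auto simp: Rank_marked_below_le_def)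
  then have "\<exists>i j. i < j \<and> marked_minor (q i, {}) (q j, {})"
    using assms[of \<alpha>] unfolding wqo_on_def by (elim allE[of _ "\<lambda>n. (q n, {})"]) simp
  moreover have "wf_ugraph (q n)" for n using q by (auto simp: rayless_graphs_def)
  ultimately show "\<exists>i j. i < j \<and> minor (q i) (q j)" by (simp add: marked_minor_unmarked)
qed

lemma wqo_imp_no_descending_chain:
  assumes "wqo_on le Q"
    and trans: "\<And>x y z. x \<in> Q \<Longrightarrow> y \<in> Q \<Longrightarrow> z \<in> Q \<Longrightarrow> le x y \<Longrightarrow> le y z \<Longrightarrow> le x z"
  shows "\<not> descending_chain le Q q"
proof
  assume chain: "descending_chain le Q q"
  then have q: "\<And>n. q n \<in> Q" and down: "\<And>n. le (q (Suc n)) (q n)"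
    and strict: "\<And>n. \<not> le (q n) (q (Suc n))"
    unfolding descending_chain_def by auto
  have "range q \<subseteq> Q" using q by blast
  then obtain i j where ij: "i < j" "le (q i) (q j)" using assms(1) unfolding wqo_on_def by blast
  have "le (q i) (q (Suc i + k)) \<longrightarrow> le (q i) (q (Suc i))" for k
  proof (induction k)
    case (Suc k)
    then show ?case using trans[OF q q q _ down[of "Suc i + k"], of i] by simp
  qed simp
  moreover obtain k where "j = Suc i + k" using less_imp_Suc_add[OF ij(1)] by auto
  ultimately show False using ij(2) strict by blast
qed

lemma wqo_imp_finite_antichains:
  assumes "wqo_on le Q" "antichain le Q A"
  shows "finite A"
proof (rule ccontr)
  assume "infinite A"
  then obtain f :: "nat \<Rightarrow> _" where f: "inj f" "range f \<subseteq> A" using infinite_countable_subset by blast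
  have "range f \<subseteq> Q" using f(2) assms(2) unfolding antichain_def by blast
  then obtain i j where ij: "i < j" "le (f i) (f j)" using assms(1) unfolding wqo_on_def by blast
  then have "f i \<noteq> f j" using injD[OF f(1)] by blast
  moreover have "f i \<in> A" "f j \<in> A" using f(2) by auto
  ultimately show False using assms(2) ij(2) unfolding antichain_def pairwise_def by blast
qed

lemma rayless_marked_trans:
  assumes "x \<in> rayless_marked" "y \<in> rayless_marked" "z \<in> rayless_marked"
    and "marked_minor x y" "marked_minor y z"
  shows "marked_minor x z"
  using assms marked_minor_trans[of "fst x" "fst y" "fst z" "snd x" "snd y" "snd z"]
  by (auto simp: rayless_marked_def rayless_graphs_def)

lemma Rank_marked_subset: "Rank_marked \<alpha> \<subseteq> rayless_marked"
  using Rank_rayless by (auto simp: Rank_marked_def rayless_marked_def)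

lemma countable_marked_classes_imp:
  assumes "countable (twin_classes marked_minor (Rank_marked \<alpha>))"
  shows "countable (twin_classes minor (Rank \<alpha>))"
proof -
  let ?R = "{(G, K). G \<in> Rank \<alpha> \<and> K \<in> Rank \<alpha> \<and> minor G K \<and> minor K G}"
  let ?R' = "{(x, y). x \<in> Rank_marked \<alpha> \<and> y \<in> Rank_marked \<alpha> \<and> marked_minor x y \<and> marked_minor y x}"
  have unmarked: "G \<in> Rank \<alpha> \<longleftrightarrow> (G, {}) \<in> Rank_marked \<alpha>" for G by (simp add: Rank_marked_def)
  have iff: "marked_minor (G, {}) (K, {}) \<longleftrightarrow> minor G K" if "G \<in> Rank \<alpha>" "K \<in> Rank \<alpha>" for G K
    using that by (simp add: marked_minor_unmarked Rank_iff_rank_le)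
  have "twin_classes minor (Rank \<alpha>) \<subseteq> (\<lambda>X. {G. (G, {}) \<in> X}) ` twin_classes marked_minor (Rank_marked \<alpha>)"
  proof
    fix X assume "X \<in> twin_classes minor (Rank \<alpha>)"
    then obtain G where G: "G \<in> Rank \<alpha>" "X = ?R `` {G}"
      unfolding twin_classes_def by (auto elim: quotientE)
    have "X = {K. (K, {}) \<in> ?R' `` {(G, {})}}"
      unfolding G(2) using G(1) unmarked iff by auto
    moreover have "?R' `` {(G, {})} \<in> twin_classes marked_minor (Rank_marked \<alpha>)"
      unfolding twin_classes_def using G(1) unmarked by (intro quotientI) simp
    ultimately show "X \<in> (\<lambda>X. {G. (G, {}) \<in> X}) ` twin_classes marked_minor (Rank_marked \<alpha>)" by blast
  qed
  then show ?thesis using assms by (meson countable_image countable_subset)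
qed

lemma countable_lesspoll_continuum:
  assumes "countable A"
  shows "A \<prec> (UNIV :: nat set set)"
proof -
  have "A \<lesssim> (UNIV :: nat set)" using assms by (auto simp: countable_def lepoll_def)
  moreover have "(UNIV :: nat set) \<prec> (UNIV :: nat set set)"
    using lesspoll_Pow_self[of "UNIV :: nat set"] by simp
  ultimately show ?thesis by (rule lesspoll_trans1)
qed

lemma all_equivalentI: "(\<And>P. P \<in> set Ps \<Longrightarrow> P \<longleftrightarrow> Q) \<Longrightarrow> all_equivalent Ps"
  unfolding all_equivalent_def by blast

theorem theorem10p1:
  shows "all_equivalent
    [ \<comment> \<open>(a)\<close> wqo_on minor rayless_graphs,
      \<comment> \<open>(b)\<close> wqo_on marked_minor rayless_marked,
      \<comment> \<open>(c)\<close> (\<forall>n. wqo_on marked_minor (rayless_marked_le n)),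
      \<comment> \<open>(d)\<close> (\<forall>n. \<forall>\<alpha>. wqo_on marked_minor (Rank_marked_below_le n \<alpha>)),
      \<comment> \<open>(e)\<close> (\<not> (\<exists>q. descending_chain minor rayless_graphs q)),
      \<comment> \<open>(f)\<close> (\<forall>\<alpha>. \<not> (\<exists>q. descending_chain minor (Rank \<alpha>) q)),
      \<comment> \<open>(g)\<close> (\<not> (\<exists>q. descending_chain marked_minor rayless_marked q)),
      \<comment> \<open>(h)\<close> (\<not> (\<exists>A. antichain minor rayless_graphs A \<and> infinite A)),
      \<comment> \<open>(i)\<close> (\<not> (\<exists>A. antichain minor rayless_graphs A \<and> A \<approx> (UNIV :: nat set set))),
      \<comment> \<open>(j)\<close> (\<forall>\<alpha>. countable (twin_classes minor (Rank \<alpha>))),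
      \<comment> \<open>(k)\<close> (\<forall>\<alpha>. countable (twin_classes marked_minor (Rank_marked \<alpha>))),
      \<comment> \<open>(l)\<close> (\<forall>\<alpha>. twin_classes minor (Rank \<alpha>) \<prec> (UNIV :: nat set set)) ]"
    (is "all_equivalent [?a, ?b, ?c, ?d, ?e, ?f, ?g, ?h, ?i, ?j, ?k, ?l]")
proof -
  let ?con = "wqo_on minor connected_rayless_graphs"
  \<comment> \<open>The implications run through \<open>?con\<close> in four cycles: b, c, d, a; then b, g, e, f; then b, c, d, a, h, i;
    and b, c, d, k, j, l.\<close>
  have con_b: ?b if ?con using that by (rule connected_wqo_imp_marked_wqo)
  have b_c: ?c if ?b
    using that by (intro allI wqo_on_subset[OF that]) (auto simp: rayless_marked_le_def)
  have c_d: ?d if ?c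
  proof (intro allI)
    fix n \<alpha>
    have "Rank_marked_below_le n \<alpha> \<subseteq> rayless_marked_le n"
      using Rank_rayless
      by (auto simp: Rank_marked_below_le_def Rank_below_def rayless_marked_le_def rayless_marked_def)
    then show "wqo_on marked_minor (Rank_marked_below_le n \<alpha>)" using that wqo_on_subset by blast
  qed
  have d_a: ?a if ?d using that by (intro bounded_rank_wqo_imp_wqo) simp
  have a_con: ?con if ?a
    by (rule wqo_on_subset[OF that]) (auto simp: connected_rayless_graphs_def)
  have b_g: ?g if ?b
  proof
    assume "\<exists>q. descending_chain marked_minor rayless_marked q"
    then obtain q where q: "descending_chain marked_minor rayless_marked q" ..
    have "\<not> descending_chain marked_minor rayless_marked q"
      by (rule wqo_imp_no_descending_chain[OF that]) (rule rayless_marked_trans)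
    then show False using q by simp
  qed
  have g_e: ?e if ?g
  proof
    assume "\<exists>q. descending_chain minor rayless_graphs q"
    then obtain q where q: "descending_chain minor rayless_graphs q" ..
    have "wf_ugraph (q n)" for n using q by (auto simp: descending_chain_def rayless_graphs_def)
    then have "descending_chain marked_minor rayless_marked (\<lambda>n. (q n, {}))"
      using q by (auto simp: descending_chain_def marked_minor_unmarked rayless_marked_def)
    then show False using that by blast
  qed
  have e_f: ?f if ?e
    using that Rank_rayless unfolding descending_chain_def by (meson order_trans)
  have f_con: ?con if ?f using not_wqo_imp_descending_chain that by blast
  have a_h: ?h if ?a using wqo_imp_finite_antichains[OF that] by blast
  have h_i: ?i if ?h
  proof
    assume "\<exists>A. antichain minor rayless_graphs A \<and> A \<approx> (UNIV :: nat set set)"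
    then obtain A where A: "antichain minor rayless_graphs A" "A \<approx> (UNIV :: nat set set)" by blast
    have "infinite (UNIV :: nat set set)" by (simp add: Finite_Set.finite_set)
    then have "infinite A" using eqpoll_finite_iff[OF A(2)] by simp
    then show False using that A(1) by blast
  qed
  have i_con: ?con if ?i using not_wqo_imp_antichain that by blast
  have d_k: ?k if ?d
  proof
    fix \<alpha>
    have "essentially_countable marked_minor (Rank_marked \<alpha>)"
      by (rule Rank_marked_countable) (use that in simp)
    then show "countable (twin_classes marked_minor (Rank_marked \<alpha>))"
    proof (rule countable_twin_classes)
      fix x y z assume "x \<in> Rank_marked \<alpha>" "y \<in> Rank_marked \<alpha>" "z \<in> Rank_marked \<alpha>"
        and le: "marked_minor x y" "marked_minor y z"
      then have "x \<in> rayless_marked" "y \<in> rayless_marked" "z \<in> rayless_marked"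
        using Rank_marked_subset by auto
      then show "marked_minor x z" using le by (rule rayless_marked_trans)
    qed
  qed
  have k_j: ?j if ?k using that countable_marked_classes_imp by blast
  have j_l: ?l if ?j using that countable_lesspoll_continuum by blast
  have l_con: ?con if ?l using not_wqo_imp_many_classes that by blast
  have iffs: "?a \<longleftrightarrow> ?con" "?b \<longleftrightarrow> ?con" "?c \<longleftrightarrow> ?con" "?d \<longleftrightarrow> ?con" "?e \<longleftrightarrow> ?con" "?f \<longleftrightarrow> ?con"
    "?g \<longleftrightarrow> ?con" "?h \<longleftrightarrow> ?con" "?i \<longleftrightarrow> ?con" "?j \<longleftrightarrow> ?con" "?k \<longleftrightarrow> ?con" "?l \<longleftrightarrow> ?con"
    using con_b b_c c_d d_a a_con b_g g_e e_f f_con a_h h_i i_con d_k k_j j_l l_con by argo+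
  show ?thesis
    by (rule all_equivalentI[where Q = ?con]) (simp only: iffs list.set insert_iff empty_iff, blast)
qed

end
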